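(* Let $M:=\sup\{s:\ s\in\operatorname{supp}(\omega_0)\}\in(\tfrac12,1]$ and $w:=\inf\{s:\ s\in\operatorname{supp}(\omega_0)\}\in[0,\tfrac12)$, where $\operatorname{supp}(\omega_0)$ denotes the support of the law of $\omega_0$ under $P$. Then $$\limsup_{n\to\infty}\frac{\xi^*(n)}{n}=\frac{(2M-1)(1-2w)}{2(M-w)\min\{M,1-w\}},\qquad \mathbb{P}\text{-a.s.}$$ In particular, if $M=1-w$, then $$\limsup_{n\to\infty}\frac{\xi^*(n)}{n}=\frac{2M-1}{2M},\qquad \mathbb{P}\text{-a.s.}$$
   Context: Random walk in random environment (RWRE) on $\mathbb{Z}_+=\{0,1,2,\dots\}$. Let $\omega=(\omega_x)_{x\in\mathbb{Z}}$ be i.i.d. random variables with values in $(0,1)$, and let $P$ be the distribution of $\omega$ on $\Omega=(0,1)^{\mathbb{Z}}$. For each $\omega$, under $P_\omega$ the process $(X_n)_{n\ge 0}$ is the time-homogeneous Markov chain on $\mathbb{Z}_+$ with $X_0=0$, $P_\omega[X_{n+1}=1\mid X_n=0]=1$, and, for $x>0$, $P_\omega[X_{n+1}=x+1\mid X_n=x]=\omega_x=1-P_\omega[X_{n+1}=x-1\mid X_n=x]$. The joint law of $(\omega,(X_n))$ is $\mathbb{P}[F\times G]=\int_F P_\omega[G]\,P(d\omega)$. Put $\rho_i=(1-\omega_i)/\omega_i$. Standing assumptions: (1) $\int\log\rho_0(\omega)\,P(d\omega)=0$; (2) $P[\delta\le\omega_0\le 1-\delta]=1$ for some $\delta\in(0,1)$;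 (3) $\operatorname{Var}(\log\rho_0)>0$. Local time: $\xi(n,x):=|\{0\le j\le n:\ X_j=x\}|$; maximal local time: $\xi^*(n):=\sup_{x\in\mathbb{Z}}\xi(n,x)$. *)

theory Defs
  imports "HOL-Probability.Probability"
begin

text \<open>The space \<open>\<Omega> = (0,1)\<^sup>\<int>\<close> of environments and the space of trajectories in \<open>\<int>\<^sub>+\<close>, both with the
  product \<open>\<sigma>\<close>-algebra.\<close>

definition env_space :: "(int \<Rightarrow> real) measure" where
  "env_space = Pi\<^sub>M UNIV (\<lambda>_. restrict_space borel {0<..<1})"

definition path_space :: "(nat \<Rightarrow> nat) measure" where
  "path_space = Pi\<^sub>M UNIV (\<lambda>_. count_space UNIV)"

definition iid_env_law :: "(int \<Rightarrow> real) measure \<Rightarrow> bool" where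
  "iid_env_law P \<longleftrightarrow>
     prob_space P \<and> sets P = sets env_space \<and>
     prob_space.indep_vars P (\<lambda>_. borel) (\<lambda>x \<omega>. \<omega> x) UNIV \<and>
     (\<forall>x. distr P borel (\<lambda>\<omega>. \<omega> x) = distr P borel (\<lambda>\<omega>. \<omega> 0))"

definition \<rho> :: "int \<Rightarrow> (int \<Rightarrow> real) \<Rightarrow> real" where
  "\<rho> i \<omega> = (1 - \<omega> i) / \<omega> i"

definition transition :: "(int \<Rightarrow> real) \<Rightarrow> nat \<Rightarrow> nat \<Rightarrow> real" where
  "transition \<omega> x y =
     (if x = 0 then (if y = 1 then 1 else 0)
      else if y = x + 1 then \<omega> (int x)
      else if y = x - 1 then 1 - \<omega> (int x)
      else 0)"

text \<open>\<open>Q\<close> is the law, on trajectories, of the time-homogeneous Markov chain started at \<open>0\<close> with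
  transition matrix \<open>transition \<omega>\<close>; the transition law is imposed given every history of positive
  probability, because \<open>cond_prob\<close> is \<open>0\<close> when the conditioning event is null.\<close>

definition quenched_law :: "(int \<Rightarrow> real) \<Rightarrow> (nat \<Rightarrow> nat) measure \<Rightarrow> bool" where
  "quenched_law \<omega> Q \<longleftrightarrow>
     prob_space Q \<and> sets Q = sets path_space \<and>
     \<P>(X in Q. X 0 = 0) = 1 \<and>
     (\<forall>n x y. \<P>(X in Q. \<forall>i\<le>n. X i = x i) > 0 \<longrightarrow>
        \<P>(X in Q. X (Suc n) = y \<bar> \<forall>i\<le>n. X i = x i) = transition \<omega> (x n) y)"

text \<open>\<open>J\<close> is the joint law of environment and walk, with \<open>Pq \<omega>\<close> in the role of \<open>P\<^sub>\<omega>\<close>. Rectangles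
  form an intersection-stable generator, so this determines \<open>J\<close>.\<close>

definition joint_law ::
  "(int \<Rightarrow> real) measure \<Rightarrow> ((int \<Rightarrow> real) \<Rightarrow> (nat \<Rightarrow> nat) measure) \<Rightarrow>
   ((int \<Rightarrow> real) \<times> (nat \<Rightarrow> nat)) measure \<Rightarrow> bool" where
  "joint_law P Pq J \<longleftrightarrow>
     prob_space J \<and> sets J = sets (P \<Otimes>\<^sub>M path_space) \<and>
     (\<forall>F\<in>sets P. \<forall>G\<in>sets path_space.
        emeasure J (F \<times> G) = (\<integral>\<^sup>+\<omega>\<in>F. emeasure (Pq \<omega>) G \<partial>P))"

definition topological_support :: "'a::topological_space measure \<Rightarrow> 'a set" where
  "topological_support \<mu> = {s. \<forall>U. open U \<and> s \<in> U \<longrightarrow> emeasure \<mu> U > 0}"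

definition local_time :: "(nat \<Rightarrow> nat) \<Rightarrow> nat \<Rightarrow> int \<Rightarrow> nat" where
  "local_time X n x = card {j. j \<le> n \<and> int (X j) = x}"

text \<open>The supremum is over a set of naturals bounded by \<open>n + 1\<close>, so it is a genuine maximum.\<close>

definition max_local_time :: "(nat \<Rightarrow> nat) \<Rightarrow> nat \<Rightarrow> nat" where
  "max_local_time X n = (SUP x::int. local_time X n x)"

end

theory Submission
  imports Defs "HOL-Real_Asymp.Real_Asymp"
begin

text \<open>The walk is reversible. With conductances \<open>c k = \<Prod>i=1..k. \<omega> i / (1 - \<omega> i)\<close> on the edges
  \<open>{k, k + 1}\<close>, the measure \<open>\<mu> x = c (x - 1) + c x\<close> satisfies detailed balance. The constant in the
  theorem is \<open>1 / \<theta>\<close>, where \<open>\<theta>\<close> (\<open>return_time\<close>) is the least possible mean return time to a site: in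
  an environment with values in \<open>[w, M]\<close>, an excursion to the right of \<open>x\<close> lasts on average at least as
  long as in the environment that is constantly \<open>w\<close>, an excursion to the left at least as long as in
  the one that is constantly \<open>M\<close>, and the mean return time \<open>1 + s / (1 - 2 * w) + (1 - s) / (2 * M - 1)\<close>,
  with \<open>s = \<omega> x\<close>, is affine in \<open>s\<close>, so that its minimum over \<open>[w, M]\<close> is at an endpoint.

  Upper bound. Fix a site \<open>x\<close> and let \<open>g\<close> be the function which is linear on both sides of \<open>x\<close>, with
  slopes \<open>1 / (1 - 2 * w)\<close> and \<open>1 / (2 * M - 1)\<close>, and let \<open>T n\<close> be the local time of \<open>x\<close>. Then
  \<open>g (X n) + n - \<theta> * T (n - 1)\<close> is a submartingale, except for a bounded error at each visit to the
  reflecting site \<open>0\<close>. Its increments are bounded uniformly in \<open>x\<close>, so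
  it is exponentially unlikely to lose more than \<open>\<epsilon> * n\<close>, and a union bound over all sites and times up to \<open>n\<close>
  costs only a factor \<open>(n + 1)\<^sup>2\<close>. At the last visit to \<open>x\<close> the function \<open>g\<close> vanishes, and the inequality
  becomes \<open>\<theta> * T n \<le> (1 + \<epsilon>) * n\<close>. The error is governed by the number of visits to \<open>0\<close>, which is
  \<open>o(n)\<close> because \<open>\<Sum>k. c k\<close> diverges (\<open>origin_visits_negligible\<close>, \<open>max_local_time_upper\<close>).

  Lower bound. Suppose that the environment is almost \<open>M\<close> on a long stretch to the left of \<open>b\<close>, almost \<open>w\<close>
  on a long stretch to the right of it, that \<open>\<mu>\<close> puts little mass on the rest of \<open>[0, d)\<close>, and that the
  expected time to reach \<open>b\<close> is small compared with \<open>\<mu> b / \<mu> d\<close>. Then for suitable \<open>n\<close> the walk soon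
  reaches \<open>b\<close>, does not reach \<open>d\<close> before time \<open>n\<close>, and spends nearly all its time in the stretch around
  \<open>b\<close>, where its mean return time to \<open>b\<close> is nearly \<open>\<theta>\<close> if \<open>\<omega> b\<close> is near the better one of \<open>w\<close> and \<open>M\<close>.
  What makes this short is reversibility: after the first visit to \<open>b\<close>, the walk is at \<open>y\<close> at any given
  time with probability at most \<open>\<mu> y / \<mu> b\<close> (\<open>occupation_after_hitting\<close>, \<open>valley_local_time\<close>).

  Almost every environment contains infinitely many such valleys. In terms of \<open>Y k = (\<Sum>y\<le>k. c y) / c k\<close>
  the expected time to reach \<open>b\<close> is at most \<open>2 * (\<Sum>k<b. Y k)\<close>, and little mass to the left of \<open>b\<close> means
  that \<open>Y\<close> is bounded just before the stretch. Now \<open>Y (k + 1) = 1 + exp \<xi> * Y k\<close> with \<open>\<xi> = log \<rho>\<close> at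
  \<open>k + 1\<close>, so \<open>log Y\<close> behaves like a centred random walk reflected near \<open>0\<close>. Before it first exceeds \<open>r\<close>,
  it visits a fixed neighbourhood of \<open>0\<close> at least of order \<open>r\<close> times on average
  (\<open>expected_low_visits\<close>). After each of these visits the desired stretch follows with a fixed
  probability, and then the potential climbs to \<open>2 * r\<close> without a deep return with probability of order
  \<open>1 / r\<close> (\<open>climb_succeeds\<close>). Successes at different visits hardly overlap, so on every scale \<open>r\<close> there is a
  valley with a probability that is bounded below given the past, and valleys occur infinitely often
  (\<open>deep_valleys_recur\<close>).

  Finally, the limit is a constant and its event concerns the trajectory alone. Hence the defining
  property of the joint law on a single rectangle turns the quenched statement into the theorem.\<close>

section \<open>Finite paths of the quenched walk\<close>

definition hist :: "(nat \<Rightarrow> nat) \<Rightarrow> nat \<Rightarrow> nat list" where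
  "hist X n = map X [0..<Suc n]"

primrec paths :: "nat \<Rightarrow> nat list set" where
  "paths 0 = {[0]}"
| "paths (Suc n) = (\<lambda>(l, y). l @ [y]) ` (SIGMA l:paths n. {last l + 1, last l - 1})"

definition up :: "(int \<Rightarrow> real) \<Rightarrow> nat \<Rightarrow> real" where
  "up \<omega> x = (if x = 0 then 1 else \<omega> (int x))"

definition weight :: "(int \<Rightarrow> real) \<Rightarrow> nat list \<Rightarrow> real" where
  "weight \<omega> l = (\<Prod>i<length l - 1. transition \<omega> (l ! i) (l ! Suc i))"

text \<open>The expectation of \<open>f\<close> under the law of the first \<open>n\<close> steps. As the walk has at most two choices
  in each step, it is a finite sum, which spares all questions of integrability.\<close>

definition path_sum :: "(int \<Rightarrow> real) \<Rightarrow> nat \<Rightarrow> (nat list \<Rightarrow> real) \<Rightarrow> real" where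
  "path_sum \<omega> n f = (\<Sum>l\<in>paths n. weight \<omega> l * f l)"

lemma hist_Suc: "hist X (Suc n) = hist X n @ [X (Suc n)]"
  by (simp add: hist_def)

lemma hist_0 [simp]: "hist X 0 = [X 0]"
  by (simp add: hist_def)

lemma length_hist [simp]: "length (hist X n) = Suc n"
  by (simp add: hist_def)

lemma last_hist [simp]: "last (hist X n) = X n"
  by (simp add: hist_def)

lemma hist_nth: "i \<le> n \<Longrightarrow> hist X n ! i = X i"
  unfolding hist_def by (subst nth_map) (auto simp: less_Suc_eq_le simp del: upt_Suc)

lemma paths_length: "l \<in> paths n \<Longrightarrow> length l = Suc n"
  by (induction n arbitrary: l) auto

lemma finite_paths [simp]: "finite (paths n)"
  by (induction n) auto

lemma transition_succ: "transition \<omega> x (x + 1) = up \<omega> x"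
  by (simp add: transition_def up_def)

text \<open>For \<open>x = 0\<close> the truncated difference makes this the probability \<open>0\<close> of staying at \<open>0\<close>, so that
  the reflecting site needs no special treatment in \<open>path_sum_Suc\<close>.\<close>

lemma transition_pred: "transition \<omega> x (x - 1) = 1 - up \<omega> x"
  by (auto simp: transition_def up_def)

lemma weight_snoc: "l \<noteq> [] \<Longrightarrow> weight \<omega> (l @ [y]) = weight \<omega> l * transition \<omega> (last l) y"
proof -
  assume "l \<noteq> []"
  then obtain k where k: "length l = Suc k" by (cases l) auto
  then have "last l = l ! k" by (metis \<open>l \<noteq> []\<close> diff_Suc_1 last_conv_nth)
  moreover have "(\<Prod>i<k. transition \<omega> ((l @ [y]) ! i) ((l @ [y]) ! Suc i)) = (\<Prod>i<k. transition \<omega> (l ! i) (l ! Suc i))"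
    by (rule prod.cong) (auto simp: nth_append k)
  ultimately show ?thesis
    by (simp add: weight_def k) (simp add: nth_append k)
qed

lemma path_sum_0: "path_sum \<omega> 0 f = f [0]"
  by (simp add: path_sum_def weight_def)

text \<open>The Markov property in the only form that is used below.\<close>

lemma path_sum_Suc:
  "path_sum \<omega> (Suc n) f = path_sum \<omega> n (\<lambda>l. up \<omega> (last l) * f (l @ [last l + 1])
     + (1 - up \<omega> (last l)) * f (l @ [last l - 1]))"
proof -
  have inj: "inj_on (\<lambda>(l, y). l @ [y]) (SIGMA l:paths n. {last l + 1, last l - 1})"
    by (auto simp: inj_on_def)
  have ne: "l \<noteq> []" if "l \<in> paths n" for l using paths_length[OF that] by auto
  have "path_sum \<omega> (Suc n) f = (\<Sum>(l, y)\<in>(SIGMA l:paths n. {last l + 1, last l - 1}). weight \<omega> (l @ [y]) * f (l @ [y]))"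
    unfolding path_sum_def paths.simps by (subst sum.reindex[OF inj]) (auto intro!: sum.cong)
  also have "\<dots> = (\<Sum>l\<in>paths n. \<Sum>y\<in>{last l + 1, last l - 1}. weight \<omega> (l @ [y]) * f (l @ [y]))"
    by (subst sum.Sigma) auto
  also have "\<dots> = (\<Sum>l\<in>paths n. weight \<omega> l * (up \<omega> (last l) * f (l @ [last l + 1])
     + (1 - up \<omega> (last l)) * f (l @ [last l - 1])))"
  proof (rule sum.cong[OF refl])
    fix l assume l: "l \<in> paths n"
    have "last l + 1 \<noteq> last l - 1" by simp
    then show "(\<Sum>y\<in>{last l + 1, last l - 1}. weight \<omega> (l @ [y]) * f (l @ [y])) = weight \<omega> l * (up \<omega> (last l) * f (l @ [last l + 1])
     + (1 - up \<omega> (last l)) * f (l @ [last l - 1]))"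
      by (simp add: weight_snoc[OF ne[OF l]] transition_succ[simplified] transition_pred[simplified] algebra_simps)
  qed
  finally show ?thesis by (simp add: path_sum_def)
qed

lemma path_sum_const: "path_sum \<omega> n (\<lambda>_. a) = a"
  by (induction n) (simp_all add: path_sum_0 path_sum_Suc algebra_simps)

locale quenched_walk =
  fixes \<omega> :: "int \<Rightarrow> real" and Q :: "(nat \<Rightarrow> nat) measure"
  assumes law: "quenched_law \<omega> Q" and pos: "0 < \<omega> x" and less1: "\<omega> x < 1"
begin

lemma up_bounds: "0 < up \<omega> x" "up \<omega> x \<le> 1"
  using pos less1 by (auto simp: up_def less_imp_le)

lemma transition_nonneg: "0 \<le> transition \<omega> x y"
  using pos less1 by (auto simp: transition_def less_imp_le)

lemma weight_nonneg: "0 \<le> weight \<omega> l"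
  unfolding weight_def by (intro prod_nonneg) (auto simp: transition_nonneg)

lemma path_sum_mono: "(\<And>l. l \<in> paths n \<Longrightarrow> f l \<le> g l) \<Longrightarrow> path_sum \<omega> n f \<le> path_sum \<omega> n g"
  unfolding path_sum_def by (intro sum_mono mult_left_mono) (auto simp: weight_nonneg)

sublocale Q: prob_space Q using law by (simp add: quenched_law_def)

lemma sets_Q: "sets Q = sets path_space" using law by (simp add: quenched_law_def)

lemma space_Q [simp]: "space Q = UNIV"
  using sets_eq_imp_space_eq[OF sets_Q] by (simp add: path_space_def space_PiM)

lemma coord_measurable [measurable]: "(\<lambda>X. X i) \<in> measurable Q (count_space UNIV)"
proof -
  have "(\<lambda>X. X i) \<in> measurable path_space (count_space UNIV)"
    unfolding path_space_def by measurable
  then show ?thesis by (simp add: measurable_cong_sets[OF sets_Q refl])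
qed

lemma hist_measurable [measurable]: "(\<lambda>X. hist X n) \<in> measurable Q (count_space UNIV)"
proof (induction n)
  case 0
  have "(\<lambda>x. [x]) \<in> measurable (count_space UNIV) (count_space UNIV)" by simp
  from measurable_compose[OF coord_measurable[of 0] this] show ?case by simp
next
  case (Suc n)
  have "(\<lambda>X. (\<lambda>l. l @ [X (Suc n)]) (hist X n)) \<in> measurable Q (count_space UNIV)"
  proof (rule measurable_compose_countable[OF _ Suc])
    fix l :: "nat list"
    have "(\<lambda>y. l @ [y]) \<in> measurable (count_space UNIV) (count_space UNIV)" by simp
    from measurable_compose[OF coord_measurable[of "Suc n"] this]
    show "(\<lambda>X. l @ [X (Suc n)]) \<in> measurable Q (count_space UNIV)" .
  qed
  then show ?case by (simp add: hist_Suc)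
qed

lemma hist_eq_iff: "hist X n = hist Y n \<longleftrightarrow> (\<forall>i\<le>n. X i = Y i)"
  by (auto simp: hist_def list_eq_iff_nth_eq less_Suc_eq_le simp del: upt_Suc)

text \<open>Histories of probability \<open>0\<close>, for which the transition law says nothing, have weight \<open>0\<close> by
  induction.\<close>

lemma prob_hist: "l \<in> paths n \<Longrightarrow> Q.prob {X. hist X n = l} = weight \<omega> l"
proof (induction n arbitrary: l)
  case 0
  have "Q.prob {X. X 0 = 0} = 1" using law by (simp add: quenched_law_def)
  then show ?case using 0 by (simp add: weight_def)
next
  case (Suc n)
  then obtain k y where k: "k \<in> paths n" and l: "l = k @ [y]" by auto
  have ne: "k \<noteq> []" and len: "length k = Suc n" using paths_length[OF k] by auto
  define x where "x = (\<lambda>i. k ! i)"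
  have xk: "hist x n = k" unfolding hist_def x_def using len by (metis map_nth)
  have last: "last k = x n" using xk last_hist by metis
  have E1: "{X. hist X n = k} = {X. \<forall>i\<le>n. X i = x i}" using hist_eq_iff[of _ n x] xk by auto
  have E2: "{X. hist X (Suc n) = l} = {X. X (Suc n) = y \<and> (\<forall>i\<le>n. X i = x i)}"
    using E1 by (auto simp: hist_Suc l)
  show ?case
  proof (cases "Q.prob {X. hist X n = k} > 0")
    case True
    have "\<P>(X in Q. X (Suc n) = y \<bar> \<forall>i\<le>n. X i = x i) = transition \<omega> (x n) y"
      using law True E1 unfolding quenched_law_def by simp
    then have "Q.prob {X. hist X (Suc n) = l} = Q.prob {X. hist X n = k} * transition \<omega> (x n) y"
      using True by (simp add: cond_prob_def E1 E2 field_simps)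
    then show ?thesis using Suc.IH[OF k] by (simp add: l weight_snoc[OF ne] last)
  next
    case False
    then have z: "Q.prob {X. hist X n = k} = 0" by (simp add: zero_less_measure_iff)
    have m: "{X. hist X n = k} \<in> sets Q"
      using measurable_sets[OF hist_measurable[of n], of "{k}"] by (simp add: vimage_def)
    have "Q.prob {X. hist X (Suc n) = l} \<le> Q.prob {X. hist X n = k}"
      by (rule Q.finite_measure_mono[OF _ m]) (auto simp: hist_Suc l)
    then show ?thesis using z Suc.IH[OF k] by (simp add: l weight_snoc[OF ne] measure_le_0_iff)
  qed
qed

lemma hist_event_sets [measurable]: "{X. A (hist X n)} \<in> sets Q"
  using measurable_sets[OF hist_measurable[of n], of "Collect A"] by (simp add: vimage_def)

lemma prob_hist_paths: "Q.prob {X. hist X n \<in> paths n \<and> A (hist X n)} = path_sum \<omega> n (\<lambda>l. of_bool (A l))"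
proof -
  have "{X. hist X n \<in> paths n \<and> A (hist X n)} = (\<Union>l\<in>{l\<in>paths n. A l}. {X. hist X n = l})" by auto
  then have "Q.prob {X. hist X n \<in> paths n \<and> A (hist X n)} = (\<Sum>l\<in>{l\<in>paths n. A l}. Q.prob {X. hist X n = l})"
    by simp (rule Q.finite_measure_finite_Union, auto simp: disjoint_family_on_def)
  also have "\<dots> = (\<Sum>l\<in>{l\<in>paths n. A l}. weight \<omega> l)"
    by (rule sum.cong) (auto simp: prob_hist)
  also have "\<dots> = path_sum \<omega> n (\<lambda>l. of_bool (A l))"
    unfolding path_sum_def by (rule sum.mono_neutral_cong_left) auto
  finally show ?thesis .
qed

lemma AE_paths: "AE X in Q. \<forall>n. hist X n \<in> paths n"
proof -
  have "AE X in Q. hist X n \<in> paths n" for n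
  proof -
    have "Q.prob {X. hist X n \<in> paths n} = 1"
      using prob_hist_paths[of n "\<lambda>_. True"] by (simp add: path_sum_const)
    from Q.AE_prob_1[OF this] show ?thesis by simp
  qed
  then show ?thesis by (simp add: AE_all_countable)
qed

lemma prob_event: "Q.prob {X. A (hist X n)} = path_sum \<omega> n (\<lambda>l. of_bool (A l))"
proof -
  have "Q.prob {X. A (hist X n)} = Q.prob {X. hist X n \<in> paths n \<and> A (hist X n)}"
    by (rule Q.finite_measure_eq_AE) (use AE_paths in auto)
  then show ?thesis by (simp add: prob_hist_paths)
qed

end

section \<open>Deviations of additive functionals\<close>

definition additive :: "(nat \<Rightarrow> nat \<Rightarrow> real) \<Rightarrow> nat list \<Rightarrow> real" where
  "additive h l = (\<Sum>i<length l - 1. h (l ! i) (l ! Suc i))"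

lemma additive_snoc: "l \<noteq> [] \<Longrightarrow> additive h (l @ [y]) = additive h l + h (last l) y"
proof -
  assume "l \<noteq> []"
  then obtain k where k: "length l = Suc k" by (cases l) auto
  then have "last l = l ! k" by (metis \<open>l \<noteq> []\<close> diff_Suc_1 last_conv_nth)
  moreover have "(\<Sum>i<k. h ((l @ [y]) ! i) ((l @ [y]) ! Suc i)) = (\<Sum>i<k. h (l ! i) (l ! Suc i))"
    by (rule sum.cong) (auto simp: nth_append k)
  ultimately show ?thesis
    by (simp add: additive_def k) (simp add: nth_append k)
qed

lemma additive_hist: "additive h (hist X n) = (\<Sum>i<n. h (X i) (X (Suc i)))"
  unfolding additive_def by (auto intro!: sum.cong simp: hist_nth)

lemma exp_le_quadratic: "\<bar>t\<bar> \<le> 1 \<Longrightarrow> exp t \<le> 1 + t + t\<^sup>2" for t :: real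
proof (cases "t \<ge> 0")
  case True
  assume "\<bar>t\<bar> \<le> 1" with True show ?thesis using exp_bound[of t] by simp
next
  case False
  define s where "s = - t"
  have s: "s > 0" "t = - s" using False by (auto simp: s_def)
  have "1 \<le> (1 - s + s\<^sup>2) * (1 + s)" using s by (simp add: algebra_simps power2_eq_square)
  also have "\<dots> \<le> (1 - s + s\<^sup>2) * exp s"
  proof (rule mult_left_mono)
    have "1 - s + s\<^sup>2 = (s - 1/2)\<^sup>2 + 3/4" by (simp add: power2_eq_square field_simps)
    then show "0 \<le> 1 - s + s\<^sup>2" by simp
  qed simp
  finally have "exp (- s) \<le> 1 - s + s\<^sup>2" by (simp add: exp_minus field_simps)
  then show ?thesis by (simp add: s)
qed

lemma path_sum_add: "path_sum \<omega> n (\<lambda>l. f l + g l) = path_sum \<omega> n f + path_sum \<omega> n g"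
  by (simp add: path_sum_def algebra_simps sum.distrib)

lemma path_sum_diff: "path_sum \<omega> n (\<lambda>l. f l - g l) = path_sum \<omega> n f - path_sum \<omega> n g"
  by (simp add: path_sum_def algebra_simps sum_subtractf)

lemma path_sum_mult: "path_sum \<omega> n (\<lambda>l. a * f l) = a * path_sum \<omega> n f"
  by (simp add: path_sum_def algebra_simps sum_distrib_left)

lemma path_sum_cong: "(\<And>l. l \<in> paths n \<Longrightarrow> f l = g l) \<Longrightarrow> path_sum \<omega> n f = path_sum \<omega> n g"
  by (simp add: path_sum_def)

lemma paths_nonempty: "l \<in> paths n \<Longrightarrow> l \<noteq> []"
  using paths_length by fastforce

context quenched_walk begin

text \<open>Each step multiplies the exponential moment by at most
  \<open>E (1 - lam * h + (lam * h)\<^sup>2) \<le> 1 + (lam * B)\<^sup>2\<close>, because \<open>h\<close> has nonnegative drift.\<close>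

lemma exponential_moment:
  assumes h: "\<And>x. \<bar>h x (x + 1)\<bar> \<le> B" "\<And>x. \<bar>h x (x - 1)\<bar> \<le> B"
    and drift: "\<And>x. 0 \<le> up \<omega> x * h x (x + 1) + (1 - up \<omega> x) * h x (x - 1)"
    and lam: "0 \<le> lam" "lam * B \<le> 1"
  shows "path_sum \<omega> n (\<lambda>l. exp (- lam * additive h l)) \<le> exp ((lam * B)\<^sup>2 * n)"
proof (induction n)
  case 0 show ?case by (simp add: path_sum_0 additive_def)
next
  case (Suc n)
  have step: "up \<omega> x * exp (- lam * h x (x + 1)) + (1 - up \<omega> x) * exp (- lam * h x (x - 1)) \<le> exp ((lam * B)\<^sup>2)" for x
  proof -
    have b: "exp (- lam * a) \<le> 1 - lam * a + (lam * B)\<^sup>2" if "\<bar>a\<bar> \<le> B" for a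
    proof -
      have le: "\<bar>lam * a\<bar> \<le> lam * B" using that lam by (simp add: abs_mult mult_left_mono)
      then have "exp (- lam * a) \<le> 1 + (- lam * a) + (- lam * a)\<^sup>2" using lam by (intro exp_le_quadratic) auto
      moreover have "(- lam * a)\<^sup>2 \<le> (lam * B)\<^sup>2" using le by (intro power2_le_iff_abs_le[THEN iffD2]) auto
      ultimately show ?thesis by simp
    qed
    have "up \<omega> x * exp (- lam * h x (x + 1)) + (1 - up \<omega> x) * exp (- lam * h x (x - 1))
       \<le> up \<omega> x * (1 - lam * h x (x + 1) + (lam * B)\<^sup>2) + (1 - up \<omega> x) * (1 - lam * h x (x - 1) + (lam * B)\<^sup>2)"
      using up_bounds[of x] h[of x] by (intro add_mono mult_left_mono b) auto
    also have "\<dots> = 1 + (lam * B)\<^sup>2 - lam * (up \<omega> x * h x (x + 1) + (1 - up \<omega> x) * h x (x - 1))"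
      by (simp add: algebra_simps)
    also have "\<dots> \<le> 1 + (lam * B)\<^sup>2" using drift[of x] lam by simp
    also have "\<dots> \<le> exp ((lam * B)\<^sup>2)" by (rule exp_ge_add_one_self)
    finally show ?thesis .
  qed
  have e: "exp (- lam * (a + a')) = exp (- lam * a') * exp (- lam * a)" for a a'
    by (simp add: exp_add[symmetric] algebra_simps)
  have "path_sum \<omega> (Suc n) (\<lambda>l. exp (- lam * additive h l)) =
    path_sum \<omega> n (\<lambda>l. (up \<omega> (last l) * exp (- lam * h (last l) (last l + 1)) + (1 - up \<omega> (last l)) * exp (- lam * h (last l) (last l - 1))) * exp (- lam * additive h l))"
    unfolding path_sum_Suc
    by (rule path_sum_cong) (simp only: additive_snoc[OF paths_nonempty] e distrib_right mult.assoc)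
  also have "\<dots> \<le> path_sum \<omega> n (\<lambda>l. exp ((lam * B)\<^sup>2) * exp (- lam * additive h l))"
    by (rule path_sum_mono, rule mult_right_mono, rule step) simp
  also have "\<dots> = exp ((lam * B)\<^sup>2) * path_sum \<omega> n (\<lambda>l. exp (- lam * additive h l))"
    by (rule path_sum_mult)
  also have "\<dots> \<le> exp ((lam * B)\<^sup>2) * exp ((lam * B)\<^sup>2 * n)" by (rule mult_left_mono[OF Suc.IH]) simp
  finally show ?case by (simp add: algebra_simps exp_add)
qed

text \<open>The rate depends only on \<open>\<epsilon>\<close> and on the bound for the increments. This uniformity permits the
  union bound over all sites in \<open>max_local_time_upper\<close>.\<close>

lemma additive_lower_deviation:
  fixes B \<epsilon> :: real
  assumes "0 < B" "0 < \<epsilon>"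
  obtains \<kappa> where "0 < \<kappa>" "\<And>h (m::nat) (n::nat). \<lbrakk>\<And>x. \<bar>h x (x + 1)\<bar> \<le> B; \<And>x. \<bar>h x (x - 1)\<bar> \<le> B;
     \<And>x. 0 \<le> up \<omega> x * h x (x + 1) + (1 - up \<omega> x) * h x (x - 1); m \<le> n\<rbrakk>
     \<Longrightarrow> Q.prob {X. additive h (hist X m) \<le> - \<epsilon> * real n} \<le> exp (- \<kappa> * real n)"
proof -
  \<comment> \<open>Minimises \<open>- lam * \<epsilon> + (lam * B)\<^sup>2\<close> subject to \<open>lam * B \<le> 1\<close>.\<close>
  define lam where "lam = min (1 / B) (\<epsilon> / (2 * B\<^sup>2))"
  have lam: "0 < lam" "lam * B \<le> 1" "lam * B\<^sup>2 \<le> \<epsilon> / 2"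
  proof -
    show "0 < lam" using assms by (simp add: lam_def)
    have "lam \<le> 1 / B" by (simp add: lam_def)
    then show "lam * B \<le> 1" using assms by (simp add: field_simps)
    have "lam \<le> \<epsilon> / (2 * B\<^sup>2)" by (simp add: lam_def)
    then show "lam * B\<^sup>2 \<le> \<epsilon> / 2" using assms by (simp add: field_simps)
  qed
  show ?thesis
  proof (rule that[of "lam * \<epsilon> / 2"])
    show "0 < lam * \<epsilon> / 2" using lam assms by simp
    fix h and m n :: nat assume h: "\<And>x. \<bar>h x (x + 1)\<bar> \<le> B" "\<And>x. \<bar>h x (x - 1)\<bar> \<le> B"
     "\<And>x. 0 \<le> up \<omega> x * h x (x + 1) + (1 - up \<omega> x) * h x (x - 1)" and mn: "m \<le> n"
    have "Q.prob {X. additive h (hist X m) \<le> - \<epsilon> * real n} = path_sum \<omega> m (\<lambda>l. of_bool (additive h l \<le> - \<epsilon> * real n))"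
      by (rule prob_event)
    also have "\<dots> \<le> path_sum \<omega> m (\<lambda>l. exp (- lam * \<epsilon> * n) * exp (- lam * additive h l))"
    proof (rule path_sum_mono)
      fix l
      show "of_bool (additive h l \<le> - \<epsilon> * real n) \<le> exp (- lam * \<epsilon> * n) * exp (- lam * additive h l)"
      proof (cases "additive h l \<le> - \<epsilon> * real n")
        case True
        then have "lam * additive h l \<le> lam * (- \<epsilon> * real n)" using lam by (intro mult_left_mono) auto
        then show ?thesis using True by (simp add: exp_add[symmetric] algebra_simps)
      qed simp
    qed
    also have "\<dots> = exp (- lam * \<epsilon> * n) * path_sum \<omega> m (\<lambda>l. exp (- lam * additive h l))"
      by (rule path_sum_mult)
    also have "\<dots> \<le> exp (- lam * \<epsilon> * n) * exp ((lam * B)\<^sup>2 * m)"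
      using lam by (intro mult_left_mono exponential_moment h) auto
    also have "\<dots> \<le> exp (- (lam * \<epsilon> / 2) * n)"
    proof -
      have "(lam * B)\<^sup>2 * m \<le> (lam * B)\<^sup>2 * n" using mn by (intro mult_left_mono) auto
      also have "(lam * B)\<^sup>2 * n = lam * (lam * B\<^sup>2) * n" by (simp add: power2_eq_square algebra_simps)
      also have "\<dots> \<le> lam * (\<epsilon> / 2) * n" using lam by (intro mult_right_mono mult_left_mono) auto
      finally show ?thesis by (simp add: exp_add[symmetric] algebra_simps)
    qed
    finally show "Q.prob {X. additive h (hist X m) \<le> - \<epsilon> * real n} \<le> exp (- (lam * \<epsilon> / 2) * n)" .
  qed
qed

end

section \<open>Reversibility and hitting times\<close>

definition conductance :: "(int \<Rightarrow> real) \<Rightarrow> nat \<Rightarrow> real" where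
  "conductance \<omega> k = (\<Prod>i=1..k. \<omega> (int i) / (1 - \<omega> (int i)))"

definition reversible :: "(int \<Rightarrow> real) \<Rightarrow> nat \<Rightarrow> real" where
  "reversible \<omega> x = (if x = 0 then 1 else conductance \<omega> (x - 1) + conductance \<omega> x)"

text \<open>If the conductances are \<open>exp (- V k)\<close>, this is \<open>\<Sum>y\<le>k. exp (V k - V y)\<close>. It measures how high \<open>k\<close>
  lies above the lowest points to its left, and it is about half the expected time to pass from \<open>k\<close> to
  \<open>k + 1\<close>.\<close>

definition left_mass :: "(nat \<Rightarrow> real) \<Rightarrow> nat \<Rightarrow> real" where
  "left_mass c k = (\<Sum>y\<le>k. c y) / c k"

context quenched_walk begin

lemma conductance_0 [simp]: "conductance \<omega> 0 = 1" by (simp add: conductance_def)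

lemma conductance_Suc: "conductance \<omega> (Suc k) = conductance \<omega> k * (\<omega> (int (Suc k)) / (1 - \<omega> (int (Suc k))))"
  by (simp add: conductance_def)

lemma conductance_pos: "0 < conductance \<omega> k"
  unfolding conductance_def by (intro prod_pos) (auto simp: pos less1)

lemma reversible_pos: "0 < reversible \<omega> x"
  by (auto simp: reversible_def intro: add_pos_pos conductance_pos)

lemma detailed_balance:
  "reversible \<omega> x * up \<omega> x = conductance \<omega> x"
  "reversible \<omega> (Suc x) * (1 - up \<omega> (Suc x)) = conductance \<omega> x"
proof -
  have d: "1 - \<omega> (int (Suc x)) > 0" for x using less1[of "int (Suc x)"] by simp
  show "reversible \<omega> x * up \<omega> x = conductance \<omega> x"
    using d[of "x - 1"] by (cases x) (auto simp: reversible_def up_def conductance_Suc field_simps)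
  show "reversible \<omega> (Suc x) * (1 - up \<omega> (Suc x)) = conductance \<omega> x"
    using d[of x] by (auto simp: reversible_def up_def conductance_Suc field_simps)
qed

text \<open>For a walk started at \<open>b\<close> this is \<open>P\<^sub>b (X n = y) = \<mu> y / \<mu> b * P\<^sub>y (X n = b)\<close>. For the walk
  started at \<open>0\<close> it follows by induction on \<open>n\<close> instead of the strong Markov property: \<open>\<mu> / \<mu> b\<close> is
  invariant, and the mass that enters at \<open>b\<close> is controlled by the trivial bound \<open>1 = \<mu> b / \<mu> b\<close>.\<close>

lemma occupation_after_hitting:
  "path_sum \<omega> n (\<lambda>l. of_bool (b \<in> set l \<and> last l = y)) \<le> reversible \<omega> y / reversible \<omega> b"
proof (induction n arbitrary: y)
  case 0
  show ?case using reversible_pos[of y] reversible_pos[of b] by (auto simp: path_sum_0 less_imp_le)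
next
  case (Suc n)
  show ?case
  proof (cases "y = b")
    case True
    have "path_sum \<omega> (Suc n) (\<lambda>l. of_bool (b \<in> set l \<and> last l = y)) \<le> path_sum \<omega> (Suc n) (\<lambda>_. 1)"
      by (rule path_sum_mono) simp
    then show ?thesis using True reversible_pos[of b] by (simp add: path_sum_const)
  next
    case False
    have "path_sum \<omega> (Suc n) (\<lambda>l. of_bool (b \<in> set l \<and> last l = y)) =
      path_sum \<omega> n (\<lambda>l. (if y = 0 then 0 else up \<omega> (y - 1) * of_bool (b \<in> set l \<and> last l = y - 1))
           + (1 - up \<omega> (Suc y)) * of_bool (b \<in> set l \<and> last l = Suc y))"
      unfolding path_sum_Suc
    proof (rule path_sum_cong)
      fix l
      show "up \<omega> (last l) * of_bool (b \<in> set (l @ [last l + 1]) \<and> last (l @ [last l + 1]) = y) +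
          (1 - up \<omega> (last l)) * of_bool (b \<in> set (l @ [last l - 1]) \<and> last (l @ [last l - 1]) = y) =
        (if y = 0 then 0 else up \<omega> (y - 1) * of_bool (b \<in> set l \<and> last l = y - 1))
           + (1 - up \<omega> (Suc y)) * of_bool (b \<in> set l \<and> last l = Suc y)"
        using False by (cases "last l"; cases y) (auto simp: up_def)
    qed
    also have "\<dots> = (if y = 0 then 0 else up \<omega> (y - 1) * path_sum \<omega> n (\<lambda>l. of_bool (b \<in> set l \<and> last l = y - 1)))
        + (1 - up \<omega> (Suc y)) * path_sum \<omega> n (\<lambda>l. of_bool (b \<in> set l \<and> last l = Suc y))"
      by (simp add: path_sum_add path_sum_mult path_sum_const)
    also have "\<dots> \<le> (if y = 0 then 0 else up \<omega> (y - 1) * (reversible \<omega> (y - 1) / reversible \<omega> b))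
        + (1 - up \<omega> (Suc y)) * (reversible \<omega> (Suc y) / reversible \<omega> b)"
    proof -
      have "up \<omega> (y - 1) * path_sum \<omega> n (\<lambda>l. of_bool (b \<in> set l \<and> last l = y - 1)) \<le> up \<omega> (y - 1) * (reversible \<omega> (y - 1) / reversible \<omega> b)"
        using up_bounds[of "y - 1"] by (intro mult_left_mono Suc.IH) simp
      moreover have "(1 - up \<omega> (Suc y)) * path_sum \<omega> n (\<lambda>l. of_bool (b \<in> set l \<and> last l = Suc y)) \<le> (1 - up \<omega> (Suc y)) * (reversible \<omega> (Suc y) / reversible \<omega> b)"
        using up_bounds[of "Suc y"] by (intro mult_left_mono Suc.IH) simp
      ultimately show ?thesis by (intro add_mono) auto
    qed
    also have "\<dots> = ((if y = 0 then 0 else reversible \<omega> (y - 1) * up \<omega> (y - 1)) + reversible \<omega> (Suc y) * (1 - up \<omega> (Suc y))) / reversible \<omega> b"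
      by (simp add: add_divide_distrib mult.commute)
    also have "\<dots> = reversible \<omega> y / reversible \<omega> b"
      unfolding detailed_balance by (simp add: reversible_def)
    finally show ?thesis .
  qed
qed

lemma left_mass_Suc: "left_mass (conductance \<omega>) (Suc k) = 1 + (1 - \<omega> (int (Suc k))) / \<omega> (int (Suc k)) * left_mass (conductance \<omega>) k"
  using conductance_pos[of k] pos[of "int (Suc k)"] less1[of "int (Suc k)"]
  by (simp add: left_mass_def conductance_Suc field_simps)

lemma left_mass_ge_1: "1 \<le> left_mass (conductance \<omega>) k"
proof -
  have "conductance \<omega> k \<le> (\<Sum>y\<le>k. conductance \<omega> y)"
    by (rule member_le_sum) (auto intro: less_imp_le conductance_pos)
  then show ?thesis using conductance_pos[of k] by (simp add: left_mass_def)
qed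

lemma unvisited_below: "l \<in> paths n \<Longrightarrow> b \<notin> set l \<Longrightarrow> 0 < b \<Longrightarrow> last l < b"
proof (induction n arbitrary: l)
  case 0 then show ?case by simp
next
  case (Suc n)
  then obtain k y where k: "k \<in> paths n" and l: "l = k @ [y]" and y: "y = last k + 1 \<or> y = last k - 1" by auto
  have "last k < b" using Suc.IH[OF k] Suc.prems l by auto
  then show ?case using y Suc.prems l by auto
qed

text \<open>The expected time to pass from \<open>k\<close> to \<open>k + 1\<close> is exactly \<open>2 * left_mass k - 1\<close>; the sum of these
  over \<open>{y..<b}\<close>, as a function of the position \<open>y\<close>, loses one unit per step in mean until \<open>b\<close> is reached.\<close>

lemma expected_hitting_time:
  assumes b: "0 < b"
  shows "(\<Sum>k<n. path_sum \<omega> k (\<lambda>l. of_bool (b \<notin> set l))) \<le> 2 * (\<Sum>k<b. left_mass (conductance \<omega>) k)"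
proof -
  define t where "t = (\<lambda>k. 2 * left_mass (conductance \<omega>) k - 1)"
  define pot where "pot = (\<lambda>y. \<Sum>k\<in>{y..<b}. t k)"
  have t0: "0 \<le> t k" for k using left_mass_ge_1[of k] by (simp add: t_def)
  have pot0: "0 \<le> pot y" for y unfolding pot_def by (intro sum_nonneg t0)
  have step: "up \<omega> y * pot (y + 1) + (1 - up \<omega> y) * pot (y - 1) = pot y - 1" if "y < b" for y
  proof -
    have a: "pot y = t y + pot (Suc y)" using that unfolding pot_def by (rule sum.atLeast_Suc_lessThan)
    show ?thesis
    proof (cases y)
      case 0 then show ?thesis using a by (simp add: up_def t_def left_mass_def)
    next
      case (Suc z)
      have p: "pot z = t z + pot y" using that Suc unfolding pot_def by (simp add: sum.atLeast_Suc_lessThan)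
      have w: "up \<omega> y = \<omega> (int y)" "\<omega> (int y) > 0" using Suc pos[of "int y"] by (auto simp: up_def)
      have "\<omega> (int y) * t y = 1 + (1 - \<omega> (int y)) * t z"
        using w pos[of "int y"] unfolding t_def Suc left_mass_Suc by (simp add: field_simps)
      then show ?thesis using a p w Suc by (simp add: algebra_simps)
    qed
  qed
  have "path_sum \<omega> n (\<lambda>l. of_bool (b \<notin> set l) * pot (last l)) + (\<Sum>k<n. path_sum \<omega> k (\<lambda>l. of_bool (b \<notin> set l))) \<le> pot 0"
  proof (induction n)
    case 0 then show ?case using b by (simp add: path_sum_0)
  next
    case (Suc n)
    have "path_sum \<omega> (Suc n) (\<lambda>l. of_bool (b \<notin> set l) * pot (last l)) \<le> 
      path_sum \<omega> n (\<lambda>l. of_bool (b \<notin> set l) * pot (last l) - of_bool (b \<notin> set l))"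
      unfolding path_sum_Suc
    proof (rule path_sum_mono)
      fix l assume l: "l \<in> paths n"
      have "up \<omega> (last l) * (of_bool (b \<notin> set (l @ [last l + 1])) * pot (last (l @ [last l + 1]))) +
         (1 - up \<omega> (last l)) * (of_bool (b \<notin> set (l @ [last l - 1])) * pot (last (l @ [last l - 1])))
        \<le> of_bool (b \<notin> set l) * (up \<omega> (last l) * pot (last l + 1) + (1 - up \<omega> (last l)) * pot (last l - 1))"
        using up_bounds[of "last l"] pot0 by (auto simp: less_imp_le)
      also have "\<dots> = of_bool (b \<notin> set l) * pot (last l) - of_bool (b \<notin> set l)"
        using step[OF unvisited_below[OF l _ b]] by (cases "b \<in> set l") auto
      finally show "up \<omega> (last l) * (of_bool (b \<notin> set (l @ [last l + 1])) * pot (last (l @ [last l + 1]))) +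
         (1 - up \<omega> (last l)) * (of_bool (b \<notin> set (l @ [last l - 1])) * pot (last (l @ [last l - 1])))
        \<le> of_bool (b \<notin> set l) * pot (last l) - of_bool (b \<notin> set l)" .
    qed
    also have "\<dots> = path_sum \<omega> n (\<lambda>l. of_bool (b \<notin> set l) * pot (last l)) - path_sum \<omega> n (\<lambda>l. of_bool (b \<notin> set l))"
      by (rule path_sum_diff)
    finally show ?case using Suc.IH by simp
  qed
  moreover have "0 \<le> path_sum \<omega> n (\<lambda>l. of_bool (b \<notin> set l) * pot (last l))"
    unfolding path_sum_def by (intro sum_nonneg mult_nonneg_nonneg weight_nonneg pot0) auto
  moreover have "pot 0 \<le> 2 * (\<Sum>k<b. left_mass (conductance \<omega>) k)"
    unfolding pot_def t_def by (simp add: sum_subtractf sum_distrib_left atLeast0LessThan)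
  ultimately show ?thesis by linarith
qed

end

section \<open>The upper bound in a fixed environment\<close>

lemma local_time_eq_sum:
  "real (local_time X n (int x)) = (\<Sum>i<n. of_bool (X i = x)) + of_bool (X n = x)"
proof -
  have "real (local_time X n (int x)) = (\<Sum>i\<le>n. of_bool (X i = x))"
    unfolding local_time_def by (simp add: Int_def)
  then show ?thesis by (simp add: lessThan_Suc_atMost[symmetric])
qed

lemma local_time_mono: "m \<le> n \<Longrightarrow> local_time X m x \<le> local_time X n x"
  unfolding local_time_def by (rule card_mono) auto

lemma local_time_le: "local_time X n x \<le> Suc n"
proof -
  have "local_time X n x \<le> card {..n}" unfolding local_time_def by (rule card_mono) auto
  then show ?thesis by simp
qed

lemma bdd_above_local_time: "bdd_above (range (local_time X n))"
  by (rule bdd_aboveI[of _ "Suc n"]) (auto simp: local_time_le)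

lemma local_time_le_max: "local_time X n x \<le> max_local_time X n"
  unfolding max_local_time_def by (rule cSUP_upper[OF _ bdd_above_local_time]) simp

text \<open>This reduces the maximum over all sites to times \<open>m\<close> at which the walk is at the site in
  question, where the test function of \<open>max_local_time_upper\<close> vanishes.\<close>

lemma max_local_time_at_last_visit:
  "\<exists>m\<le>n. max_local_time X n = local_time X m (int (X m))"
proof -
  have fin: "finite (range (local_time X n))"
    by (rule finite_subset[of _ "{..Suc n}"]) (auto simp: local_time_le)
  have "max_local_time X n = Max (range (local_time X n))"
    unfolding max_local_time_def using fin by (intro cSup_eq_Max) auto
  then have "max_local_time X n \<in> range (local_time X n)" using Max_in[OF fin] by auto
  then obtain x where x: "max_local_time X n = local_time X n x" by auto
  have "0 < local_time X n (int (X 0))" unfolding local_time_def card_gt_0_iff by auto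
  then have "0 < local_time X n x" using local_time_le_max[of X n "int (X 0)"] x by simp
  then have ne: "{j. j \<le> n \<and> int (X j) = x} \<noteq> {}" unfolding local_time_def card_gt_0_iff by simp
  define m where "m = Max {j. j \<le> n \<and> int (X j) = x}"
  have fin2: "finite {j. j \<le> n \<and> int (X j) = x}" by simp
  have m: "m \<le> n" "int (X m) = x" using Max_in[OF fin2 ne] unfolding m_def by auto
  have "{j. j \<le> n \<and> int (X j) = x} = {j. j \<le> m \<and> int (X j) = x}"
    using m Max_ge[OF fin2] unfolding m_def by force
  then show ?thesis using m x unfolding local_time_def by auto
qed

lemma last_path_le: "l \<in> paths n \<Longrightarrow> last l \<le> n"
  by (induction n arbitrary: l) fastforce+

lemma summable_polynomial_exp:
  assumes "0 < \<kappa>"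
  shows "summable (\<lambda>n. real (Suc n) ^ 2 * exp (- \<kappa> * real n))"
proof (rule summable_comparison_test_bigo)
  show "summable (\<lambda>n. norm (1 / real n ^ 2))"
    using inverse_power_summable[of 2, where ?'a = real] by (simp add: inverse_eq_divide)
  show "(\<lambda>n. real (Suc n) ^ 2 * exp (- \<kappa> * real n)) \<in> O(\<lambda>n. 1 / real n ^ 2)"
    using assms by real_asymp
qed

context quenched_walk begin

lemma AE_coordinate_le: "AE X in Q. \<forall>n. X n \<le> n"
proof (rule AE_mp[OF AE_paths], rule AE_I2, intro impI allI)
  fix X n assume "\<forall>n. hist X n \<in> paths n"
  then show "X n \<le> n" using last_path_le[of "hist X n" n] by simp
qed

lemma additive_eventually:
  assumes "0 < \<epsilon>" "0 < B" and h: "\<And>x. \<bar>h x (x + 1)\<bar> \<le> B" "\<And>x. \<bar>h x (x - 1)\<bar> \<le> B"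
     "\<And>x. 0 \<le> up \<omega> x * h x (x + 1) + (1 - up \<omega> x) * h x (x - 1)"
  shows "AE X in Q. \<forall>\<^sub>F n in sequentially. - \<epsilon> * real n < (\<Sum>i<n. h (X i) (X (Suc i)))"
proof -
  obtain \<kappa> where k: "0 < \<kappa>" "\<And>h (m::nat) (n::nat). \<lbrakk>\<And>x. \<bar>h x (x + 1)\<bar> \<le> B; \<And>x. \<bar>h x (x - 1)\<bar> \<le> B;
     \<And>x. 0 \<le> up \<omega> x * h x (x + 1) + (1 - up \<omega> x) * h x (x - 1); m \<le> n\<rbrakk>
     \<Longrightarrow> Q.prob {X. additive h (hist X m) \<le> - \<epsilon> * real n} \<le> exp (- \<kappa> * real n)"
    using additive_lower_deviation[OF assms(2,1)] by metis
  define A where "A = (\<lambda>n. {X. additive h (hist X n) \<le> - \<epsilon> * real n})"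
  have "AE X in Q. \<forall>\<^sub>F n in sequentially. X \<in> space Q - A n"
  proof (rule borel_cantelli_AE1)
    show "A n \<in> sets Q" for n unfolding A_def by (rule hist_event_sets)
    show "emeasure Q (A n) < \<infinity>" for n by (simp add: Q.emeasure_finite less_top[symmetric])
    show "summable (\<lambda>n. Q.prob (A n))"
    proof (rule summable_comparison_test'[OF summable_polynomial_exp[OF k(1)]])
      fix n
      have "Q.prob (A n) \<le> exp (- \<kappa> * real n)" unfolding A_def using h by (intro k(2)) auto
      also have "\<dots> = 1 * exp (- \<kappa> * real n)" by simp
      also have "\<dots> \<le> real (Suc n) ^ 2 * exp (- \<kappa> * real n)"
        by (rule mult_right_mono, rule one_le_power) auto
      finally show "norm (Q.prob (A n)) \<le> real (Suc n) ^ 2 * exp (- \<kappa> * real n)" by simp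
    qed
  qed
  then show ?thesis by (rule AE_mp) (auto simp: A_def additive_hist not_le elim!: eventually_mono)
qed

text \<open>Null recurrence. The test function \<open>g\<close> is built from the conductances below \<open>L\<close> such that its
  drift is at least \<open>- 1\<close> everywhere and equals \<open>R = \<Sum>k<L. c k\<close> at \<open>0\<close>. As \<open>g\<close> is bounded, each visit to \<open>0\<close> is
  paid for by about \<open>1 + R\<close> units of time, and \<open>R\<close> is arbitrarily large.\<close>

lemma origin_visits_negligible:
  assumes div: "\<And>R. \<exists>L. R < (\<Sum>k<L. conductance \<omega> k)" and eta: "0 < \<eta>"
  shows "AE X in Q. \<forall>\<^sub>F n in sequentially. real (local_time X n 0) \<le> \<eta> * real n"
proof -
  obtain L where L: "4 / \<eta> < (\<Sum>k<L. conductance \<omega> k)" using div by blast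
  define R where "R = (\<Sum>k<L. conductance \<omega> k)"
  have R: "4 / \<eta> < R" "0 < R" using L eta by (auto simp: R_def intro: less_trans[of 0 "4 / \<eta>"])
  \<comment> \<open>The increments of \<open>g\<close>: up to a bounded factor, the expected time to pass from \<open>k + 1\<close> to \<open>k\<close> if the conductances beyond \<open>L\<close> are removed.\<close>
  define t where "t = (\<lambda>k. (\<Sum>j\<in>{k..<L}. conductance \<omega> j) / conductance \<omega> k)"
  define g where "g = (\<lambda>y. \<Sum>k<y. t k)"
  define G where "G = (\<Sum>k<L. t k)"
  have t0: "0 \<le> t k" for k unfolding t_def
    by (intro divide_nonneg_pos sum_nonneg conductance_pos less_imp_le)
  have tz: "t k = 0" if "L \<le> k" for k using that by (simp add: t_def)
  have g0: "0 \<le> g y" for y unfolding g_def by (intro sum_nonneg t0)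
  have gG: "g y \<le> G" for y
  proof -
    have "g y = (\<Sum>k\<in>{..<y} \<inter> {..<L}. t k)" unfolding g_def
      by (rule sum.mono_neutral_right) (auto intro: tz)
    also have "\<dots> \<le> G" unfolding G_def by (rule sum_mono2) (auto intro: t0)
    finally show ?thesis .
  qed
  define h where "h = (\<lambda>x y. g y - g x + 1 - (1 + R) * of_bool (x = 0))"
  define B where "B = G + 2 + R"
  have Gpos: "0 \<le> G" using g0[of 0] gG[of 0] by simp
  have B: "\<bar>h x y\<bar> \<le> B" for x y
    using g0[of x] g0[of y] gG[of x] gG[of y] R unfolding h_def B_def by (auto simp: of_bool_def)
  have drift: "0 \<le> up \<omega> x * h x (x + 1) + (1 - up \<omega> x) * h x (x - 1)" for x
  proof (cases x)
    case 0
    then show ?thesis by (simp add: up_def h_def g_def t_def R_def atLeast0LessThan)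
  next
    case (Suc k)
    have w: "0 < \<omega> (int x)" "\<omega> (int x) < 1" by (auto simp: pos less1)
    have s: "(\<Sum>j\<in>{k..<L}. conductance \<omega> j) \<le> conductance \<omega> k + (\<Sum>j\<in>{x..<L}. conductance \<omega> j)"
      using conductance_pos[of k] Suc by (cases "k < L") (auto simp: sum.atLeast_Suc_lessThan)
    have "\<omega> (int x) * t x = (1 - \<omega> (int x)) * ((\<Sum>j\<in>{x..<L}. conductance \<omega> j) / conductance \<omega> k)"
      using w conductance_pos[of k] Suc by (simp add: t_def conductance_Suc field_simps)
    moreover have "(1 - \<omega> (int x)) * t k \<le> (1 - \<omega> (int x)) * (1 + (\<Sum>j\<in>{x..<L}. conductance \<omega> j) / conductance \<omega> k)"
      using w s conductance_pos[of k] by (intro mult_left_mono) (auto simp: t_def field_simps)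
    ultimately have "(1 - \<omega> (int x)) * t k \<le> 1 - \<omega> (int x) + \<omega> (int x) * t x"
      by (simp add: algebra_simps)
    then have "(1 - \<omega> (int x)) * t k \<le> 1 + \<omega> (int x) * t x" using w by simp
    then show ?thesis using Suc by (simp add: up_def h_def g_def algebra_simps)
  qed
  have "AE X in Q. \<forall>\<^sub>F n in sequentially. - 1 * real n < (\<Sum>i<n. h (X i) (X (Suc i)))"
    by (rule additive_eventually[where B = B]) (use B drift Gpos R in \<open>auto simp: B_def\<close>)
  then show ?thesis
  proof (rule AE_mp, intro AE_I2 impI)
    fix X assume ev: "\<forall>\<^sub>F n in sequentially. - 1 * real n < (\<Sum>i<n. h (X i) (X (Suc i)))"
    have ev2: "\<forall>\<^sub>F n in sequentially. 1 + G / (1 + R) \<le> \<eta> / 2 * real n" using eta by real_asymp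
    show "\<forall>\<^sub>F n in sequentially. real (local_time X n 0) \<le> \<eta> * real n"
      using ev ev2
    proof eventually_elim
      case (elim n)
      have "(\<Sum>i<n. h (X i) (X (Suc i))) = (\<Sum>i<n. g (X (Suc i)) - g (X i)) + real n - (1 + R) * (\<Sum>i<n. of_bool (X i = 0))"
        unfolding h_def by (simp add: sum.distrib sum_subtractf sum_distrib_left)
      also have "(\<Sum>i<n. g (X (Suc i)) - g (X i)) = g (X n) - g (X 0)" by (rule sum_lessThan_telescope)
      finally have "(1 + R) * (\<Sum>i<n. of_bool (X i = 0)) \<le> 2 * real n + G"
        using elim(1) g0[of "X 0"] gG[of "X n"] by linarith
      then have "(\<Sum>i<n. of_bool (X i = 0)) \<le> (2 * real n + G) / (1 + R)"
        using R by (simp add: field_simps)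
      also have "\<dots> = 2 / (1 + R) * real n + G / (1 + R)" by (simp add: add_divide_distrib)
      also have "2 / (1 + R) * real n \<le> \<eta> / 2 * real n"
      proof (rule mult_right_mono)
        have "4 \<le> \<eta> * (1 + R)" using R eta by (simp add: field_simps)
        then show "2 / (1 + R) \<le> \<eta> / 2" using R by (simp add: field_simps)
      qed simp
      finally have "(\<Sum>i<n. of_bool (X i = 0)) \<le> \<eta> / 2 * real n + G / (1 + R)" by simp
      moreover have "of_bool (X n = 0) \<le> (1::real)" by simp
      ultimately show ?case using local_time_eq_sum[of X n 0, unfolded of_nat_0] elim(2) by linarith
    qed
  qed
qed

text \<open>The drift of the piecewise linear \<open>g x\<close> compensates the passage of time off \<open>x\<close> because
  \<open>w \<le> \<omega> \<le> M\<close>, and at \<open>x\<close> because of the bound on \<open>\<theta>\<close>. The reflection at \<open>0\<close> is repaired by the term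
  with the constant \<open>C\<close>.\<close>

lemma max_local_time_upper:
  assumes wM: "\<And>x. 1 \<le> x \<Longrightarrow> w \<le> \<omega> x \<and> \<omega> x \<le> M" and w: "w < 1/2" and M: "1/2 < M"
    and theta: "0 \<le> \<theta>" "\<And>s. w \<le> s \<Longrightarrow> s \<le> M \<Longrightarrow> \<theta> \<le> 1 + s / (1 - 2 * w) + (1 - s) / (2 * M - 1)"
    and div: "\<And>R. \<exists>L. R < (\<Sum>k<L. conductance \<omega> k)" and eps: "0 < \<epsilon>"
  shows "AE X in Q. \<forall>\<^sub>F n in sequentially. \<theta> * real (max_local_time X n) \<le> (1 + \<epsilon>) * real n"
proof -
  define \<alpha> where "\<alpha> = 1 / (1 - 2 * w)"
  define \<beta> where "\<beta> = 1 / (2 * M - 1)"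
  have ab: "0 < \<alpha>" "0 < \<beta>" "\<alpha> * (1 - 2 * w) = 1" "\<beta> * (2 * M - 1) = 1" using w M by (auto simp: \<alpha>_def \<beta>_def)
  \<comment> \<open>From \<open>0\<close> to \<open>1\<close> the function \<open>g x\<close> decreases by \<open>\<beta>\<close> if \<open>x > 0\<close>; the summand \<open>\<theta>\<close> covers the case \<open>x = 0\<close>.\<close>
  define C where "C = \<theta> + \<beta>"
  define g where "g = (\<lambda>x y. \<alpha> * real (y - x) + \<beta> * real (x - y))"
  define h where "h = (\<lambda>x y z. g x z - g x y + 1 - \<theta> * of_bool (y = x) + C * of_bool (y = 0))"
  define B where "B = \<alpha> + \<beta> + 1 + \<theta> + C"
  have g_up: "g x (y + 1) - g x y = (if x \<le> y then \<alpha> else - \<beta>)" for x y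
    by (auto simp: g_def of_nat_diff algebra_simps)
  have g_dn: "g x (y - 1) - g x y = (if y = 0 then 0 else if y \<le> x then \<beta> else - \<alpha>)" for x y
    by (cases y) (auto simp: g_def of_nat_diff algebra_simps Suc_diff_le)
  have C0: "0 \<le> C" using theta ab by (simp add: C_def)
  have B: "\<bar>h x y (y + 1)\<bar> \<le> B" "\<bar>h x y (y - 1)\<bar> \<le> B" for x y
    unfolding h_def B_def g_up g_dn using ab theta C0 by (auto simp: of_bool_def)
  have drift: "0 \<le> up \<omega> y * h x y (y + 1) + (1 - up \<omega> y) * h x y (y - 1)" for x y
  proof (cases "y = 0")
    case True
    then show ?thesis using ab theta unfolding h_def g_up g_dn by (auto simp: up_def C_def of_bool_def)
  next
    case False
    define s where "s = \<omega> (int y)"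
    have s: "w \<le> s" "s \<le> M" "up \<omega> y = s" using wM[of "int y"] False by (auto simp: s_def up_def)
    consider "x < y" | "x = y" | "y < x" by linarith
    then show ?thesis
    proof cases
      case 1
      have "\<alpha> * w \<le> \<alpha> * s" using s ab by simp
      then show ?thesis using 1 ab(3) unfolding h_def g_up g_dn s(3) by (auto simp: of_bool_def algebra_simps)
    next
      case 2
      have "\<theta> \<le> 1 + s * \<alpha> + (1 - s) * \<beta>" using theta(2)[of s] s by (simp add: \<alpha>_def \<beta>_def)
      then show ?thesis using 2 False unfolding h_def g_up g_dn s(3) by (auto simp: of_bool_def algebra_simps)
    next
      case 3
      have "\<beta> * s \<le> \<beta> * M" using s ab by simp
      then show ?thesis using 3 False ab(4) unfolding h_def g_up g_dn s(3) by (auto simp: of_bool_def algebra_simps)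
    qed
  qed
  have B0: "0 < B" using ab theta C0 by (simp add: B_def)
  obtain \<kappa> where k: "0 < \<kappa>" "\<And>h (m::nat) (n::nat). \<lbrakk>\<And>x. \<bar>h x (x + 1)\<bar> \<le> B; \<And>x. \<bar>h x (x - 1)\<bar> \<le> B;
     \<And>x. 0 \<le> up \<omega> x * h x (x + 1) + (1 - up \<omega> x) * h x (x - 1); m \<le> n\<rbrakk>
     \<Longrightarrow> Q.prob {X. additive h (hist X m) \<le> - (\<epsilon> / 4) * real n} \<le> exp (- \<kappa> * real n)"
    using additive_lower_deviation[OF B0, of "\<epsilon> / 4"] eps by (metis zero_less_divide_iff zero_less_numeral)
  define A where "A = (\<lambda>n. \<Union>m\<in>{..n}. \<Union>x\<in>{..n}. {X. additive (h x) (hist X m) \<le> - (\<epsilon> / 4) * real n})"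
  have "AE X in Q. \<forall>\<^sub>F n in sequentially. X \<in> space Q - A n"
  proof (rule borel_cantelli_AE1)
    show "A n \<in> sets Q" for n unfolding A_def by (intro sets.finite_UN hist_event_sets) auto
    show "emeasure Q (A n) < \<infinity>" for n by (simp add: Q.emeasure_finite less_top[symmetric])
    show "summable (\<lambda>n. Q.prob (A n))"
    proof (rule summable_comparison_test'[OF summable_polynomial_exp[OF k(1)]])
      fix n
      have "Q.prob (A n) \<le> (\<Sum>m\<le>n. Q.prob (\<Union>x\<in>{..n}. {X. additive (h x) (hist X m) \<le> - (\<epsilon> / 4) * real n}))"
        unfolding A_def by (rule Q.finite_measure_subadditive_finite) (auto intro!: sets.finite_UN hist_event_sets)
      also have "\<dots> \<le> (\<Sum>m\<le>n. \<Sum>x\<le>n. Q.prob {X. additive (h x) (hist X m) \<le> - (\<epsilon> / 4) * real n})"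
        by (intro sum_mono Q.finite_measure_subadditive_finite) (auto intro!: hist_event_sets)
      also have "\<dots> \<le> (\<Sum>m\<le>n. \<Sum>x\<le>n. exp (- \<kappa> * real n))"
        by (intro sum_mono k(2) B drift) auto
      finally show "norm (Q.prob (A n)) \<le> real (Suc n) ^ 2 * exp (- \<kappa> * real n)"
        by (simp add: power2_eq_square algebra_simps)
    qed
  qed
  moreover define \<eta> where "\<eta> = \<epsilon> / (4 * (C + 1))"
  have eta: "0 < \<eta>" "C * \<eta> \<le> \<epsilon> / 4" using eps C0 by (auto simp: \<eta>_def field_simps)
  have "AE X in Q. \<forall>\<^sub>F n in sequentially. real (local_time X n 0) \<le> \<eta> * real n"
    by (rule origin_visits_negligible[OF div eta(1)])
  ultimately show ?thesis using AE_coordinate_le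
  proof (eventually_elim)
    case (elim X)
    have ev: "\<forall>\<^sub>F n in sequentially. \<theta> \<le> \<epsilon> / 4 * real n" using eps by real_asymp
    show ?case using elim(1,2) ev
    proof eventually_elim
      case (elim n)
      obtain m where m: "m \<le> n" "max_local_time X n = local_time X m (int (X m))"
        using max_local_time_at_last_visit by blast
      define x where "x = X m"
      have xn: "x \<le> n" using \<open>\<forall>n. X n \<le> n\<close> m unfolding x_def by (meson le_trans)
      have "- (\<epsilon> / 4) * real n < additive (h x) (hist X m)"
        using elim(1) m(1) xn by (force simp: A_def not_le)
      also have "additive (h x) (hist X m) = (\<Sum>i<m. g x (X (Suc i)) - g x (X i)) + real m - \<theta> * (\<Sum>i<m. of_bool (X i = x)) + C * (\<Sum>i<m. of_bool (X i = 0))"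
        unfolding additive_hist h_def by (simp add: sum.distrib sum_subtractf sum_distrib_left)
      also have "(\<Sum>i<m. g x (X (Suc i)) - g x (X i)) = g x (X m) - g x (X 0)" by (rule sum_lessThan_telescope)
      also have "\<dots> \<le> 0"
      proof -
        have "0 \<le> \<alpha> * real (X 0 - X m) + \<beta> * real (X m - X 0)" using ab by simp
        then show ?thesis by (simp add: g_def x_def)
      qed
      finally have *: "\<theta> * (\<Sum>i<m. of_bool (X i = x)) \<le> real m + C * (\<Sum>i<m. of_bool (X i = 0)) + \<epsilon> / 4 * real n" by simp
      have "(\<Sum>i<m. of_bool (X i = 0)) \<le> real (local_time X m (int 0))"
        by (subst local_time_eq_sum) simp
      also have "\<dots> \<le> real (local_time X n 0)" using local_time_mono[OF m(1), of X 0] by simp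
      also have "\<dots> \<le> \<eta> * real n" by (rule elim(2))
      finally have "C * (\<Sum>i<m. of_bool (X i = 0)) \<le> C * (\<eta> * real n)" using C0 by (rule mult_left_mono)
      also have "\<dots> = (C * \<eta>) * real n" by simp
      also have "\<dots> \<le> \<epsilon> / 4 * real n" by (rule mult_right_mono[OF eta(2)]) simp
      finally have "\<theta> * (\<Sum>i<m. of_bool (X i = x)) \<le> real n + \<epsilon> / 4 * real n + \<epsilon> / 4 * real n"
        using * m(1) by simp
      moreover have "\<theta> * real (max_local_time X n) = \<theta> * (\<Sum>i<m. of_bool (X i = x)) + \<theta>"
        unfolding m(2) local_time_eq_sum x_def by (simp add: algebra_simps)
      moreover have "0 \<le> \<epsilon> / 4 * real n" using eps by simp
      ultimately show ?case using elim(3) by (simp add: algebra_simps)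
    qed
  qed
qed

end

section \<open>Valleys and the lower bound in a fixed environment\<close>

text \<open>The slope conditions say that in the window \<open>[b - K, b + K]\<close> the function with slopes \<open>\<alpha>\<close> to the right
  of \<open>b\<close> and \<open>\<beta>\<close> to the left of it decreases in mean by at least \<open>1\<close> per step, so it bounds the time spent
  in the window before the return to \<open>b\<close>, and \<open>\<theta>\<close> bounds the mean of this time for a return from \<open>b\<close>. The
  last three conditions say that the rest of \<open>[0, d)\<close> has little reversible mass compared with \<open>b\<close>, and
  that \<open>b\<close> is reached long before \<open>d\<close>.\<close>

definition valley :: "(int \<Rightarrow> real) \<Rightarrow> nat \<Rightarrow> real \<Rightarrow> real \<Rightarrow> real \<Rightarrow> real \<Rightarrow> nat \<Rightarrow> nat \<Rightarrow> bool" where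
  "valley \<omega> K \<alpha> \<beta> \<theta> \<gamma> b d \<longleftrightarrow> K < b \<and> b + K < d \<and>
     (\<forall>y. b < y \<and> y \<le> b + K \<longrightarrow> \<alpha> * (2 * \<omega> (int y) - 1) \<le> - 1) \<and>
     (\<forall>y. b - K \<le> y \<and> y < b \<longrightarrow> \<beta> * (1 - 2 * \<omega> (int y)) \<le> - 1) \<and>
     1 + \<alpha> * \<omega> (int b) + \<beta> * (1 - \<omega> (int b)) \<le> \<theta> \<and>
     (\<Sum>y<b - K. conductance \<omega> y) \<le> \<gamma> * conductance \<omega> (b - 1) \<and>
     (\<Sum>y=b + K..<d. conductance \<omega> y) \<le> \<gamma> * conductance \<omega> b \<and>
     (\<Sum>k<b. left_mass (conductance \<omega>) k) * (conductance \<omega> (d - 1) + conductance \<omega> d) \<le> \<gamma> * conductance \<omega> b"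

lemma max_local_time_hist: "max_local_time X n = max_local_time (\<lambda>i. hist X n ! i) n"
proof -
  have "local_time X n x = local_time (\<lambda>i. hist X n ! i) n x" for x
    unfolding local_time_def by (rule arg_cong[where f = card]) (auto simp: hist_nth)
  then show ?thesis unfolding max_local_time_def by simp
qed

lemma (in prob_space) prob_count_le:
  fixes C :: "nat \<Rightarrow> 'a set"
  assumes C: "\<And>i. C i \<in> events" and s: "0 < s"
  shows "prob {x\<in>space M. s \<le> (\<Sum>i<n. indicator (C i) x :: real)} \<le> (\<Sum>i<n. prob (C i)) / s"
proof -
  have m: "{x\<in>space M. s \<le> (\<Sum>i<n. indicator (C i) x :: real)} \<in> events"
    using C by measurable
  have "s * prob {x\<in>space M. s \<le> (\<Sum>i<n. indicator (C i) x :: real)} =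
      (\<integral>x. s * indicator {x\<in>space M. s \<le> (\<Sum>i<n. indicator (C i) x :: real)} x \<partial>M)"
    using m by simp
  also have "\<dots> \<le> (\<integral>x. (\<Sum>i<n. indicator (C i) x) \<partial>M)"
  proof (rule integral_mono)
    show "integrable M (\<lambda>x. s * indicator {x\<in>space M. s \<le> (\<Sum>i<n. indicator (C i) x :: real)} x)"
      using m by (intro integrable_mult_right) (simp add: less_top[symmetric] emeasure_eq_measure)
    show "integrable M (\<lambda>x. \<Sum>i<n. indicator (C i) x :: real)"
      using C by (intro Bochner_Integration.integrable_sum) (simp add: less_top[symmetric] emeasure_eq_measure)
  qed (auto simp: indicator_def intro: sum_nonneg)
  also have "\<dots> = (\<Sum>i<n. prob (C i))"
    using C by (subst Bochner_Integration.integral_sum) (auto simp: less_top[symmetric] emeasure_eq_measure)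
  finally show ?thesis using s by (simp add: field_simps)
qed

context quenched_walk begin

lemma max_local_time_event: "{X. A (max_local_time X n)} \<in> sets Q"
  using hist_event_sets[of "\<lambda>l. A (max_local_time (\<lambda>i. l ! i) n)" n] by (simp add: max_local_time_hist[symmetric])

lemma outside_reversible_mass:
  assumes "valley \<omega> K \<alpha> \<beta> \<theta> \<gamma> b d"
  shows "(\<Sum>y\<in>{..<d} - {b - K..b + K}. reversible \<omega> y) \<le> 2 * \<gamma> * reversible \<omega> b"
proof -
  have v: "K < b" "b + K < d" "(\<Sum>y<b - K. conductance \<omega> y) \<le> \<gamma> * conductance \<omega> (b - 1)"
     "(\<Sum>y=b + K..<d. conductance \<omega> y) \<le> \<gamma> * conductance \<omega> b" using assms by (auto simp: valley_def)
  have c0: "0 \<le> conductance \<omega> k" for k using conductance_pos[of k] by simp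
  have le: "(\<Sum>y<k. reversible \<omega> y) \<le> 2 * (\<Sum>y<k. conductance \<omega> y)" for k
  proof -
    have "(\<Sum>y<Suc k. reversible \<omega> y) = (\<Sum>y<k. conductance \<omega> y) + (\<Sum>y<Suc k. conductance \<omega> y)" for k
      by (induction k) (auto simp: reversible_def)
    then show ?thesis using c0 by (cases k) auto
  qed
  have split: "{..<d} - {b - K..b + K} = {..<b - K} \<union> {Suc (b + K)..<d}" using v by auto
  have "(\<Sum>y\<in>{..<d} - {b - K..b + K}. reversible \<omega> y) = (\<Sum>y<b - K. reversible \<omega> y) + (\<Sum>y=Suc (b + K)..<d. reversible \<omega> y)"
    unfolding split by (rule sum.union_disjoint) auto
  also have "(\<Sum>y<b - K. reversible \<omega> y) \<le> 2 * (\<gamma> * conductance \<omega> (b - 1))"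
    using le[of "b - K"] v(3) by simp
  also have "(\<Sum>y=Suc (b + K)..<d. reversible \<omega> y) = (\<Sum>y=Suc (b + K)..<d. conductance \<omega> (y - 1)) + (\<Sum>y=Suc (b + K)..<d. conductance \<omega> y)"
    by (subst sum.distrib[symmetric]) (auto intro!: sum.cong simp: reversible_def)
  also have "(\<Sum>y=Suc (b + K)..<d. conductance \<omega> (y - 1)) = (\<Sum>y=b + K..<d - 1. conductance \<omega> y)"
    using v sum.shift_bounds_Suc_ivl[of "\<lambda>y. conductance \<omega> (y - 1)" "b + K" "d - 1"] by simp
  also have "\<dots> \<le> (\<Sum>y=b + K..<d. conductance \<omega> y)" by (rule sum_mono2) (auto intro: c0)
  also have "(\<Sum>y=Suc (b + K)..<d. conductance \<omega> y) \<le> (\<Sum>y=b + K..<d. conductance \<omega> y)" by (rule sum_mono2) (auto intro: c0)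
  finally have "(\<Sum>y\<in>{..<d} - {b - K..b + K}. reversible \<omega> y) \<le> 2 * (\<gamma> * conductance \<omega> (b - 1)) + 2 * (\<gamma> * conductance \<omega> b)"
    using v(4) by simp
  then show ?thesis using v(1) by (simp add: reversible_def algebra_simps)
qed

text \<open>A nearest-neighbour path that has visited \<open>b < d\<close> cannot get past \<open>d\<close> without visiting it.\<close>

lemma before_barrier:
  assumes "b < d" "hist X n \<in> paths n" "b \<in> set (hist X n)" "\<And>i. i \<le> n \<Longrightarrow> b \<in> set (hist X i) \<Longrightarrow> X i \<noteq> d"
    "\<And>k. hist X k \<in> paths k"
  shows "X n < d"
  using assms(2-4)
proof (induction n)
  case 0 then show ?case using assms(1) by auto
next
  case (Suc n)
  show ?case
  proof (cases "b \<in> set (hist X n)")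
    case True
    then have lt: "X n < d" using Suc.IH[OF assms(5)] Suc.prems(3) by auto
    have "X (Suc n) = X n + 1 \<or> X (Suc n) = X n - 1"
      using Suc.prems(1) by (auto simp: hist_Suc)
    moreover have "X (Suc n) \<noteq> d" using Suc.prems by blast
    ultimately show ?thesis using lt by auto
  next
    case False then show ?thesis using Suc.prems(2) assms(1) by (auto simp: hist_Suc)
  qed
qed

text \<open>Truncating \<open>g\<close> at the distance \<open>K\<close> makes it constant outside the window. There its drift is \<open>0\<close>,
  and the time spent there is not counted.\<close>

lemma valley_drift:
  assumes v: "valley \<omega> K \<alpha> \<beta> \<theta> \<gamma> b d" and ab: "0 \<le> \<alpha>" "0 \<le> \<beta>"
  defines "g \<equiv> \<lambda>y. \<alpha> * real (min (y - b) K) + \<beta> * real (min (b - y) K)"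
  defines "h \<equiv> \<lambda>y z. - (g z - g y) - of_bool (y \<in> {b - K..b + K}) + \<theta> * of_bool (y = b)"
  shows "\<bar>h y (y + 1)\<bar> \<le> \<alpha> + \<beta> + 1 + \<bar>\<theta>\<bar>" "\<bar>h y (y - 1)\<bar> \<le> \<alpha> + \<beta> + 1 + \<bar>\<theta>\<bar>"
    "0 \<le> up \<omega> y * h y (y + 1) + (1 - up \<omega> y) * h y (y - 1)"
proof -
  have K: "K < b" using v by (simp add: valley_def)
  have g_up: "g (y + 1) - g y = (if b \<le> y \<and> y < b + K then \<alpha> else if b - K \<le> y \<and> y < b then - \<beta> else 0)" for y
  proof -
    have "min (y + 1 - b) K = min (y - b) K + (if b \<le> y \<and> y < b + K then 1 else 0)" by auto
    moreover have "min (b - y) K = min (b - (y + 1)) K + (if b - K \<le> y \<and> y < b then 1 else 0)" using K by auto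
    ultimately show ?thesis by (auto simp: g_def algebra_simps)
  qed
  have g_dn: "g (y - 1) - g y = (if b < y \<and> y \<le> b + K then - \<alpha> else if b - K < y \<and> y \<le> b then \<beta> else 0)" for y
  proof (cases y)
    case 0 then show ?thesis using K by (auto simp: g_def)
  next
    case (Suc z)
    have "g (y - 1) - g y = - (g (z + 1) - g z)" by (simp add: Suc)
    also have "\<dots> = (if b < y \<and> y \<le> b + K then - \<alpha> else if b - K < y \<and> y \<le> b then \<beta> else 0)"
      unfolding g_up Suc by auto
    finally show ?thesis .
  qed
  show "\<bar>h y (y + 1)\<bar> \<le> \<alpha> + \<beta> + 1 + \<bar>\<theta>\<bar>" "\<bar>h y (y - 1)\<bar> \<le> \<alpha> + \<beta> + 1 + \<bar>\<theta>\<bar>"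
    unfolding h_def g_up g_dn using ab by (auto simp: of_bool_def)
  define s where "s = \<omega> (int y)"
  have s: "0 < s" "s < 1" by (auto simp: s_def pos less1)
  have mult: "0 \<le> \<alpha> * s" "0 \<le> \<beta> * s" "\<alpha> * s \<le> \<alpha>" "\<beta> * s \<le> \<beta>" using s ab by (auto intro: mult_left_le)
  show "0 \<le> up \<omega> y * h y (y + 1) + (1 - up \<omega> y) * h y (y - 1)"
  proof (cases "y = 0")
    case True then show ?thesis using K unfolding h_def g_up g_dn by (auto simp: up_def)
  next
    case False
    then have u: "up \<omega> y = s" by (simp add: up_def s_def)
    consider "y < b - K" | "b - K \<le> y" "y < b" | "y = b" | "b < y" "y \<le> b + K" | "b + K < y" by linarith
    then show ?thesis
    proof cases
      case 2
      have "\<beta> * (1 - 2 * s) \<le> - 1" using v 2 by (simp add: valley_def s_def)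
      then show ?thesis using 2 mult unfolding h_def g_up g_dn u by (auto simp: of_bool_def algebra_simps)
    next
      case 3
      have "1 + \<alpha> * s + \<beta> * (1 - s) \<le> \<theta>" using v 3 by (simp add: valley_def s_def)
      then show ?thesis using 3 K mult unfolding h_def g_up g_dn u by (cases "K = 0") (auto simp: of_bool_def algebra_simps)
    next
      case 4
      have "\<alpha> * (2 * s - 1) \<le> - 1" using v 4 by (simp add: valley_def s_def)
      then show ?thesis using 4 mult unfolding h_def g_up g_dn u by (auto simp: of_bool_def algebra_simps)
    next
      case 1
      then show ?thesis using K unfolding h_def g_up g_dn u by auto
    next
      case 5
      then show ?thesis using K unfolding h_def g_up g_dn u by auto
    qed
  qed
qed

text \<open>Four events of probability at most \<open>\<epsilon>\<close> can spoil the estimate: \<open>F1\<close>, that \<open>b\<close> is reached late; \<open>F2\<close>,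
  that too much time is spent below \<open>d\<close> outside the window; \<open>F3\<close>, that \<open>d\<close> is reached; and \<open>F4\<close>, a
  deviation of the additive functional. The first is bounded by the expected hitting time, the next two
  by the reversible measure. Outside these events nearly all of the time up to \<open>n\<close> is spent in the window,
  where each visit to \<open>b\<close> accounts for at most \<open>\<theta>\<close> units of it.\<close>

lemma valley_local_time:
  assumes ab: "0 \<le> \<alpha>" "0 \<le> \<beta>" and theta: "0 < \<theta>" and eps: "0 < \<epsilon>" "\<epsilon> \<le> 1"
  obtains n0 where "\<And>b d. n0 \<le> b \<Longrightarrow> valley \<omega> K \<alpha> \<beta> \<theta> (\<epsilon> ^ 3 / 6) b d \<Longrightarrow>
    \<exists>n\<ge>b. 1 - 4 * \<epsilon> \<le> Q.prob {X. (1 - 4 * \<epsilon>) * real n \<le> \<theta> * real (max_local_time X n)}"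
proof -
  define \<gamma> where "\<gamma> = \<epsilon> ^ 3 / 6"
  define B where "B = \<alpha> + \<beta> + 1 + \<bar>\<theta>\<bar>"
  have B0: "0 < B" using ab by (simp add: B_def add_nonneg_pos)
  obtain \<kappa> where k: "0 < \<kappa>" "\<And>h (m::nat) (n::nat). \<lbrakk>\<And>x. \<bar>h x (x + 1)\<bar> \<le> B; \<And>x. \<bar>h x (x - 1)\<bar> \<le> B;
     \<And>x. 0 \<le> up \<omega> x * h x (x + 1) + (1 - up \<omega> x) * h x (x - 1); m \<le> n\<rbrakk>
     \<Longrightarrow> Q.prob {X. additive h (hist X m) \<le> - \<epsilon> * real n} \<le> exp (- \<kappa> * real n)"
    using additive_lower_deviation[OF B0 eps(1)] by metis
  have "\<forall>\<^sub>F n in sequentially. exp (- \<kappa> * real n) \<le> \<epsilon> \<and> (\<alpha> + \<beta>) * real K \<le> \<epsilon> * real n"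
    using k(1) eps by (intro eventually_conj; real_asymp)
  then obtain n0 where n0: "\<And>n. n0 \<le> n \<Longrightarrow> exp (- \<kappa> * real n) \<le> \<epsilon>" "\<And>n. n0 \<le> n \<Longrightarrow> (\<alpha> + \<beta>) * real K \<le> \<epsilon> * real n"
    unfolding eventually_sequentially by blast
  show ?thesis
  proof (rule that[of n0])
    fix b d assume bn: "n0 \<le> b" and v: "valley \<omega> K \<alpha> \<beta> \<theta> (\<epsilon> ^ 3 / 6) b d"
    have bd: "0 < b" "b < d" "K < b" using v by (auto simp: valley_def)
    define T where "T = 2 * (\<Sum>k<b. left_mass (conductance \<omega>) k)"
    have "real b \<le> (\<Sum>k<b. left_mass (conductance \<omega>) k)"
      using sum_mono[of "{..<b}" "\<lambda>_. 1" "left_mass (conductance \<omega>)"] left_mass_ge_1 by simp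
    then have T: "real b \<le> T" "1 \<le> T" using bd by (auto simp: T_def)
    have e2: "0 < \<epsilon>\<^sup>2" "\<epsilon>\<^sup>2 \<le> 1" using eps by (auto simp: power_le_one)
    \<comment> \<open>Long enough for \<open>b\<close> to be reached by time \<open>\<epsilon> * n\<close>, short enough for \<open>d\<close> not to be reached by time \<open>n\<close>.\<close>
    define n where "n = nat \<lceil>T / \<epsilon>\<^sup>2\<rceil>"
    have Te: "T \<le> T / \<epsilon>\<^sup>2" using T e2 by (simp add: field_simps)
    have nn: "real n = of_int \<lceil>T / \<epsilon>\<^sup>2\<rceil>" unfolding n_def using Te T by simp
    have n1: "T / \<epsilon>\<^sup>2 \<le> real n" unfolding nn by (rule le_of_int_ceiling)
    have n2: "real n \<le> 2 * T / \<epsilon>\<^sup>2" 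
    proof -
      have "2 * T / \<epsilon>\<^sup>2 = 2 * (T / \<epsilon>\<^sup>2)" by simp
      then show ?thesis unfolding nn using of_int_ceiling_le_add_one[of "T / \<epsilon>\<^sup>2"] Te T by linarith
    qed
    have nb: "b \<le> n" using n1 Te T by linarith
    have npos: "0 < real n" using nb bd by simp
    define C1 where "C1 = (\<lambda>i. {X. b \<notin> set (hist X i)})"
    define C2 where "C2 = (\<lambda>i. {X. b \<in> set (hist X i) \<and> last (hist X i) \<in> {..<d} - {b - K..b + K}})"
    define C3 where "C3 = (\<lambda>i. {X. b \<in> set (hist X i) \<and> last (hist X i) = d})"
    have ev: "C1 i \<in> sets Q" "C2 i \<in> sets Q" "C3 i \<in> sets Q" for i
      unfolding C1_def C2_def C3_def by (rule hist_event_sets)+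
    define F1 where "F1 = {X\<in>space Q. \<epsilon> * n \<le> (\<Sum>i<n. indicator (C1 i) X :: real)}"
    define F2 where "F2 = {X\<in>space Q. \<epsilon> * n \<le> (\<Sum>i<n. indicator (C2 i) X :: real)}"
    define F3 where "F3 = (\<Union>i\<in>{..<n}. C3 i)"
    define g where "g = (\<lambda>y. \<alpha> * real (min (y - b) K) + \<beta> * real (min (b - y) K))"
    define h where "h = (\<lambda>y z. - (g z - g y) - of_bool (y \<in> {b - K..b + K}) + \<theta> * of_bool (y = b))"
    define F4 where "F4 = {X. additive h (hist X n) \<le> - \<epsilon> * real n}"
    have en: "0 < \<epsilon> * n" using eps npos by simp
    have F1: "Q.prob F1 \<le> \<epsilon>"
    proof -
      have "Q.prob F1 \<le> (\<Sum>i<n. Q.prob (C1 i)) / (\<epsilon> * n)"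
        unfolding F1_def by (rule Q.prob_count_le[OF ev(1) en])
      also have "(\<Sum>i<n. Q.prob (C1 i)) \<le> T"
        unfolding C1_def prob_event[of "\<lambda>l. b \<notin> set l"] T_def by (rule expected_hitting_time[OF bd(1)])
      also have "T / (\<epsilon> * n) \<le> \<epsilon>" using n1 eps npos by (simp add: field_simps power2_eq_square)
      finally show ?thesis using en by (simp add: divide_right_mono)
    qed
    have g3: "0 \<le> \<gamma>" "\<gamma> \<le> \<epsilon>\<^sup>2 / 6" "4 * \<gamma> / \<epsilon>\<^sup>2 \<le> \<epsilon>"
      using eps by (auto simp: \<gamma>_def power2_eq_square power3_eq_cube mult_le_one)
    have F2: "Q.prob F2 \<le> \<epsilon>"
    proof -
      have one: "Q.prob (C2 i) \<le> 2 * \<gamma>" for i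
      proof -
        have "Q.prob (C2 i) = path_sum \<omega> i (\<lambda>l. of_bool (b \<in> set l \<and> last l \<in> {..<d} - {b - K..b + K}))"
          unfolding C2_def by (rule prob_event)
        also have "\<dots> = path_sum \<omega> i (\<lambda>l. \<Sum>y\<in>{..<d} - {b - K..b + K}. of_bool (b \<in> set l \<and> last l = y))"
          by (rule path_sum_cong) (auto simp: of_bool_def if_distrib sum.If_cases)
        also have "\<dots> = (\<Sum>y\<in>{..<d} - {b - K..b + K}. path_sum \<omega> i (\<lambda>l. of_bool (b \<in> set l \<and> last l = y)))"
          unfolding path_sum_def sum_distrib_left by (rule sum.swap)
        also have "\<dots> \<le> (\<Sum>y\<in>{..<d} - {b - K..b + K}. reversible \<omega> y / reversible \<omega> b)"
          by (rule sum_mono, rule occupation_after_hitting)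
        also have "\<dots> \<le> 2 * \<gamma>"
          using outside_reversible_mass[OF v] reversible_pos[of b]
          by (simp add: sum_divide_distrib[symmetric] field_simps \<gamma>_def)
        finally show ?thesis .
      qed
      have "Q.prob F2 \<le> (\<Sum>i<n. Q.prob (C2 i)) / (\<epsilon> * n)"
        unfolding F2_def by (rule Q.prob_count_le[OF ev(2) en])
      also have "(\<Sum>i<n. Q.prob (C2 i)) \<le> real n * (2 * \<gamma>)"
        using sum_mono[of "{..<n}" "\<lambda>i. Q.prob (C2 i)" "\<lambda>_. 2 * \<gamma>"] one by simp
      also have "real n * (2 * \<gamma>) / (\<epsilon> * n) \<le> \<epsilon>" using g3(1,2) eps npos
        by (simp add: field_simps power2_eq_square)
      finally show ?thesis using en by (simp add: divide_right_mono)
    qed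
    have F3: "Q.prob F3 \<le> \<epsilon>"
    proof -
      have one: "Q.prob (C3 i) \<le> reversible \<omega> d / reversible \<omega> b" for i
        unfolding C3_def prob_event[of "\<lambda>l. b \<in> set l \<and> last l = d"] by (rule occupation_after_hitting)
      have "T * reversible \<omega> d \<le> 2 * \<gamma> * reversible \<omega> b"
      proof -
        have "T * reversible \<omega> d \<le> 2 * (\<gamma> * conductance \<omega> b)"
        proof -
          have "(\<Sum>k<b. left_mass (conductance \<omega>) k) * (conductance \<omega> (d - 1) + conductance \<omega> d) \<le> \<gamma> * conductance \<omega> b"
            using v unfolding valley_def \<gamma>_def by blast
          moreover have "T * reversible \<omega> d = 2 * ((\<Sum>k<b. left_mass (conductance \<omega>) k) * (conductance \<omega> (d - 1) + conductance \<omega> d))"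
            using bd by (simp add: T_def reversible_def)
          ultimately show ?thesis by linarith
        qed
        also have "\<dots> \<le> 2 * (\<gamma> * reversible \<omega> b)"
          using g3(1) bd conductance_pos[of "b - 1"] by (intro mult_left_mono) (auto simp: reversible_def)
        finally show ?thesis by simp
      qed
      then have r: "T * (reversible \<omega> d / reversible \<omega> b) \<le> 2 * \<gamma>" using reversible_pos[of b] by (simp add: field_simps)
      have "Q.prob F3 \<le> (\<Sum>i<n. Q.prob (C3 i))"
        unfolding F3_def by (rule Q.finite_measure_subadditive_finite) (use ev in auto)
      also have "\<dots> \<le> real n * (reversible \<omega> d / reversible \<omega> b)"
        using sum_mono[of "{..<n}" "\<lambda>i. Q.prob (C3 i)" "\<lambda>_. reversible \<omega> d / reversible \<omega> b"] one by simp
      also have "\<dots> \<le> 2 * T / \<epsilon>\<^sup>2 * (reversible \<omega> d / reversible \<omega> b)"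
        using n2 reversible_pos[of b] reversible_pos[of d] by (intro mult_right_mono) auto
      also have "\<dots> = (T * (reversible \<omega> d / reversible \<omega> b)) * (2 / \<epsilon>\<^sup>2)" by (simp add: mult.commute)
      also have "\<dots> \<le> 2 * \<gamma> * (2 / \<epsilon>\<^sup>2)" using r e2 by (intro mult_right_mono) auto
      also have "\<dots> \<le> \<epsilon>" using g3(3) by simp
      finally show ?thesis .
    qed
    have F4: "Q.prob F4 \<le> \<epsilon>"
    proof -
      have "Q.prob F4 \<le> exp (- \<kappa> * real n)" unfolding F4_def
      proof (rule k(2))
        show "\<bar>h x (x + 1)\<bar> \<le> B" "\<bar>h x (x - 1)\<bar> \<le> B" "0 \<le> up \<omega> x * h x (x + 1) + (1 - up \<omega> x) * h x (x - 1)" for x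
          using valley_drift[OF v ab, of x] unfolding h_def g_def B_def by blast+
      qed simp
      also have "\<dots> \<le> \<epsilon>" using n0(1)[of n] bn nb by linarith
      finally show ?thesis .
    qed
    define Gd where "Gd = {X. (1 - 4 * \<epsilon>) * real n \<le> \<theta> * real (max_local_time X n)}"
    have evs: "F1 \<in> sets Q" "F2 \<in> sets Q" "F3 \<in> sets Q" "F4 \<in> sets Q" "Gd \<in> sets Q"
    proof -
      show "F1 \<in> sets Q" "F2 \<in> sets Q" unfolding F1_def F2_def using ev by measurable
      show "F3 \<in> sets Q" unfolding F3_def using ev by auto
      show "F4 \<in> sets Q" unfolding F4_def by (rule hist_event_sets)
      show "Gd \<in> sets Q" unfolding Gd_def by (rule max_local_time_event)
    qed
    have "AE X in Q. X \<notin> F1 \<longrightarrow> X \<notin> F2 \<longrightarrow> X \<notin> F3 \<longrightarrow> X \<notin> F4 \<longrightarrow> X \<in> Gd"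
      using AE_paths
    proof (rule AE_mp, intro AE_I2 impI)
      fix X assume p: "\<forall>n. hist X n \<in> paths n" and nF: "X \<notin> F1" "X \<notin> F2" "X \<notin> F3" "X \<notin> F4"
      have out: "(1::real) - of_bool (X i \<in> {b - K..b + K}) \<le> indicator (C1 i) X + indicator (C2 i) X" if "i < n" for i
      proof (cases "X i \<in> {b - K..b + K} \<or> b \<notin> set (hist X i)")
        case True then show ?thesis by (auto simp: C1_def)
      next
        case False
        have "X i < d"
        proof (rule before_barrier[OF bd(2), where X = X and n = i])
          show "hist X i \<in> paths i" using p by blast
          show "hist X k \<in> paths k" for k using p by blast
          show "b \<in> set (hist X i)" using False by blast
          fix j assume "j \<le> i" "b \<in> set (hist X j)"
          then show "X j \<noteq> d" using nF(3) that by (auto simp: F3_def C3_def)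
        qed
        then show ?thesis using False by (auto simp: C2_def)
      qed
      have "(\<Sum>i<n. (1::real) - of_bool (X i \<in> {b - K..b + K})) \<le> (\<Sum>i<n. indicator (C1 i) X + indicator (C2 i) X)"
        by (rule sum_mono) (use out in auto)
      also have "\<dots> = (\<Sum>i<n. indicator (C1 i) X) + (\<Sum>i<n. indicator (C2 i) X)" by (rule sum.distrib)
      also have "\<dots> \<le> \<epsilon> * n + \<epsilon> * n" using nF(1,2) by (simp add: F1_def F2_def)
      finally have W: "real n - 2 * (\<epsilon> * n) \<le> (\<Sum>i<n. of_bool (X i \<in> {b - K..b + K}))" by (simp add: sum_subtractf)
      have "- \<epsilon> * real n < additive h (hist X n)" using nF(4) by (simp add: F4_def)
      also have "additive h (hist X n) = - (\<Sum>i<n. g (X (Suc i)) - g (X i)) - (\<Sum>i<n. of_bool (X i \<in> {b - K..b + K})) + \<theta> * (\<Sum>i<n. of_bool (X i = b))"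
        unfolding additive_hist h_def by (simp only: sum.distrib sum_subtractf sum_distrib_left sum_negf)
      also have "(\<Sum>i<n. g (X (Suc i)) - g (X i)) = g (X n) - g (X 0)" by (rule sum_lessThan_telescope)
      finally have low: "- \<epsilon> * real n < - (g (X n) - g (X 0)) - (\<Sum>i<n. of_bool (X i \<in> {b - K..b + K})) + \<theta> * (\<Sum>i<n. of_bool (X i = b))" .
      have "real n - 2 * (\<epsilon> * n) - \<epsilon> * n - g (X 0) \<le> \<theta> * (\<Sum>i<n. of_bool (X i = b))"
      proof -
        have "0 \<le> g (X n)" using ab by (simp add: g_def)
        then show ?thesis using W low by linarith
      qed
      moreover have "g (X 0) \<le> (\<alpha> + \<beta>) * real K"
      proof -
        have "g (X 0) \<le> \<alpha> * real K + \<beta> * real K" unfolding g_def using ab by (intro add_mono mult_left_mono) auto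
        then show ?thesis by (simp add: algebra_simps)
      qed
      moreover have "(\<alpha> + \<beta>) * real K \<le> \<epsilon> * n" using n0(2)[of n] bn nb by linarith
      moreover have "\<theta> * (\<Sum>i<n. of_bool (X i = b)) \<le> \<theta> * real (max_local_time X n)"
      proof (rule mult_left_mono)
        have "(\<Sum>i<n. of_bool (X i = b)) \<le> real (local_time X n (int b))" by (subst local_time_eq_sum) simp
        also have "\<dots> \<le> real (max_local_time X n)" by (simp add: local_time_le_max)
        finally show "(\<Sum>i<n. of_bool (X i = b)) \<le> real (max_local_time X n)" .
      qed (use theta in simp)
      ultimately have "real n - 4 * (\<epsilon> * n) \<le> \<theta> * real (max_local_time X n)" by linarith
      then show "X \<in> Gd" by (simp add: Gd_def algebra_simps)
    qed
    then have "AE X in Q. X \<in> space Q - Gd \<longrightarrow> X \<in> F1 \<union> F2 \<union> F3 \<union> F4" by (rule AE_mp) auto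
    then have "Q.prob (space Q - Gd) \<le> Q.prob (F1 \<union> F2 \<union> F3 \<union> F4)"
      by (rule Q.finite_measure_mono_AE) (use evs in auto)
    also have "\<dots> \<le> Q.prob F1 + Q.prob F2 + Q.prob F3 + Q.prob F4"
      using measure_Un_le[of "F1 \<union> F2 \<union> F3" Q F4] measure_Un_le[of "F1 \<union> F2" Q F3]
        measure_Un_le[of F1 Q F2] evs by (simp add: sets.Un)
    also have "\<dots> \<le> 4 * \<epsilon>" using F1 F2 F3 F4 by simp
    finally have "1 - 4 * \<epsilon> \<le> Q.prob Gd" using Q.prob_compl[OF evs(5)] by simp
    then show "\<exists>n\<ge>b. 1 - 4 * \<epsilon> \<le> Q.prob {X. (1 - 4 * \<epsilon>) * real n \<le> \<theta> * real (max_local_time X n)}"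
      using nb by (auto simp: Gd_def)
  qed
qed

text \<open>For every \<open>\<epsilon>\<close> the event has probability at least \<open>1 - 4 * \<epsilon>\<close> at arbitrarily large times, hence it
  happens beyond any given time almost surely.\<close>

lemma max_local_time_lower:
  assumes theta: "0 < \<theta>" and c: "c < 1"
    and valleys: "\<And>\<epsilon>. 0 < \<epsilon> \<Longrightarrow> \<exists>K \<alpha> \<beta>. 0 \<le> \<alpha> \<and> 0 \<le> \<beta> \<and> (\<forall>N. \<exists>b\<ge>N. \<exists>d. valley \<omega> K \<alpha> \<beta> (\<theta> + \<epsilon>) (\<epsilon> ^ 3 / 6) b d)"
  shows "AE X in Q. \<exists>\<^sub>F n in sequentially. c * real n \<le> \<theta> * real (max_local_time X n)"
proof -
  define A where "A = (\<lambda>n. {X. c * real n \<le> \<theta> * real (max_local_time X n)})"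
  have A: "A n \<in> sets Q" for n unfolding A_def by (rule max_local_time_event)
  have one: "Q.prob (\<Union>n\<in>{N..}. A n) = 1" for N
  proof (rule antisym[OF Q.prob_le_1], rule field_le_epsilon)
    fix e :: real assume e: "0 < e"
    \<comment> \<open>The third bound ensures that \<open>c * (\<theta> + \<epsilon>) \<le> (1 - 4 * \<epsilon>) * \<theta>\<close>.\<close>
    define \<epsilon> where "\<epsilon> = Min {1, e / 4, (1 - c) * \<theta> / (1 + 4 * \<theta>)}"
    have eps: "0 < \<epsilon>" "\<epsilon> \<le> 1" "\<epsilon> \<le> e / 4" "\<epsilon> \<le> (1 - c) * \<theta> / (1 + 4 * \<theta>)"
    proof -
      show "0 < \<epsilon>" using e c theta by (auto simp: \<epsilon>_def intro!: divide_pos_pos)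
      show "\<epsilon> \<le> 1" "\<epsilon> \<le> e / 4" "\<epsilon> \<le> (1 - c) * \<theta> / (1 + 4 * \<theta>)" unfolding \<epsilon>_def by (rule Min_le; simp)+
    qed
    have eps4: "\<epsilon> * (1 + 4 * \<theta>) \<le> (1 - c) * \<theta>" using eps(4) theta by (simp add: field_simps)
    obtain K \<alpha> \<beta> where ab: "0 \<le> \<alpha>" "0 \<le> \<beta>" and val: "\<forall>N. \<exists>b\<ge>N. \<exists>d. valley \<omega> K \<alpha> \<beta> (\<theta> + \<epsilon>) (\<epsilon> ^ 3 / 6) b d"
      using valleys[OF eps(1)] by blast
    obtain n0 where n0: "\<And>b d. n0 \<le> b \<Longrightarrow> valley \<omega> K \<alpha> \<beta> (\<theta> + \<epsilon>) (\<epsilon> ^ 3 / 6) b d \<Longrightarrow>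
      \<exists>n\<ge>b. 1 - 4 * \<epsilon> \<le> Q.prob {X. (1 - 4 * \<epsilon>) * real n \<le> (\<theta> + \<epsilon>) * real (max_local_time X n)}"
      using valley_local_time[OF ab, of "\<theta> + \<epsilon>" \<epsilon> K] theta eps by (metis add_pos_pos)
    obtain b d where "max n0 N \<le> b" "valley \<omega> K \<alpha> \<beta> (\<theta> + \<epsilon>) (\<epsilon> ^ 3 / 6) b d" using val by blast
    then obtain n where n: "N \<le> n" "1 - 4 * \<epsilon> \<le> Q.prob {X. (1 - 4 * \<epsilon>) * real n \<le> (\<theta> + \<epsilon>) * real (max_local_time X n)}"
      using n0[of b d] by (meson le_trans max.boundedE)
    have sub: "{X. (1 - 4 * \<epsilon>) * real n \<le> (\<theta> + \<epsilon>) * real (max_local_time X n)} \<subseteq> A n"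
    proof
      fix X assume "X \<in> {X. (1 - 4 * \<epsilon>) * real n \<le> (\<theta> + \<epsilon>) * real (max_local_time X n)}"
      then have "\<theta> * ((1 - 4 * \<epsilon>) * real n) \<le> \<theta> * ((\<theta> + \<epsilon>) * real (max_local_time X n))"
        using theta by simp
      moreover have "c * (\<theta> + \<epsilon>) \<le> \<theta> * (1 - 4 * \<epsilon>)"
      proof -
        have "c * \<epsilon> \<le> 1 * \<epsilon>" using c eps by (intro mult_right_mono) auto
        then show ?thesis using eps4 by (simp add: algebra_simps)
      qed
      then have "c * (\<theta> + \<epsilon>) * real n \<le> \<theta> * (1 - 4 * \<epsilon>) * real n" by (rule mult_right_mono) simp
      ultimately have "(\<theta> + \<epsilon>) * (c * real n) \<le> (\<theta> + \<epsilon>) * (\<theta> * real (max_local_time X n))"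
        by (simp add: algebra_simps)
      then show "X \<in> A n" using theta eps by (simp add: A_def)
    qed
    have "1 - 4 * \<epsilon> \<le> Q.prob (A n)" using n(2) Q.finite_measure_mono[OF sub A] by simp
    also have "\<dots> \<le> Q.prob (\<Union>n\<in>{N..}. A n)" using n(1) A by (intro Q.finite_measure_mono) auto
    finally show "1 \<le> Q.prob (\<Union>n\<in>{N..}. A n) + e" using eps(3) by simp
  qed
  have "AE X in Q. X \<in> (\<Union>n\<in>{N..}. A n)" for N by (rule Q.AE_prob_1[OF one])
  then have "AE X in Q. \<forall>N. X \<in> (\<Union>n\<in>{N..}. A n)" by (simp add: AE_all_countable)
  then show ?thesis by (rule AE_mp) (auto simp: frequently_sequentially A_def)
qed

end

section \<open>Resampling coordinates of an i.i.d. sequence\<close>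

text \<open>Only invariance under changes of single later coordinates is ever needed, since \<open>resample\<close> changes
  one coordinate at a time. This is weaker than membership in the \<open>\<sigma>\<close>-algebra of the first \<open>n\<close>
  coordinates, and it is checked by rewriting.\<close>

definition determined :: "nat \<Rightarrow> (nat \<Rightarrow> real) set \<Rightarrow> bool" where
  "determined n B \<longleftrightarrow> (\<forall>m>n. \<forall>u x. u(m := x) \<in> B \<longleftrightarrow> u \<in> B)"

lemma determined_mono: "determined n B \<Longrightarrow> n \<le> m \<Longrightarrow> determined m B"
  by (auto simp: determined_def)

lemma determined_Int: "determined n B \<Longrightarrow> determined n C \<Longrightarrow> determined n (B \<inter> C)"
  by (auto simp: determined_def)

lemma determined_Un: "(\<And>i. i \<in> I \<Longrightarrow> determined n (B i)) \<Longrightarrow> determined n (\<Union>i\<in>I. B i)"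
  by (simp add: determined_def)

lemma determined_Diff: "determined n B \<Longrightarrow> determined n C \<Longrightarrow> determined n (B - C)"
  by (auto simp: determined_def)

text \<open>\<open>\<nu>\<close> is the law of a single coordinate and \<open>\<xi>\<close> plays the role of \<open>log \<rho>\<close>. The bound on \<open>\<xi>\<close> holds
  everywhere and not just almost everywhere, so that pathwise estimates hold for all sequences.\<close>

locale bounded_centred =
  fixes \<nu> :: "real measure" and \<xi> :: "real \<Rightarrow> real" and C :: real
  assumes prob: "prob_space \<nu>" and sets_nu [measurable_cong, simp]: "sets \<nu> = sets borel"
    and meas [measurable]: "\<xi> \<in> borel_measurable borel"
    and bound: "\<bar>\<xi> s\<bar> \<le> C"
    and centred: "(\<integral>s. \<xi> s \<partial>\<nu>) = 0"
    and nonzero: "0 < (\<integral>s. (\<xi> s)\<^sup>2 \<partial>\<nu>)"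
begin

sublocale N: prob_space \<nu> by (rule prob)

definition iid :: "(nat \<Rightarrow> real) measure" where "iid = Pi\<^sub>M UNIV (\<lambda>_. \<nu>)"

sublocale P: prob_space iid unfolding iid_def by (rule prob_space_PiM) (rule prob)

lemma space_nu [simp]: "space \<nu> = UNIV"
  using sets_eq_imp_space_eq[OF sets_nu] by simp

lemma space_Pi [simp]: "space iid = UNIV" by (simp add: iid_def space_PiM)

lemma coordinate_measurable [measurable]: "(\<lambda>u. u i) \<in> borel_measurable iid"
proof -
  have "(\<lambda>u. u i) \<in> measurable iid \<nu>" unfolding iid_def by measurable
  then show ?thesis by (simp add: measurable_cong_sets[OF refl sets_nu])
qed

lemma update_measurable [measurable]: "(\<lambda>(x, u). u(n := x)) \<in> measurable (\<nu> \<Otimes>\<^sub>M iid) iid"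
proof -
  have "(\<lambda>p. (snd p)(n := fst p)) \<in> measurable (\<nu> \<Otimes>\<^sub>M iid) (Pi\<^sub>M UNIV (\<lambda>_. \<nu>))"
    by (rule measurable_fun_upd[where J = UNIV]) (auto simp: iid_def)
  then show ?thesis by (simp add: split_def iid_def)
qed

lemma resample_distr: "distr (\<nu> \<Otimes>\<^sub>M iid) iid (\<lambda>(x, u). u(n := x)) = iid"
  using distr_pair_PiM_eq_PiM[of UNIV "\<lambda>_. \<nu>" n] prob by (simp add: iid_def)

sublocale NP: pair_prob_space \<nu> iid ..

text \<open>Independence in the form of an identity: replacing one coordinate by a fresh one does not change the
  law. Applied to a function of the coordinates up to \<open>n\<close>, the inner integral is the conditional
  expectation given the coordinates before \<open>n\<close>.\<close>

lemma resample:
  assumes f [measurable]: "f \<in> borel_measurable iid" and b: "\<And>u. \<bar>f u\<bar> \<le> (B::real)"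
  shows "(\<integral>u. f u \<partial>iid) = (\<integral>u. (\<integral>x. f (u(n := x)) \<partial>\<nu>) \<partial>iid)"
    and "integrable iid (\<lambda>u. \<integral>x. f (u(n := x)) \<partial>\<nu>)"
proof -
  have int: "integrable (\<nu> \<Otimes>\<^sub>M iid) (\<lambda>(x, u). f (u(n := x)))"
  proof (rule NP.P.integrable_const_bound[of _ B])
    show "(\<lambda>(x, u). f (u(n := x))) \<in> borel_measurable (\<nu> \<Otimes>\<^sub>M iid)"
      using measurable_compose[OF update_measurable f] by (simp add: split_def)
  qed (auto intro!: AE_I2 simp: b)
  have "(\<integral>u. f u \<partial>iid) = (\<integral>u. f u \<partial>distr (\<nu> \<Otimes>\<^sub>M iid) iid (\<lambda>(x, u). u(n := x)))"
    by (simp add: resample_distr)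
  also have "\<dots> = (\<integral>p. f ((\<lambda>(x, u). u(n := x)) p) \<partial>(\<nu> \<Otimes>\<^sub>M iid))"
    by (rule integral_distr) (rule update_measurable, rule f)
  also have "\<dots> = (\<integral>(x, u). f (u(n := x)) \<partial>(\<nu> \<Otimes>\<^sub>M iid))" by (simp add: split_def)
  also have "\<dots> = (\<integral>u. (\<integral>x. f (u(n := x)) \<partial>\<nu>) \<partial>iid)"
    by (rule NP.integral_snd[symmetric]) (rule int)
  finally show "(\<integral>u. f u \<partial>iid) = (\<integral>u. (\<integral>x. f (u(n := x)) \<partial>\<nu>) \<partial>iid)" .
  show "integrable iid (\<lambda>u. \<integral>x. f (u(n := x)) \<partial>\<nu>)" by (rule NP.integrable_snd[OF int])
qed

text \<open>Dynkin's formula as an inequality, for a chain \<open>st\<close> driven by the coordinates after \<open>n0\<close> and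
  restricted to an event \<open>B\<close> of the past. It is used with \<open>v > 0\<close> to bound the expected time until a
  chain stops, and with \<open>v < 0\<close> to bound the number of its visits to \<open>A\<close> from below.\<close>

lemma drift_sum:
  fixes st :: "nat \<Rightarrow> (nat \<Rightarrow> real) \<Rightarrow> 's" and f :: "'s \<Rightarrow> real"
  assumes st_Suc: "\<And>k u. st (Suc k) u = F (st k u) (u (n0 + Suc k))"
    and st_det: "\<And>k m x u. n0 + k < m \<Longrightarrow> st k (u(m := x)) = st k u"
    and st_meas [measurable]: "\<And>k. st k \<in> measurable iid S"
    and f [measurable]: "f \<in> borel_measurable S" and A [measurable]: "A \<in> sets S"
    and b: "\<And>k u. \<bar>f (st k u)\<bar> \<le> D"
    and B [measurable]: "B \<in> sets iid" and det: "determined n0 B"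
    and drift: "\<And>k u. f (st k u) + v * indicator A (st k u) \<le> (\<integral>a. f (F (st k u) a) \<partial>\<nu>)"
  shows "(\<integral>u. indicator B u * f (st 0 u) \<partial>iid) + v * (\<Sum>k<m. P.prob (B \<inter> {u. st k u \<in> A}))
    \<le> (\<integral>u. indicator B u * f (st m u) \<partial>iid)"
proof (induction m)
  case 0 then show ?case by simp
next
  case (Suc m)
  have D: "0 \<le> D" using b[of 0 undefined] by linarith
  have bi: "\<bar>indicator B u * f (st k u)\<bar> \<le> D" for k u using b[of k u] D by (auto simp: indicator_def)
  have mb: "(\<lambda>u. indicator B u * f (st k u)) \<in> borel_measurable iid" for k by measurable
  have ib: "integrable iid (\<lambda>u. indicator B u * f (st k u))" for k
    by (rule P.integrable_const_bound[of _ D]) (auto intro!: AE_I2 simp del: abs_mult simp: bi[simplified] mb)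
  have mA: "B \<inter> {u. st m u \<in> A} \<in> sets iid"
    using measurable_sets[OF st_meas A, of m] by (auto simp: vimage_def)
  let ?G = "\<lambda>u. \<integral>x. indicator B (u(n0 + Suc m := x)) * f (st (Suc m) (u(n0 + Suc m := x))) \<partial>\<nu>"
  have "?G u = indicator B u * (\<integral>a. f (F (st m u) a) \<partial>\<nu>)" for u
  proof -
    have "indicator B (u(n0 + Suc m := x)) * f (st (Suc m) (u(n0 + Suc m := x))) = indicator B u * f (F (st m u) x)" for x
    proof -
      have "(u(n0 + Suc m := x) \<in> B) = (u \<in> B)" using det by (simp add: determined_def)
      then show ?thesis by (simp add: st_Suc st_det indicator_def)
    qed
    then show ?thesis by simp
  qed
  then have G: "indicator B u * f (st m u) + v * indicator (B \<inter> {u. st m u \<in> A}) u \<le> ?G u" for u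
    using drift[of m u] by (auto simp: indicator_def)
  have "(\<integral>u. indicator B u * f (st m u) \<partial>iid) + v * P.prob (B \<inter> {u. st m u \<in> A})
      = (\<integral>u. indicator B u * f (st m u) + v * indicator (B \<inter> {u. st m u \<in> A}) u \<partial>iid)"
    using ib[of m] mA by (subst Bochner_Integration.integral_add) (auto simp: less_top[symmetric] P.emeasure_eq_measure)
  also have "\<dots> \<le> (\<integral>u. ?G u \<partial>iid)"
  proof (rule integral_mono)
    show "integrable iid (\<lambda>u. indicator B u * f (st m u) + v * indicator (B \<inter> {u. st m u \<in> A}) u)"
      using ib[of m] mA by (auto simp: less_top[symmetric] P.emeasure_eq_measure)
    show "integrable iid ?G" by (rule resample(2)[OF mb bi])
  qed (rule G)
  also have "\<dots> = (\<integral>u. indicator B u * f (st (Suc m) u) \<partial>iid)"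
    by (rule resample(1)[OF mb bi, symmetric])
  finally show ?case using Suc.IH by (simp add: algebra_simps)
qed

lemma prob_pattern:
  assumes B [measurable]: "B \<in> sets iid" and det: "determined n B" and As [measurable]: "\<And>i. As i \<in> sets borel"
  shows "{u. \<forall>i\<in>{1..L}. u (n + i) \<in> As i} \<in> sets iid" "determined (n + L) {u. \<forall>i\<in>{1..L}. u (n + i) \<in> As i}"
    "P.prob (B \<inter> {u. \<forall>i\<in>{1..L}. u (n + i) \<in> As i}) = P.prob B * (\<Prod>i=1..L. N.prob (As i))"
proof -
  let ?E = "\<lambda>L. {u. \<forall>i\<in>{1..L}. u (n + i) \<in> As i}"
  have S1: "{u. u j \<in> As i} \<in> sets iid" for i j
    using measurable_sets[OF coordinate_measurable As, of j i] by (simp add: vimage_def)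
  have S: "?E L \<in> sets iid" for L
  proof -
    have "?E L = (\<Inter>i\<in>{1..L}. {u. u (n + i) \<in> As i}) \<inter> UNIV" by auto
    also have "\<dots> = space iid \<inter> (\<Inter>i\<in>{1..L}. {u. u (n + i) \<in> As i})" by auto
    also have "\<dots> \<in> sets iid" using sets.top[of iid] by (cases "L = 0") (auto intro!: sets.finite_INT S1)
    finally show ?thesis .
  qed
  have d: "determined (n + L) (?E L)" for L by (auto simp: determined_def)
  show "?E L \<in> sets iid" "determined (n + L) (?E L)" by (rule S, rule d)
  show "P.prob (B \<inter> ?E L) = P.prob B * (\<Prod>i=1..L. N.prob (As i))"
  proof (induction L)
    case 0 then show ?case by simp
  next
    case (Suc L)
    let ?B = "B \<inter> ?E L"
    have dB: "determined (n + L) ?B" using determined_mono[OF det] d by (intro determined_Int) auto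
    have sB: "?B \<in> sets iid" using S B by auto
    have eq: "B \<inter> ?E (Suc L) = ?B \<inter> {u. u (n + Suc L) \<in> As (Suc L)}" by (auto simp: atLeastAtMostSuc_conv)
    have s2: "B \<inter> ?E (Suc L) \<in> sets iid" using S B by auto
    have "P.prob (B \<inter> ?E (Suc L)) = (\<integral>u. indicator (B \<inter> ?E (Suc L)) u \<partial>iid)" using s2 by simp
    also have "\<dots> = (\<integral>u. (\<integral>x. indicator (B \<inter> ?E (Suc L)) (u(n + Suc L := x)) \<partial>\<nu>) \<partial>iid)"
      using s2 by (intro resample(1)[where B = 1]) (auto simp: indicator_def)
    also have "\<dots> = (\<integral>u. indicator ?B u * N.prob (As (Suc L)) \<partial>iid)"
    proof (rule Bochner_Integration.integral_cong[OF refl])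
      fix u
      have "indicator (B \<inter> ?E (Suc L)) (u(n + Suc L := x)) = indicator ?B u * (indicator (As (Suc L)) x :: real)" for x
      proof -
        have "u(n + Suc L := x) \<in> ?B \<longleftrightarrow> u \<in> ?B" using dB unfolding determined_def by simp
        then show ?thesis unfolding eq by (simp add: indicator_def)
      qed
      then show "(\<integral>x. indicator (B \<inter> ?E (Suc L)) (u(n + Suc L := x)) \<partial>\<nu>) = indicator ?B u * N.prob (As (Suc L))" by simp
    qed
    also have "\<dots> = P.prob ?B * N.prob (As (Suc L))" using sB by simp
    finally show ?case using Suc.IH by (simp add: mult.assoc)
  qed
qed

end

section \<open>Low points of a centred potential\<close>

lemma inverse_sqrt_ge: "0 \<le> x \<Longrightarrow> 1 - x / 2 \<le> 1 / sqrt (1 + x)" for x :: real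
proof -
  assume x: "0 \<le> x"
  have s: "sqrt (1 + x) \<le> 1 + x / 2" by (rule real_le_lsqrt) (use x in \<open>auto simp: power2_eq_square algebra_simps\<close>)
  have "1 - x / 2 \<le> 1 / (1 + x / 2)"
  proof -
    have "(1 - x / 2) * (1 + x / 2) \<le> 1" by (simp add: algebra_simps)
    then show ?thesis using x by (simp add: pos_le_divide_eq)
  qed
  also have "\<dots> \<le> 1 / sqrt (1 + x)" using s x by (intro divide_left_mono) auto
  finally show ?thesis .
qed

lemma exp_eq_add_one_iff: "exp y = 1 + y \<longleftrightarrow> y = 0" for y :: real
proof
  assume e: "exp y = 1 + y"
  show "y = 0"
  proof (cases "0 \<le> 1 + y / 2")
    case True
    have "(1 + y / 2)\<^sup>2 \<le> (exp (y / 2))\<^sup>2" using True by (intro power_mono exp_ge_add_one_self)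
    also have "\<dots> = exp y" by (simp add: power2_eq_square exp_add[symmetric])
    finally have "y * y \<le> 0" using e by (simp add: power2_eq_square algebra_simps)
    then show ?thesis by (auto simp: mult_le_0_iff)
  next
    case False
    then have "1 + y < 0" by simp
    then show ?thesis using e exp_gt_zero[of y] by linarith
  qed
qed simp

context bounded_centred begin

lemma bounded_integrable: "f \<in> borel_measurable borel \<Longrightarrow> (\<And>s. \<bar>f s\<bar> \<le> D) \<Longrightarrow> integrable \<nu> f" for f :: "real \<Rightarrow> real"
  by (rule N.integrable_const_bound[of _ D]) (auto intro!: AE_I2 simp: measurable_cong_sets[OF sets_nu refl])

lemma C_pos: "0 < C"
proof (rule ccontr)
  assume "\<not> 0 < C"
  then have "\<xi> s = 0" for s using bound[of s] by simp
  then show False using nonzero by simp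
qed

lemma integrable_xi [simp]: "integrable \<nu> \<xi>" by (rule bounded_integrable[OF meas bound])

lemma integrable_xi2 [simp]: "integrable \<nu> (\<lambda>s. (\<xi> s)\<^sup>2)"
proof (rule bounded_integrable[where D = "C\<^sup>2"])
  show "\<bar>(\<xi> s)\<^sup>2\<bar> \<le> C\<^sup>2" for s using bound[of s] by (simp add: abs_le_square_iff[symmetric])
qed simp

lemma integrable_exp_xi: "integrable \<nu> (\<lambda>s. exp (a * \<xi> s))"
proof (rule bounded_integrable[where D = "exp (\<bar>a\<bar> * C)"])
  fix s
  have "a * \<xi> s \<le> \<bar>a\<bar> * \<bar>\<xi> s\<bar>" by (metis abs_ge_self abs_mult)
  also have "\<dots> \<le> \<bar>a\<bar> * C" by (intro mult_left_mono bound) simp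
  finally show "\<bar>exp (a * \<xi> s)\<bar> \<le> exp (\<bar>a\<bar> * C)" by simp
qed simp

lemma xi_nonzero_AE: "\<not> (AE s in \<nu>. \<xi> s = 0)"
proof
  assume "AE s in \<nu>. \<xi> s = 0"
  then have "(\<integral>s. (\<xi> s)\<^sup>2 \<partial>\<nu>) = (\<integral>s. 0 \<partial>\<nu>)"
    by (intro integral_cong_AE) (auto simp: measurable_cong_sets[OF sets_nu refl])
  then show False using nonzero by simp
qed

text \<open>This exceeds \<open>1\<close> by Jensen's inequality. Hence \<open>exp (- V / 2)\<close> has strictly positive drift, which
  supplies the concave corrections in the two test functions below.\<close>

definition \<phi> :: real where "\<phi> = (\<integral>s. exp (- 1 / 2 * \<xi> s) \<partial>\<nu>)"

lemma phi_gt_1: "1 < \<phi>"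
proof -
  let ?f = "\<lambda>s. exp (- 1 / 2 * \<xi> s) - 1 - (- 1 / 2) * \<xi> s"
  have i: "integrable \<nu> ?f" by (intro Bochner_Integration.integrable_diff integrable_exp_xi) auto
  have v: "integral\<^sup>L \<nu> ?f = \<phi> - 1"
    unfolding \<phi>_def using integrable_exp_xi[of "- 1 / 2"] by (simp add: centred N.prob_space[simplified])
  have nn: "0 \<le> ?f s" for s using exp_ge_add_one_self[of "- 1 / 2 * \<xi> s"] by linarith
  then have "0 \<le> integral\<^sup>L \<nu> ?f" by (rule Bochner_Integration.integral_nonneg)
  moreover have "integral\<^sup>L \<nu> ?f \<noteq> 0"
  proof
    assume "integral\<^sup>L \<nu> ?f = 0"
    then have "AE s in \<nu>. ?f s = 0" using integral_nonneg_eq_0_iff_AE[OF i] nn by auto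
    then have "AE s in \<nu>. \<xi> s = 0"
    proof (rule AE_mp, intro AE_I2 impI)
      fix s assume "?f s = 0"
      then have "exp (- 1 / 2 * \<xi> s) = 1 + (- 1 / 2 * \<xi> s)" by linarith
      then show "\<xi> s = 0" unfolding exp_eq_add_one_iff by simp
    qed
    then show False using xi_nonzero_AE by blast
  qed
  ultimately show ?thesis using v by linarith
qed

definition positive_variance :: real where "positive_variance = (\<integral>s. (max 0 (\<xi> s))\<^sup>2 \<partial>\<nu>)"

lemma integrable_positive_part_square: "integrable \<nu> (\<lambda>s. (max 0 (\<xi> s))\<^sup>2)"
proof (rule bounded_integrable[where D = "C\<^sup>2"])
  show "\<bar>(max 0 (\<xi> s))\<^sup>2\<bar> \<le> C\<^sup>2" for s using bound[of s] C_pos by (auto simp: max_def abs_le_square_iff[symmetric])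
qed simp

lemma positive_variance_pos: "0 < positive_variance"
proof -
  have "0 \<le> positive_variance" unfolding positive_variance_def by (rule Bochner_Integration.integral_nonneg) simp
  moreover have "positive_variance \<noteq> 0"
  proof
    assume "positive_variance = 0"
    then have "AE s in \<nu>. (max 0 (\<xi> s))\<^sup>2 = 0" unfolding positive_variance_def
      using integral_nonneg_eq_0_iff_AE[OF integrable_positive_part_square] by auto
    then have neg: "AE s in \<nu>. \<xi> s \<le> 0" by (rule AE_mp) (auto simp: max_def split: if_splits)
    have "AE s in \<nu>. - \<xi> s = 0"
      using integral_nonneg_eq_0_iff_AE[of \<nu> "\<lambda>s. - \<xi> s"] neg by (simp add: centred)
    then show False using xi_nonzero_AE by simp
  qed
  ultimately show ?thesis by linarith
qed

text \<open>With \<open>c k = exp (- (\<Sum>i=1..k. \<xi> (u i)))\<close> this is \<open>left_mass c\<close>, see \<open>Y_eq_left_mass\<close>; the recursion shows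
  that it is a Markov chain.\<close>

primrec Y :: "(nat \<Rightarrow> real) \<Rightarrow> nat \<Rightarrow> real" where
  "Y u 0 = 1"
| "Y u (Suc k) = 1 + exp (\<xi> (u (Suc k))) * Y u k"

lemma Y_ge_1: "1 \<le> Y u k"
proof (induction k)
  case (Suc k)
  then have "0 \<le> exp (\<xi> (u (Suc k))) * Y u k" by (intro mult_nonneg_nonneg) auto
  then show ?case by simp
qed simp

lemma Y_le: "Y u (k + m) \<le> (1 + exp C) ^ m * Y u k"
proof (induction m)
  case (Suc m)
  have e: "exp (\<xi> (u (Suc (k + m)))) \<le> exp C" using bound[of "u (Suc (k + m))"] by auto
  have "Y u (k + Suc m) \<le> Y u (k + m) + exp C * Y u (k + m)"
  proof -
    have "exp (\<xi> (u (Suc (k + m)))) * Y u (k + m) \<le> exp C * Y u (k + m)"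
      using Y_ge_1[of u "k + m"] by (intro mult_right_mono[OF e]) simp
    then show ?thesis using Y_ge_1[of u "k + m"] unfolding add_Suc_right Y.simps by linarith
  qed
  also have "\<dots> = (1 + exp C) * Y u (k + m)" by (simp add: algebra_simps)
  also have "\<dots> \<le> (1 + exp C) * ((1 + exp C) ^ m * Y u k)" by (intro mult_left_mono Suc.IH) (auto intro: add_nonneg_nonneg)
  finally show ?case by (simp add: mult.assoc)
qed simp

lemma Y_measurable [measurable]: "(\<lambda>u. Y u k) \<in> borel_measurable iid"
  by (induction k) auto

lemma Y_update: "k < m \<Longrightarrow> Y (u(m := x)) k = Y u k"
  by (induction k) auto

text \<open>The process \<open>Y\<close> from index \<open>n\<close> on, stopped when it reaches the level \<open>R\<close>.\<close>

primrec stopped_Y :: "real \<Rightarrow> nat \<Rightarrow> nat \<Rightarrow> (nat \<Rightarrow> real) \<Rightarrow> real" where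
  "stopped_Y R n 0 u = Y u n"
| "stopped_Y R n (Suc k) u = (if stopped_Y R n k u < R then 1 + exp (\<xi> (u (n + Suc k))) * stopped_Y R n k u else stopped_Y R n k u)"

lemma stopped_Y_measurable [measurable]: "stopped_Y R n k \<in> borel_measurable iid"
proof (induction k)
  case 0 have "(\<lambda>u. Y u n) \<in> borel_measurable iid" by measurable then show ?case by simp
next
  case (Suc k)
  note [measurable] = Suc
  have "(\<lambda>u. if stopped_Y R n k u < R then 1 + exp (\<xi> (u (n + Suc k))) * stopped_Y R n k u else stopped_Y R n k u) \<in> borel_measurable iid"
    by measurable
  then show ?case by simp
qed

lemma stopped_Y_update: "n + k < m \<Longrightarrow> stopped_Y R n k (u(m := x)) = stopped_Y R n k u"
  by (induction k) (auto simp: Y_update)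

lemma stopped_Y_ge_1: "1 \<le> stopped_Y R n k u"
proof (induction k)
  case (Suc k)
  then have "0 \<le> exp (\<xi> (u (n + Suc k))) * stopped_Y R n k u" by (intro mult_nonneg_nonneg) auto
  then show ?case using Suc by simp
qed (simp add: Y_ge_1)

lemma stopped_Y_le: "1 \<le> R \<Longrightarrow> Y u n \<le> R \<Longrightarrow> stopped_Y R n k u \<le> (1 + exp C) * R"
proof (induction k)
  case 0
  have "1 * R \<le> (1 + exp C) * R" using 0 by (intro mult_right_mono) auto
  then have "Y u n \<le> (1 + exp C) * R" using 0 by linarith
  then show ?case by simp
next
  case (Suc k)
  show ?case
  proof (cases "stopped_Y R n k u < R")
    case True
    have e: "exp (\<xi> (u (Suc (n + k)))) \<le> exp C" using bound[of "u (Suc (n + k))"] by auto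
    have "exp (\<xi> (u (Suc (n + k)))) * stopped_Y R n k u \<le> exp C * R"
      using e True stopped_Y_ge_1[of R n k u] by (intro mult_mono) auto
    then show ?thesis using True Suc.prems by (simp add: algebra_simps)
  next
    case False
    then show ?thesis using Suc.IH[OF Suc.prems] unfolding stopped_Y.simps by argo
  qed
qed

lemma stopped_Y_eq_Y: "stopped_Y R n k u < R \<Longrightarrow> i \<le> k \<Longrightarrow> stopped_Y R n i u = Y u (n + i) \<and> Y u (n + i) < R"
proof (induction k arbitrary: i)
  case (Suc k)
  have lt: "stopped_Y R n k u < R" using Suc.prems(1) unfolding stopped_Y.simps by argo
  have "stopped_Y R n k u = Y u (n + k)" using Suc.IH[OF lt, of k] by simp
  then have "stopped_Y R n (Suc k) u = Y u (n + Suc k)" using lt by simp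
  then have "i = Suc k \<Longrightarrow> ?case" using Suc.prems(1) by metis
  moreover have "i \<le> k \<Longrightarrow> ?case" by (rule Suc.IH[OF lt])
  ultimately show ?case using Suc.prems(2) by linarith
qed simp

lemma ln_step_bounds:
  assumes z: "1 \<le> z"
  shows "ln z + \<xi> a \<le> ln (1 + exp (\<xi> a) * z)" "ln (1 + exp (\<xi> a) * z) \<le> ln z + \<xi> a + exp C / z"
proof -
  have x: "exp (- \<xi> a) \<le> exp C" using bound[of a] by auto
  have p: "0 < exp (\<xi> a) * z" using z by simp
  have eq: "1 + exp (\<xi> a) * z = exp (\<xi> a) * z * (1 + exp (- \<xi> a) / z)"
  proof -
    have "exp (\<xi> a) * z * (exp (- \<xi> a) / z) = exp (\<xi> a) * exp (- \<xi> a)" using z by simp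
    also have "\<dots> = 1" by (metis exp_minus_inverse)
    finally show ?thesis by (simp add: distrib_left)
  qed
  have pos: "0 < 1 + exp (- \<xi> a) / z" using z by (intro add_pos_nonneg) auto
  have ln: "ln (1 + exp (\<xi> a) * z) = \<xi> a + ln z + ln (1 + exp (- \<xi> a) / z)"
    unfolding eq using p pos z by (simp add: ln_mult)
  have "ln (1 + exp (- \<xi> a) / z) \<le> exp (- \<xi> a) / z" using z by (intro ln_add_one_self_le_self) auto
  also have "\<dots> \<le> exp C / z" using x z by (intro divide_right_mono) auto
  finally show "ln (1 + exp (\<xi> a) * z) \<le> ln z + \<xi> a + exp C / z" using ln by simp
  have "0 \<le> ln (1 + exp (- \<xi> a) / z)" using z by (intro ln_ge_zero) auto
  then show "ln z + \<xi> a \<le> ln (1 + exp (\<xi> a) * z)" using ln by simp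
qed

lemma inverse_sqrt_step:
  assumes z: "1 \<le> z"
  shows "1 / sqrt z * (exp (- 1 / 2 * \<xi> a) - exp (2 * C) / z) \<le> 1 / sqrt (1 + exp (\<xi> a) * z)"
proof -
  define x where "x = exp (- \<xi> a) / z"
  have x0: "0 \<le> x" using z by (simp add: x_def)
  have eq: "1 + exp (\<xi> a) * z = (exp (1 / 2 * \<xi> a))\<^sup>2 * z * (1 + x)"
  proof -
    have "(exp (1 / 2 * \<xi> a))\<^sup>2 = exp (\<xi> a)" by (simp add: exp_double[symmetric])
    moreover have "exp (\<xi> a) * z * (exp (- \<xi> a) / z) = exp (\<xi> a) * exp (- \<xi> a)" using z by simp
    moreover have "exp (\<xi> a) * exp (- \<xi> a) = 1" by (metis exp_minus_inverse)
    ultimately show ?thesis by (simp add: x_def distrib_left)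
  qed
  have sq: "sqrt (1 + exp (\<xi> a) * z) = exp (1 / 2 * \<xi> a) * sqrt z * sqrt (1 + x)"
    unfolding eq by (simp add: real_sqrt_mult)
  have "exp (- 1 / 2 * \<xi> a) * x \<le> exp C * (exp C / z)"
    unfolding x_def using bound[of a] C_pos z by (intro mult_mono divide_right_mono) auto
  also have "\<dots> = exp (2 * C) / z" by (simp add: exp_add[symmetric])
  finally have "exp (- 1 / 2 * \<xi> a) - exp (2 * C) / z \<le> exp (- 1 / 2 * \<xi> a) * (1 - x)" by (simp add: algebra_simps)
  also have "\<dots> \<le> exp (- 1 / 2 * \<xi> a) * (1 / sqrt (1 + x))"
    using inverse_sqrt_ge[OF x0] x0 by (intro mult_left_mono) auto
  finally have "1 / sqrt z * (exp (- 1 / 2 * \<xi> a) - exp (2 * C) / z) \<le> 1 / sqrt z * (exp (- 1 / 2 * \<xi> a) * (1 / sqrt (1 + x)))"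
    using z by (intro mult_left_mono) auto
  also have "\<dots> = 1 / sqrt (1 + exp (\<xi> a) * z)" 
  proof -
    have m: "- 1 / 2 * \<xi> a = - (1 / 2 * \<xi> a)" by simp
    have "exp (- 1 / 2 * \<xi> a) = 1 / exp (1 / 2 * \<xi> a)" unfolding m exp_minus by (rule inverse_eq_divide)
    then show ?thesis unfolding sq by simp
  qed
  finally show ?thesis .
qed

text \<open>Above this level the gain of \<open>1 / sqrt Y\<close>, of order \<open>(\<phi> - 1) / sqrt Y\<close>, outweighs the drift of \<open>ln Y\<close>,
  of order \<open>1 / Y\<close>.\<close>

definition low_level :: real where "low_level = (2 * exp (2 * C) / (\<phi> - 1))\<^sup>2 + 1"

text \<open>The process \<open>ln Y\<close> is a submartingale with small upward drift. Subtracting \<open>1 / sqrt Y\<close> turns it into a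
  supermartingale above \<open>low_level\<close>, so that \<open>ln Y\<close> can rise in mean only by visits below that level.\<close>

lemma lyapunov_drift:
  assumes z: "1 \<le> z"
  shows "(1 / sqrt z - ln z) - (1 + exp C) * of_bool (z < low_level) \<le> (\<integral>a. 1 / sqrt (1 + exp (\<xi> a) * z) - ln (1 + exp (\<xi> a) * z) \<partial>\<nu>)"
proof -
  let ?h = "\<lambda>a. 1 / sqrt (1 + exp (\<xi> a) * z) - ln (1 + exp (\<xi> a) * z)"
  have p: "1 \<le> 1 + exp (\<xi> a) * z" for a using z by simp
  have ih: "integrable \<nu> ?h"
  proof (rule bounded_integrable[where D = "1 + (ln z + C + exp C / z)"])
    fix a
    have a1: "0 \<le> 1 / sqrt (1 + exp (\<xi> a) * z)" "1 / sqrt (1 + exp (\<xi> a) * z) \<le> 1"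
      using p[of a] by auto
    have a2: "0 \<le> ln (1 + exp (\<xi> a) * z)" "ln (1 + exp (\<xi> a) * z) \<le> ln z + C + exp C / z"
      using p[of a] ln_step_bounds[OF z, of a] bound[of a] by auto
    show "\<bar>?h a\<bar> \<le> 1 + (ln z + C + exp C / z)" unfolding abs_le_iff using a1 a2 by (intro conjI; linarith)
  qed simp
  show ?thesis
  proof (cases "z < low_level")
    case True
    let ?g = "\<lambda>a. - (ln z + \<xi> a + exp C / z)"
    have "(\<integral>a. ?g a \<partial>\<nu>) \<le> (\<integral>a. ?h a \<partial>\<nu>)"
    proof (rule integral_mono[OF _ ih])
      show "?g a \<le> ?h a" for a
      proof -
        have "0 \<le> 1 / sqrt (1 + exp (\<xi> a) * z)" using p[of a] by simp
        then show ?thesis using ln_step_bounds(2)[OF z, of a] by linarith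
      qed
    qed simp
    moreover have "(\<integral>a. ?g a \<partial>\<nu>) = - (ln z + exp C / z)"
      by (simp add: centred N.prob_space[simplified])
    moreover have "1 / sqrt z \<le> 1" "exp C / z \<le> exp C" using z by (auto simp: field_simps)
    ultimately show ?thesis using True by simp
  next
    case False
    then have zS: "low_level \<le> z" by simp
    let ?g = "\<lambda>a. 1 / sqrt z * (exp (- 1 / 2 * \<xi> a) - exp (2 * C) / z) - (ln z + \<xi> a + exp C / z)"
    have "(\<integral>a. ?g a \<partial>\<nu>) \<le> (\<integral>a. ?h a \<partial>\<nu>)"
    proof (rule integral_mono[OF _ ih])
      show "integrable \<nu> ?g" using integrable_exp_xi[of "- 1 / 2"] by (intro Bochner_Integration.integrable_diff Bochner_Integration.integrable_add integrable_mult_right) auto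
      show "?g a \<le> ?h a" for a
        using ln_step_bounds(2)[OF z, of a] inverse_sqrt_step[OF z, of a] by linarith
    qed
    moreover have "(\<integral>a. ?g a \<partial>\<nu>) = 1 / sqrt z * (\<phi> - exp (2 * C) / z) - (ln z + exp C / z)"
      using integrable_exp_xi[of "- 1 / 2"] by (simp add: centred N.prob_space[simplified] \<phi>_def diff_divide_distrib)
    moreover have "1 / sqrt z \<le> 1 / sqrt z * (\<phi> - exp (2 * C) / z) - exp C / z"
    proof -
      define q where "q = sqrt z"
      have q: "1 \<le> q" "z = q * q" using z by (auto simp: q_def)
      have ph: "0 < \<phi> - 1" using phi_gt_1 by simp
      have "(2 * exp (2 * C) / (\<phi> - 1))\<^sup>2 \<le> z" using zS by (simp add: low_level_def)
      then have "2 * exp (2 * C) / (\<phi> - 1) \<le> q" unfolding q_def by (rule real_le_rsqrt)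
      then have 1: "2 * exp (2 * C) \<le> q * (\<phi> - 1)" using ph by (simp add: pos_divide_le_eq)
      have "exp C \<le> exp (2 * C)" using C_pos by simp
      moreover have "exp (2 * C) / q \<le> exp (2 * C)" using q by (simp add: field_simps)
      ultimately have 2: "exp (2 * C) / q + exp C \<le> q * (\<phi> - 1)" using 1 by linarith
      have "(1 / q * (\<phi> - exp (2 * C) / z) - exp C / z) - 1 / q = (q * (\<phi> - 1) - (exp (2 * C) / q + exp C)) / z"
        using q(1) unfolding q(2) by (simp add: field_simps)
      moreover have "0 \<le> (q * (\<phi> - 1) - (exp (2 * C) / q + exp C)) / z" using 2 z by (intro divide_nonneg_pos) auto
      ultimately show ?thesis by (simp add: q_def)
    qed
    ultimately show ?thesis using False by simp
  qed
qed

text \<open>With \<open>L = ln z\<close>, the new value of \<open>ln Y\<close> is at least \<open>max 0 (L + \<xi>)\<close>, and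
  \<open>(max 0 (L + \<xi>))\<^sup>2 \<ge> L\<^sup>2 + 2 * L * \<xi> + (max 0 \<xi>)\<^sup>2\<close> for all \<open>L \<ge> 0\<close>.\<close>

lemma log_square_drift:
  assumes z: "1 \<le> z"
  shows "(ln z)\<^sup>2 + positive_variance \<le> (\<integral>a. (ln (1 + exp (\<xi> a) * z))\<^sup>2 \<partial>\<nu>)"
proof -
  define L where "L = ln z"
  have L: "0 \<le> L" using z by (simp add: L_def)
  have b: "L + \<xi> a \<le> ln (1 + exp (\<xi> a) * z)" "ln (1 + exp (\<xi> a) * z) \<le> L + \<xi> a + exp C / z" "0 \<le> ln (1 + exp (\<xi> a) * z)" for a
    using ln_step_bounds[OF z, of a] z by (auto simp: L_def)
  have "(\<integral>a. L\<^sup>2 + 2 * L * \<xi> a + (max 0 (\<xi> a))\<^sup>2 \<partial>\<nu>) \<le> (\<integral>a. (ln (1 + exp (\<xi> a) * z))\<^sup>2 \<partial>\<nu>)"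
  proof (rule integral_mono)
    show "integrable \<nu> (\<lambda>a. L\<^sup>2 + 2 * L * \<xi> a + (max 0 (\<xi> a))\<^sup>2)"
      using integrable_positive_part_square by simp
    show "integrable \<nu> (\<lambda>a. (ln (1 + exp (\<xi> a) * z))\<^sup>2)"
    proof (rule bounded_integrable[where D = "(L + C + exp C / z)\<^sup>2"])
      fix a
      have "(ln (1 + exp (\<xi> a) * z))\<^sup>2 \<le> (L + C + exp C / z)\<^sup>2"
        using b[of a] bound[of a] by (intro power_mono) auto
      then show "\<bar>(ln (1 + exp (\<xi> a) * z))\<^sup>2\<bar> \<le> (L + C + exp C / z)\<^sup>2" by simp
    qed simp
    fix a
    show "L\<^sup>2 + 2 * L * \<xi> a + (max 0 (\<xi> a))\<^sup>2 \<le> (ln (1 + exp (\<xi> a) * z))\<^sup>2"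
    proof (cases "0 \<le> L + \<xi> a")
      case True
      have "L\<^sup>2 + 2 * L * \<xi> a + (max 0 (\<xi> a))\<^sup>2 \<le> (L + \<xi> a)\<^sup>2" by (auto simp: max_def power2_eq_square algebra_simps)
      also have "\<dots> \<le> (ln (1 + exp (\<xi> a) * z))\<^sup>2" using True b[of a] by (intro power_mono) auto
      finally show ?thesis .
    next
      case False
      then have "L * (L + 2 * \<xi> a) \<le> 0" using L by (intro mult_nonneg_nonpos) auto
      moreover have "max 0 (\<xi> a) = 0" using False L by auto
      ultimately have "L\<^sup>2 + 2 * L * \<xi> a + (max 0 (\<xi> a))\<^sup>2 \<le> 0" by (simp add: power2_eq_square algebra_simps)
      then show ?thesis by (rule order_trans) simp
    qed
  qed
  moreover have "(\<integral>a. L\<^sup>2 + 2 * L * \<xi> a + (max 0 (\<xi> a))\<^sup>2 \<partial>\<nu>) = L\<^sup>2 + positive_variance"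
    using integrable_positive_part_square by (simp add: centred positive_variance_def N.prob_space[simplified])
  ultimately show ?thesis by (simp add: L_def)
qed

lemma integrable_indicator_mult:
  assumes "B \<in> sets iid" "f \<in> borel_measurable iid" "\<And>u. \<bar>f u\<bar> \<le> D"
  shows "integrable iid (\<lambda>u. indicator B u * f u :: real)"
proof (rule P.integrable_const_bound[of _ D])
  have "0 \<le> D" using assms(3)[of undefined] by linarith
  then show "AE u in iid. norm (indicator B u * f u) \<le> D" using assms(3) by (intro AE_I2) (auto simp: indicator_def)
  show "(\<lambda>u. indicator B u * f u) \<in> borel_measurable iid" using assms(1,2) by measurable
qed

text \<open>Up to the time when \<open>Y\<close> reaches \<open>exp r\<close> its logarithm has to rise by at least \<open>3 / 4 * r\<close>, while by
  \<open>lyapunov_drift\<close> each visit below \<open>low_level\<close> contributes at most \<open>1 + exp C\<close> to this rise in mean. The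
  drift of the squared logarithm shows that the level is reached within \<open>t\<close> steps with probability at
  least \<open>1 / 2\<close>.\<close>

lemma expected_low_visits:
  assumes r: "8 \<le> r" and n: "real n * ln (1 + exp C) \<le> r / 4"
    and B [measurable]: "B \<in> sets iid" and det: "determined n B"
    and t: "2 * (r + ln (1 + exp C))\<^sup>2 / positive_variance \<le> real t"
  shows "r / (8 * (1 + exp C)) * P.prob B \<le> (\<Sum>k<t. P.prob (B \<inter> {u. stopped_Y (exp r) n k u < low_level}))"
proof -
  define R where "R = exp r"
  define D where "D = r + ln (1 + exp C)"
  have lnC: "0 \<le> ln (1 + exp C)" by (intro ln_ge_zero) simp
  have R: "1 \<le> R" using r by (simp add: R_def)
  have Yn: "Y u n \<le> exp (r / 4)" for u
  proof -
    have "Y u n \<le> (1 + exp C) ^ n" using Y_le[of u 0 n] by simp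
    also have "\<dots> = exp (real n * ln (1 + exp C))"
      by (subst exp_of_nat_mult) (simp add: add_pos_pos)
    also have "\<dots> \<le> exp (r / 4)" using n by simp
    finally show ?thesis .
  qed
  have YR: "Y u n \<le> R" for u
    using order_trans[OF Yn[of u], of R] r by (simp add: R_def)
  have ln_stopped: "0 \<le> ln (stopped_Y R n k u)" "ln (stopped_Y R n k u) \<le> D" for k u
  proof -
    have z: "1 \<le> stopped_Y R n k u" by (rule stopped_Y_ge_1)
    then show "0 \<le> ln (stopped_Y R n k u)" by simp
    have "ln (stopped_Y R n k u) \<le> ln ((1 + exp C) * R)" using z stopped_Y_le[OF R YR, of k u] by (subst ln_le_cancel_iff) auto
    also have "\<dots> = D"
    proof -
      have "0 < 1 + exp C" by (simp add: add_pos_pos)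
      then show ?thesis by (simp add: ln_mult_pos R_def D_def)
    qed
    finally show "ln (stopped_Y R n k u) \<le> D" .
  qed
  have D0: "0 \<le> D" using r lnC by (simp add: D_def)
  have sets_stopped: "{u. stopped_Y R n k u < a} \<in> sets iid" for k a
    using measurable_sets[OF stopped_Y_measurable, of "{..<a}" R n k] by (simp add: vimage_def)
  have PB: "(\<integral>u. indicator B u * a \<partial>iid) = P.prob B * a" for a by simp
  have half: "P.prob (B \<inter> {u. stopped_Y R n t u < R}) \<le> P.prob B / 2"
  proof -
    have "(\<integral>u. indicator B u * (ln (stopped_Y R n 0 u))\<^sup>2 \<partial>iid) + positive_variance * (\<Sum>k<t. P.prob (B \<inter> {u. stopped_Y R n k u \<in> {..<R}}))
      \<le> (\<integral>u. indicator B u * (ln (stopped_Y R n t u))\<^sup>2 \<partial>iid)"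
    proof (rule drift_sum[where F = "\<lambda>z a. if z < R then 1 + exp (\<xi> a) * z else z" and S = borel and D = "D\<^sup>2"])
      show "\<bar>(ln (stopped_Y R n k u))\<^sup>2\<bar> \<le> D\<^sup>2" for k u using ln_stopped[of k u] by (simp add: power_mono)
      show "(ln (stopped_Y R n k u))\<^sup>2 + positive_variance * indicator {..<R} (stopped_Y R n k u)
         \<le> (\<integral>a. (ln (if stopped_Y R n k u < R then 1 + exp (\<xi> a) * stopped_Y R n k u else stopped_Y R n k u))\<^sup>2 \<partial>\<nu>)" for k u
        using log_square_drift[OF stopped_Y_ge_1[of R n k u]] N.prob_space by (simp add: indicator_def)
    qed (auto simp: stopped_Y_update det)
    moreover have "0 \<le> (\<integral>u. indicator B u * (ln (stopped_Y R n 0 u))\<^sup>2 \<partial>iid)"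
      by (rule Bochner_Integration.integral_nonneg) simp
    moreover have "(\<integral>u. indicator B u * (ln (stopped_Y R n t u))\<^sup>2 \<partial>iid) \<le> (\<integral>u. indicator B u * D\<^sup>2 \<partial>iid)"
    proof (rule integral_mono)
      show "integrable iid (\<lambda>u. indicator B u * (ln (stopped_Y R n t u))\<^sup>2)"
        by (rule integrable_indicator_mult[where D = "D\<^sup>2"]) (use ln_stopped in \<open>auto simp: power_mono\<close>)
      show "integrable iid (\<lambda>u. indicator B u * D\<^sup>2)" by (rule integrable_indicator_mult[where D = "D\<^sup>2"]) auto
      show "indicator B u * (ln (stopped_Y R n t u))\<^sup>2 \<le> indicator B u * D\<^sup>2" for u
        using ln_stopped by (intro mult_left_mono power_mono) auto
    qed
    ultimately have "positive_variance * (\<Sum>k<t. P.prob (B \<inter> {u. stopped_Y R n k u < R})) \<le> P.prob B * D\<^sup>2"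
      unfolding PB lessThan_iff by linarith
    moreover have "real t * P.prob (B \<inter> {u. stopped_Y R n t u < R}) \<le> (\<Sum>k<t. P.prob (B \<inter> {u. stopped_Y R n k u < R}))"
    proof -
      have "(\<Sum>k<t. P.prob (B \<inter> {u. stopped_Y R n t u < R})) \<le> (\<Sum>k<t. P.prob (B \<inter> {u. stopped_Y R n k u < R}))"
      proof (rule sum_mono)
        fix k assume "k \<in> {..<t}"
        then show "P.prob (B \<inter> {u. stopped_Y R n t u < R}) \<le> P.prob (B \<inter> {u. stopped_Y R n k u < R})"
          using sets_stopped by (intro P.finite_measure_mono) (auto dest: stopped_Y_eq_Y[of R n t _ k])
      qed
      then show ?thesis by simp
    qed
    ultimately have "positive_variance * (real t * P.prob (B \<inter> {u. stopped_Y R n t u < R})) \<le> P.prob B * D\<^sup>2"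
      using positive_variance_pos by (meson less_imp_le mult_left_mono order_trans)
    moreover have "2 * D\<^sup>2 * P.prob (B \<inter> {u. stopped_Y R n t u < R}) \<le> (positive_variance * real t) * P.prob (B \<inter> {u. stopped_Y R n t u < R})"
    proof (rule mult_right_mono)
      show "2 * D\<^sup>2 \<le> positive_variance * real t" using t positive_variance_pos by (simp add: D_def field_simps)
    qed simp
    ultimately have "D\<^sup>2 * (2 * P.prob (B \<inter> {u. stopped_Y R n t u < R})) \<le> D\<^sup>2 * P.prob B" by (simp add: algebra_simps)
    moreover have "0 < D" using r lnC unfolding D_def by linarith
    ultimately show ?thesis by simp
  qed
  let ?f = "\<lambda>z. 1 / sqrt z - ln z"
  have fb: "\<bar>?f (stopped_Y R n k u)\<bar> \<le> 1 + D" for k u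
  proof -
    have "0 \<le> 1 / sqrt (stopped_Y R n k u)" "1 / sqrt (stopped_Y R n k u) \<le> 1" using stopped_Y_ge_1[of R n k u] by auto
    then show ?thesis using ln_stopped[of k u] unfolding abs_le_iff by (intro conjI; linarith)
  qed
  have ev2: "P.prob B / 2 \<le> P.prob (B \<inter> {u. R \<le> stopped_Y R n t u})"
  proof -
    have "P.prob B = P.prob ((B \<inter> {u. stopped_Y R n t u < R}) \<union> (B \<inter> {u. R \<le> stopped_Y R n t u}))"
      by (rule arg_cong[where f = P.prob]) auto
    also have "\<dots> \<le> P.prob (B \<inter> {u. stopped_Y R n t u < R}) + P.prob (B \<inter> {u. R \<le> stopped_Y R n t u})"
      using sets_stopped[of t R] B sets.compl_sets[OF sets_stopped[of t R]]
      by (intro measure_Un_le) (auto simp: Compl_eq_Diff_UNIV[symmetric] not_less Collect_neg_eq[symmetric])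
    finally show ?thesis using half by simp
  qed
  have mR: "{u. R \<le> stopped_Y R n t u} \<in> sets iid"
    using measurable_sets[OF stopped_Y_measurable, of "{R..}" R n t] by (simp add: vimage_def)
  have "(\<integral>u. indicator B u * ?f (stopped_Y R n 0 u) \<partial>iid) + (- (1 + exp C)) * (\<Sum>k<t. P.prob (B \<inter> {u. stopped_Y R n k u \<in> {..<low_level}}))
      \<le> (\<integral>u. indicator B u * ?f (stopped_Y R n t u) \<partial>iid)"
  proof (rule drift_sum[where F = "\<lambda>z a. if z < R then 1 + exp (\<xi> a) * z else z" and S = borel and D = "1 + D"])
    show "?f (stopped_Y R n k u) + (- (1 + exp C)) * indicator {..<low_level} (stopped_Y R n k u)
         \<le> (\<integral>a. ?f (if stopped_Y R n k u < R then 1 + exp (\<xi> a) * stopped_Y R n k u else stopped_Y R n k u) \<partial>\<nu>)" for k u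
    proof (cases "stopped_Y R n k u < R")
      case True
      then show ?thesis using lyapunov_drift[OF stopped_Y_ge_1[of R n k u]] by (cases "stopped_Y R n k u < low_level") (simp_all add: algebra_simps)
    next
      case False
      have "- 1 \<le> exp C" by (rule order_trans[of _ 0]) auto
      with False show ?thesis using N.prob_space by (simp add: indicator_def)
    qed
  qed (use fb in \<open>auto simp: stopped_Y_update det\<close>)
  moreover have "- (r / 4) * P.prob B \<le> (\<integral>u. indicator B u * ?f (stopped_Y R n 0 u) \<partial>iid)"
  proof -
    have "(\<integral>u. indicator B u * (- (r / 4)) \<partial>iid) \<le> (\<integral>u. indicator B u * ?f (stopped_Y R n 0 u) \<partial>iid)"
    proof (rule integral_mono)
      show "integrable iid (\<lambda>u. indicator B u * (- (r / 4)))" by (rule integrable_indicator_mult[where D = "r / 4"]) (use r in auto)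
      show "integrable iid (\<lambda>u. indicator B u * ?f (stopped_Y R n 0 u))"
        by (rule integrable_indicator_mult[OF B _ fb]) measurable
      fix u
      have z1: "1 \<le> stopped_Y R n 0 u" by (rule stopped_Y_ge_1)
      have "ln (Y u n) \<le> ln (exp (r / 4))"
        using Yn[of u] order_trans[OF Y_ge_1[of u n] Yn[of u]] Y_ge_1[of u n] by (subst ln_le_cancel_iff) auto
      then have "ln (Y u n) \<le> r / 4" by simp
      moreover have "0 \<le> 1 / sqrt (stopped_Y R n 0 u)" using z1 by auto
      ultimately have "- (r / 4) \<le> ?f (stopped_Y R n 0 u)" unfolding stopped_Y.simps by linarith
      then show "indicator B u * (- (r / 4)) \<le> indicator B u * ?f (stopped_Y R n 0 u)" by (intro mult_left_mono) auto
    qed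
    then show ?thesis unfolding PB by (simp add: mult.commute)
  qed
  moreover have "(\<integral>u. indicator B u * ?f (stopped_Y R n t u) \<partial>iid) \<le> P.prob B - r * P.prob (B \<inter> {u. R \<le> stopped_Y R n t u})"
  proof -
    have "(\<integral>u. indicator B u * ?f (stopped_Y R n t u) \<partial>iid) \<le> (\<integral>u. indicator B u * (1 - r * indicator {u. R \<le> stopped_Y R n t u} u) \<partial>iid)"
    proof (rule integral_mono)
      show "integrable iid (\<lambda>u. indicator B u * ?f (stopped_Y R n t u))"
        by (rule integrable_indicator_mult[OF B _ fb]) measurable
      show "integrable iid (\<lambda>u. indicator B u * (1 - r * indicator {u. R \<le> stopped_Y R n t u} u))"
        by (rule integrable_indicator_mult[where D = "1 + r"]) (use r mR in \<open>auto simp: indicator_def\<close>)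
      fix u
      have z1: "1 \<le> stopped_Y R n t u" by (rule stopped_Y_ge_1)
      have a: "1 / sqrt (stopped_Y R n t u) \<le> 1" using z1 by auto
      have b: "R \<le> stopped_Y R n t u \<Longrightarrow> r \<le> ln (stopped_Y R n t u)" using z1 by (subst ln_ge_iff) (auto simp: R_def)
      have "?f (stopped_Y R n t u) \<le> 1 - r * indicator {u. R \<le> stopped_Y R n t u} u"
        using a b ln_stopped(1)[of t u] by (cases "R \<le> stopped_Y R n t u") (simp_all del: divide_le_eq_1)
      then show "indicator B u * ?f (stopped_Y R n t u) \<le> indicator B u * (1 - r * indicator {u. R \<le> stopped_Y R n t u} u)"
        by (intro mult_left_mono) auto
    qed
    also have "\<dots> = (\<integral>u. indicator B u - r * indicator (B \<inter> {u. R \<le> stopped_Y R n t u}) u \<partial>iid)"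
      by (rule Bochner_Integration.integral_cong) (auto simp: indicator_def)
    also have "\<dots> = P.prob B - r * P.prob (B \<inter> {u. R \<le> stopped_Y R n t u})"
      using B mR by (subst Bochner_Integration.integral_diff) (auto simp: less_top[symmetric] P.emeasure_eq_measure)
    finally show ?thesis .
  qed
  moreover have "r * (P.prob B / 2) \<le> r * P.prob (B \<inter> {u. R \<le> stopped_Y R n t u})"
    using r by (intro mult_left_mono ev2) auto
  ultimately have "(r / 4 - 1) * P.prob B \<le> (1 + exp C) * (\<Sum>k<t. P.prob (B \<inter> {u. stopped_Y R n k u < low_level}))"
    by (simp add: algebra_simps)
  moreover have "(r / 8) * P.prob B \<le> (r / 4 - 1) * P.prob B" using r by (intro mult_right_mono) auto
  ultimately have "(r / 8) * P.prob B \<le> (1 + exp C) * (\<Sum>k<t. P.prob (B \<inter> {u. stopped_Y R n k u < low_level}))" by linarith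
  moreover have "0 < 1 + exp C" by (simp add: add_pos_pos)
  ultimately show ?thesis by (simp add: R_def field_simps)
qed

end

section \<open>Climbing out of a valley\<close>

context bounded_centred begin

text \<open>The first component is the height of the potential, started at \<open>x0\<close>, the second one the mass
  \<open>exp (- height)\<close> collected so far. The pair stops when the height leaves \<open>[0, H)\<close> or the mass exceeds
  \<open>1\<close>.\<close>

primrec climb :: "real \<Rightarrow> real \<Rightarrow> nat \<Rightarrow> nat \<Rightarrow> (nat \<Rightarrow> real) \<Rightarrow> real \<times> real" where
  "climb x0 H n 0 u = (x0, 0)"
| "climb x0 H n (Suc k) u = (let p = climb x0 H n k u in
     if 0 \<le> fst p \<and> fst p < H \<and> snd p \<le> 1 then (fst p + \<xi> (u (n + Suc k)), snd p + exp (- fst p)) else p)"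

definition climbing :: "real \<Rightarrow> (real \<times> real) set" where
  "climbing H = {p. 0 \<le> fst p \<and> fst p < H \<and> snd p \<le> 1}"

lemma climbing_borel [measurable]: "climbing H \<in> sets (borel \<Otimes>\<^sub>M borel)"
proof -
  have "{p \<in> space (borel \<Otimes>\<^sub>M borel). 0 \<le> fst p \<and> fst p < H \<and> snd p \<le> (1::real)} \<in> sets (borel \<Otimes>\<^sub>M (borel :: real measure))"
    by measurable
  then show ?thesis by (simp add: climbing_def space_pair_measure)
qed

lemma climb_Suc: "climb x0 H n (Suc k) u = (if climb x0 H n k u \<in> climbing H
   then (fst (climb x0 H n k u) + \<xi> (u (n + Suc k)), snd (climb x0 H n k u) + exp (- fst (climb x0 H n k u))) else climb x0 H n k u)"
  by (simp add: climbing_def Let_def)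

declare climb.simps(2) [simp del]

lemma climb_measurable [measurable]: "climb x0 H n k \<in> measurable iid (borel \<Otimes>\<^sub>M borel)"
proof (induction k)
  case 0 show ?case by (simp add: climb.simps(1)[abs_def])
next
  case (Suc k)
  note [measurable] = Suc
  have "(\<lambda>u. if climb x0 H n k u \<in> climbing H
   then (fst (climb x0 H n k u) + \<xi> (u (n + Suc k)), snd (climb x0 H n k u) + exp (- fst (climb x0 H n k u))) else climb x0 H n k u)
    \<in> measurable iid (borel \<Otimes>\<^sub>M borel)"
    by measurable
  then show ?case by (simp add: climb_Suc[abs_def])
qed

lemma climb_update: "n + k < m \<Longrightarrow> climb x0 H n k (u(m := x)) = climb x0 H n k u"
  by (induction k) (auto simp: climb_Suc)

lemma climb_bounds:
  assumes "0 \<le> x0" "x0 \<le> H"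
  shows "- C \<le> fst (climb x0 H n k u) \<and> fst (climb x0 H n k u) \<le> H + C \<and> 0 \<le> snd (climb x0 H n k u) \<and> snd (climb x0 H n k u) \<le> 2"
proof (induction k)
  case 0 show ?case using assms C_pos by simp
next
  case (Suc k)
  show ?case
  proof (cases "climb x0 H n k u \<in> climbing H")
    case True
    have b: "- C \<le> \<xi> (u (n + Suc k))" "\<xi> (u (n + Suc k)) \<le> C" using bound[of "u (n + Suc k)"] by auto
    have c: "0 \<le> fst (climb x0 H n k u)" "fst (climb x0 H n k u) < H" "snd (climb x0 H n k u) \<le> 1"
      using True by (auto simp: climbing_def)
    have e: "0 \<le> exp (- fst (climb x0 H n k u))" "exp (- fst (climb x0 H n k u)) \<le> 1" using c by auto
    show ?thesis unfolding climb_Suc using True Suc b c e by (simp only: if_True fst_conv snd_conv) linarith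
  next
    case False
    then show ?thesis unfolding climb_Suc using Suc by simp
  qed
qed

definition height :: "real \<Rightarrow> (nat \<Rightarrow> real) \<Rightarrow> nat \<Rightarrow> nat \<Rightarrow> real" where
  "height x0 u n i = x0 + (\<Sum>l=1..i. \<xi> (u (n + l)))"

text \<open>The number \<open>j\<close> is the time at which the pair stops, or \<open>m\<close> if it has not stopped by then.\<close>

lemma climb_path:
  shows "\<exists>j\<le>m. climb x0 H n m u = (height x0 u n j, \<Sum>i<j. exp (- height x0 u n i)) \<and> (\<forall>i<j. 0 \<le> height x0 u n i \<and> height x0 u n i < H)
    \<and> (j = m \<or> climb x0 H n m u \<notin> climbing H)"
proof (induction m)
  case 0 show ?case by (simp add: height_def)
next
  case (Suc m)
  then obtain j where j: "j \<le> m" "climb x0 H n m u = (height x0 u n j, \<Sum>i<j. exp (- height x0 u n i))" "\<forall>i<j. 0 \<le> height x0 u n i \<and> height x0 u n i < H"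
    "j = m \<or> climb x0 H n m u \<notin> climbing H" by blast
  show ?case
  proof (cases "climb x0 H n m u \<in> climbing H")
    case True
    then have jm: "j = m" using j(4) by blast
    have w: "0 \<le> height x0 u n m" "height x0 u n m < H" using True j(2) jm by (auto simp: climbing_def)
    have "climb x0 H n (Suc m) u = (height x0 u n (Suc m), \<Sum>i<Suc m. exp (- height x0 u n i))"
      unfolding climb_Suc using True j(2) jm by (simp add: height_def)
    moreover have "\<forall>i<Suc m. 0 \<le> height x0 u n i \<and> height x0 u n i < H" using j(3) jm w by (auto simp: less_Suc_eq)
    ultimately show ?thesis by blast
  next
    case False
    then have "climb x0 H n (Suc m) u = climb x0 H n m u" by (simp add: climb_Suc)
    then show ?thesis using j False by (intro exI[of _ j]) auto
  qed
qed

definition climb_const :: real where "climb_const = 1 / (\<phi> - 1)"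
definition start :: real where "start = C + climb_const * exp (C / 2) + 1"
definition variance_xi :: real where "variance_xi = (\<integral>s. (\<xi> s)\<^sup>2 \<partial>\<nu>)"

lemma climb_const_pos: "0 < climb_const" using phi_gt_1 by (simp add: climb_const_def)

lemma start_pos: "0 < start"
  using C_pos climb_const_pos by (simp add: start_def add_pos_pos)

lemma half_exp_ge: "0 \<le> x \<Longrightarrow> x * exp (- x) \<le> exp (- x / 2)" for x :: real
proof -
  assume x: "0 \<le> x"
  have "x \<le> (1 + x / 4)\<^sup>2"
  proof -
    have "0 \<le> (1 - x / 4)\<^sup>2" by simp
    then show ?thesis by (simp add: power2_eq_square algebra_simps)
  qed
  also have "\<dots> \<le> (exp (x / 4))\<^sup>2" using x by (intro power_mono exp_ge_add_one_self) auto
  also have "\<dots> = exp (x / 2)" by (simp add: exp_double[symmetric])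
  finally have "x * exp (- x) \<le> exp (x / 2) * exp (- x)" by (rule mult_right_mono) simp
  also have "\<dots> = exp (- x / 2)" by (simp add: exp_add[symmetric])
  finally show ?thesis .
qed

text \<open>The height, discounted linearly with the collected mass. The discount costs \<open>x * exp (- x)\<close> per step in
  mean at height \<open>x\<close>, and the second summand gains exactly \<open>exp (- x / 2)\<close>.\<close>

definition potential :: "real \<times> real \<Rightarrow> real" where
  "potential p = fst p * (1 - snd p) + climb_const * exp (- fst p / 2)"

lemma climb_drift:
  assumes p: "p \<in> climbing H"
  shows "potential p \<le> (\<integral>a. potential (fst p + \<xi> a, snd p + exp (- fst p)) \<partial>\<nu>)"
proof -
  obtain x I where xI: "p = (x, I)" by (cases p)
  have x: "0 \<le> x" using p xI by (simp add: climbing_def)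
  have "(\<integral>a. potential (x + \<xi> a, I + exp (- x)) \<partial>\<nu>) = (\<integral>a. x * (1 - I - exp (- x)) + (1 - I - exp (- x)) * \<xi> a + climb_const * exp (- x / 2) * exp (- 1 / 2 * \<xi> a) \<partial>\<nu>)"
  proof (rule Bochner_Integration.integral_cong[OF refl])
    fix a
    have e: "exp (- (x + \<xi> a) / 2) = exp (- x / 2) * exp (- 1 / 2 * \<xi> a)"
      by (simp add: exp_add[symmetric] diff_divide_distrib)
    show "potential (x + \<xi> a, I + exp (- x)) = x * (1 - I - exp (- x)) + (1 - I - exp (- x)) * \<xi> a + climb_const * exp (- x / 2) * exp (- 1 / 2 * \<xi> a)"
      unfolding potential_def fst_conv snd_conv e by (simp add: algebra_simps)
  qed
  also have "\<dots> = x * (1 - I - exp (- x)) + climb_const * exp (- x / 2) * \<phi>"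
    using integrable_exp_xi[of "- 1 / 2"] N.prob_space by (simp add: centred \<phi>_def)
  also have "\<dots> \<ge> x * (1 - I) + climb_const * exp (- x / 2)"
  proof -
    have "climb_const * (\<phi> - 1) = 1" using phi_gt_1 by (simp add: climb_const_def)
    then have "climb_const * exp (- x / 2) * \<phi> = climb_const * exp (- x / 2) + exp (- x / 2)" by (simp add: algebra_simps) (metis distrib_left mult.commute mult.left_commute mult_1 add.commute diff_add_cancel)
    then show ?thesis using half_exp_ge[OF x] by (simp add: algebra_simps)
  qed
  finally show ?thesis by (simp add: xI potential_def)
qed

text \<open>The potential is a submartingale and starts at more than \<open>start\<close>. It is at most \<open>start - 1\<close> if the
  height falls below \<open>0\<close>, or if the mass exceeds \<open>1\<close> before \<open>H\<close> is reached, and at most \<open>H + C + climb_const\<close> otherwise. So the climb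
  reaches \<open>H\<close>, or is still going on after \<open>m\<close> steps, with probability at least the reciprocal of the latter
  bound. The variance of the height shows that half of this remains for reaching \<open>H\<close> if \<open>m\<close> is large.\<close>

lemma climb_succeeds:
  assumes H: "start \<le> H" and B [measurable]: "B \<in> sets iid" and det: "determined n B"
    and m: "2 * (H + C + climb_const) ^ 3 / variance_xi \<le> real m"
  shows "P.prob B / (2 * (H + C + climb_const)) \<le> P.prob (B \<inter> {u. H \<le> fst (climb start H n m u)})"
proof -
  define K where "K = H + C + climb_const"
  have s0: "0 \<le> start" using start_pos by simp
  have K: "0 < K" "H + C \<le> K" "0 \<le> H + C" using start_pos H C_pos climb_const_pos by (auto simp: K_def)
  have vp: "0 < variance_xi" using nonzero by (simp add: variance_xi_def)
  let ?st = "climb start H n"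
  note bnd = climb_bounds[OF s0 H, of n]
  have sets_cl: "{u. ?st k u \<in> climbing H} \<in> sets iid" for k
    using measurable_sets[OF climb_measurable climbing_borel, of start H n k H] by (simp add: vimage_def)
  have PB: "(\<integral>u. indicator B u * a \<partial>iid) = P.prob B * a" for a by simp
  have act: "P.prob (B \<inter> {u. ?st m u \<in> climbing H}) \<le> P.prob B / (2 * K)"
  proof -
    have "(\<integral>u. indicator B u * (fst (?st 0 u))\<^sup>2 \<partial>iid) + variance_xi * (\<Sum>k<m. P.prob (B \<inter> {u. ?st k u \<in> climbing H}))
      \<le> (\<integral>u. indicator B u * (fst (?st m u))\<^sup>2 \<partial>iid)"
    proof (rule drift_sum[where F = "\<lambda>p a. if p \<in> climbing H then (fst p + \<xi> a, snd p + exp (- fst p)) else p" and S = "borel \<Otimes>\<^sub>M borel" and D = "(H + C)\<^sup>2"])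
      show "\<bar>(fst (?st k u))\<^sup>2\<bar> \<le> (H + C)\<^sup>2" for k u
      proof -
        have "\<bar>fst (?st k u)\<bar> \<le> H + C" using bnd[of k u] H start_pos by (auto simp: abs_le_iff)
        then show ?thesis using K by (simp add: abs_le_square_iff[symmetric])
      qed
      show "(fst (?st k u))\<^sup>2 + variance_xi * indicator (climbing H) (?st k u)
         \<le> (\<integral>a. (fst (if ?st k u \<in> climbing H then (fst (?st k u) + \<xi> a, snd (?st k u) + exp (- fst (?st k u))) else ?st k u))\<^sup>2 \<partial>\<nu>)" for k u
      proof (cases "?st k u \<in> climbing H")
        case True
        define x where "x = fst (?st k u)"
        have "(\<integral>a. (x + \<xi> a)\<^sup>2 \<partial>\<nu>) = (\<integral>a. x\<^sup>2 + 2 * x * \<xi> a + (\<xi> a)\<^sup>2 \<partial>\<nu>)"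
          by (rule Bochner_Integration.integral_cong) (auto simp: power2_eq_square algebra_simps)
        also have "\<dots> = x\<^sup>2 + variance_xi" using N.prob_space by (simp add: centred variance_xi_def)
        finally show ?thesis using True by (simp add: x_def)
      next
        case False then show ?thesis using N.prob_space by simp
      qed
    qed (auto simp: climb_update det climb_Suc)
    moreover have "0 \<le> (\<integral>u. indicator B u * (fst (?st 0 u))\<^sup>2 \<partial>iid)"
      by (rule Bochner_Integration.integral_nonneg) simp
    moreover have "(\<integral>u. indicator B u * (fst (?st m u))\<^sup>2 \<partial>iid) \<le> (\<integral>u. indicator B u * (H + C)\<^sup>2 \<partial>iid)"
    proof (rule integral_mono)
      have le: "(fst (?st m u))\<^sup>2 \<le> (H + C)\<^sup>2" for u
      proof -
        have "\<bar>fst (?st m u)\<bar> \<le> H + C" using bnd[of m u] H start_pos by (auto simp: abs_le_iff)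
        then show ?thesis using K by (simp add: abs_le_square_iff[symmetric])
      qed
      show "integrable iid (\<lambda>u. indicator B u * (fst (?st m u))\<^sup>2)"
        by (rule integrable_indicator_mult[where D = "(H + C)\<^sup>2"]) (use le in auto)
      show "integrable iid (\<lambda>u. indicator B u * (H + C)\<^sup>2)" by (rule integrable_indicator_mult[where D = "(H + C)\<^sup>2"]) auto
      show "indicator B u * (fst (?st m u))\<^sup>2 \<le> indicator B u * (H + C)\<^sup>2" for u
        using le by (intro mult_left_mono) auto
    qed
    ultimately have "variance_xi * (\<Sum>k<m. P.prob (B \<inter> {u. ?st k u \<in> climbing H})) \<le> P.prob B * (H + C)\<^sup>2"
      unfolding PB by linarith
    also have "\<dots> \<le> P.prob B * K\<^sup>2" using K by (intro mult_left_mono power_mono) auto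
    finally have 1: "variance_xi * (\<Sum>k<m. P.prob (B \<inter> {u. ?st k u \<in> climbing H})) \<le> P.prob B * K\<^sup>2" .
    have still: "?st k u \<in> climbing H" if "?st m u \<in> climbing H" "k \<le> m" for k u
      using that(2,1) by (induction k rule: inc_induct) (auto simp: climb_Suc split: if_splits)
    have "(\<Sum>k<m. P.prob (B \<inter> {u. ?st m u \<in> climbing H})) \<le> (\<Sum>k<m. P.prob (B \<inter> {u. ?st k u \<in> climbing H}))"
      using sets_cl by (intro sum_mono P.finite_measure_mono) (auto intro: still)
    then have "variance_xi * (real m * P.prob (B \<inter> {u. ?st m u \<in> climbing H})) \<le> variance_xi * (\<Sum>k<m. P.prob (B \<inter> {u. ?st k u \<in> climbing H}))"
      using vp by (intro mult_left_mono) auto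
    also note 1
    finally have 2: "(variance_xi * real m) * P.prob (B \<inter> {u. ?st m u \<in> climbing H}) \<le> P.prob B * K\<^sup>2" by simp
    have "2 * K ^ 3 \<le> variance_xi * real m" using m vp by (simp add: K_def field_simps)
    then have "(2 * K ^ 3) * P.prob (B \<inter> {u. ?st m u \<in> climbing H}) \<le> (variance_xi * real m) * P.prob (B \<inter> {u. ?st m u \<in> climbing H})"
      by (rule mult_right_mono) simp
    then have "K\<^sup>2 * (2 * K * P.prob (B \<inter> {u. ?st m u \<in> climbing H})) \<le> K\<^sup>2 * P.prob B"
      using 2 by (simp add: power2_eq_square power3_eq_cube algebra_simps)
    then have "2 * K * P.prob (B \<inter> {u. ?st m u \<in> climbing H}) \<le> P.prob B" using K by simp
    then show ?thesis using K by (simp add: field_simps)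
  qed
  define c3 where "c3 = C + climb_const * exp (C / 2)"
  have c3: "0 \<le> c3" "climb_const \<le> c3"
  proof -
    have "climb_const * 1 \<le> climb_const * exp (C / 2)" using climb_const_pos C_pos by (intro mult_left_mono) auto
    then show "climb_const \<le> c3" using C_pos by (simp add: c3_def)
    then show "0 \<le> c3" using climb_const_pos by simp
  qed
  have fb: "\<bar>potential (?st k u)\<bar> \<le> (H + C) + climb_const * exp (C / 2)" for k u
  proof -
    have "\<bar>fst (?st k u)\<bar> \<le> H + C" "\<bar>1 - snd (?st k u)\<bar> \<le> 1" using bnd[of k u] H start_pos by (auto simp: abs_le_iff)
    then have "\<bar>fst (?st k u) * (1 - snd (?st k u))\<bar> \<le> (H + C) * 1" unfolding abs_mult using K by (intro mult_mono) auto
    moreover have "\<bar>climb_const * exp (- fst (?st k u) / 2)\<bar> \<le> climb_const * exp (C / 2)"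
      using climb_const_pos bnd[of k u] by (simp add: abs_mult)
    ultimately show ?thesis unfolding potential_def mult_1_right
      by (intro order_trans[OF abs_triangle_ineq] add_mono)
  qed
  have fm [measurable]: "potential \<in> borel_measurable (borel \<Otimes>\<^sub>M borel)" unfolding potential_def[abs_def] by measurable
  have sm: "{u. H \<le> fst (?st m u)} \<in> sets iid"
  proof -
    have "(\<lambda>u. fst (?st m u)) \<in> borel_measurable iid" by measurable
    from measurable_sets[OF this, of "{H..}"] show ?thesis by (simp add: vimage_def)
  qed
  have "(\<integral>u. indicator B u * potential (?st 0 u) \<partial>iid) + 0 * (\<Sum>k<m. P.prob (B \<inter> {u. ?st k u \<in> {}}))
      \<le> (\<integral>u. indicator B u * potential (?st m u) \<partial>iid)"
  proof (rule drift_sum[where F = "\<lambda>p a. if p \<in> climbing H then (fst p + \<xi> a, snd p + exp (- fst p)) else p" and S = "borel \<Otimes>\<^sub>M borel" and D = "(H + C) + climb_const * exp (C / 2)"])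
    show "potential (?st k u) + 0 * indicator {} (?st k u)
         \<le> (\<integral>a. potential (if ?st k u \<in> climbing H then (fst (?st k u) + \<xi> a, snd (?st k u) + exp (- fst (?st k u))) else ?st k u) \<partial>\<nu>)" for k u
    proof (cases "?st k u \<in> climbing H")
      case True
      then show ?thesis using climb_drift[OF True] by simp
    next
      case False
      then show ?thesis using N.prob_space by simp
    qed
  qed (use fb in \<open>auto simp: climb_update det climb_Suc\<close>)
  moreover have "(\<integral>u. indicator B u * potential (?st 0 u) \<partial>iid) = P.prob B * potential (start, 0)" by simp
  moreover have "P.prob B * (c3 + 1) \<le> P.prob B * potential (start, 0)"
    using climb_const_pos by (intro mult_left_mono) (auto simp: potential_def start_def c3_def)
  moreover have "(\<integral>u. indicator B u * potential (?st m u) \<partial>iid) \<le> c3 * P.prob B + K * P.prob (B \<inter> {u. H \<le> fst (?st m u)}) + K * P.prob (B \<inter> {u. ?st m u \<in> climbing H})"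
  proof -
    have "(\<integral>u. indicator B u * potential (?st m u) \<partial>iid) \<le> (\<integral>u. c3 * indicator B u + K * indicator (B \<inter> {u. H \<le> fst (?st m u)}) u + K * indicator (B \<inter> {u. ?st m u \<in> climbing H}) u \<partial>iid)"
    proof (rule integral_mono)
      show "integrable iid (\<lambda>u. indicator B u * potential (?st m u))"
        by (rule integrable_indicator_mult[OF B _ fb]) measurable
      show "integrable iid (\<lambda>u. c3 * indicator B u + K * indicator (B \<inter> {u. H \<le> fst (?st m u)}) u + K * indicator (B \<inter> {u. ?st m u \<in> climbing H}) u)"
        using B sm sets_cl[of m] by (auto simp: less_top[symmetric] P.emeasure_eq_measure)
      fix u
      define x where "x = fst (?st m u)"
      define I where "I = snd (?st m u)"
      have b: "- C \<le> x" "x \<le> H + C" "0 \<le> I" "I \<le> 2" using bnd[of m u] by (auto simp: x_def I_def)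
      have fx: "potential (?st m u) = x * (1 - I) + climb_const * exp (- x / 2)" by (simp add: potential_def x_def I_def)
      have pos: "x * (1 - I) \<le> x" if "0 \<le> x" using that b by (simp add: mult_left_le)
      have e1: "climb_const * exp (- x / 2) \<le> climb_const" if "0 \<le> x" using that climb_const_pos by (simp add: mult_left_le)
      consider "x < 0" | "0 \<le> x" "x < H" "1 < I" | "0 \<le> x" "x < H" "I \<le> 1" | "0 \<le> x" "H \<le> x" by linarith
      then have "potential (?st m u) \<le> c3 + K * of_bool (H \<le> x) + K * of_bool (?st m u \<in> climbing H)"
      proof cases
        case 1
        have "x * (1 - I) \<le> \<bar>x\<bar> * \<bar>1 - I\<bar>" by (metis abs_ge_self abs_mult)
        also have "\<dots> \<le> C * 1" using 1 b by (intro mult_mono) auto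
        finally have "x * (1 - I) \<le> C" by simp
        moreover have "climb_const * exp (- x / 2) \<le> climb_const * exp (C / 2)" using b climb_const_pos by simp
        ultimately have "potential (?st m u) \<le> c3" by (simp add: fx c3_def)
        then show ?thesis using K by (simp add: add_increasing2)
      next
        case 2
        then have "x * (1 - I) \<le> 0" by (intro mult_nonneg_nonpos) auto
        then have "potential (?st m u) \<le> c3" using e1 2 c3 by (simp add: fx)
        then show ?thesis using K by (simp add: add_increasing2)
      next
        case 3
        have "potential (?st m u) \<le> K" using pos e1 3 C_pos by (simp add: fx K_def)
        moreover have "?st m u \<in> climbing H" using 3 by (simp add: climbing_def x_def I_def)
        ultimately show ?thesis using 3 c3 by simp
      next
        case 4
        have "potential (?st m u) \<le> K" using pos e1 4 b by (simp add: fx K_def)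
        then show ?thesis using 4 c3 K by (simp add: add_increasing2)
      qed
      then show "indicator B u * potential (?st m u) \<le> c3 * indicator B u + K * indicator (B \<inter> {u. H \<le> fst (?st m u)}) u + K * indicator (B \<inter> {u. ?st m u \<in> climbing H}) u"
        by (auto simp: indicator_def x_def)
    qed
    also have "\<dots> = c3 * P.prob B + K * P.prob (B \<inter> {u. H \<le> fst (?st m u)}) + K * P.prob (B \<inter> {u. ?st m u \<in> climbing H})"
      using B sm sets_cl[of m] by (simp add: less_top[symmetric] P.emeasure_eq_measure)
    finally show ?thesis .
  qed
  ultimately have "P.prob B \<le> K * P.prob (B \<inter> {u. H \<le> fst (?st m u)}) + K * P.prob (B \<inter> {u. ?st m u \<in> climbing H})"
    by (simp add: algebra_simps)
  also have "K * P.prob (B \<inter> {u. ?st m u \<in> climbing H}) \<le> K * (P.prob B / (2 * K))" using act K by (intro mult_left_mono) auto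
  also have "K * (P.prob B / (2 * K)) = P.prob B / 2" using K by simp
  finally have "P.prob B / 2 \<le> K * P.prob (B \<inter> {u. H \<le> fst (?st m u)})" by simp
  then have "P.prob B / (2 * K) \<le> P.prob (B \<inter> {u. H \<le> fst (?st m u)})" using K by (simp add: field_simps)
  then show ?thesis by (simp only: K_def)
qed

end

section \<open>Deep valleys recur\<close>

text \<open>Coordinates in \<open>AL\<close> let the potential descend, those in \<open>AR\<close> let it ascend, and the coordinate at the
  bottom of the valley is in \<open>A0\<close>.\<close>

locale valley_pattern = bounded_centred +
  fixes AL A0 AR :: "real set" and \<kappa> :: real
  assumes pattern_sets [measurable]: "AL \<in> sets borel" "A0 \<in> sets borel" "AR \<in> sets borel"
    and kappa: "0 < \<kappa>" and left: "s \<in> AL \<Longrightarrow> \<xi> s \<le> - \<kappa>" and right: "s \<in> AR \<Longrightarrow> \<kappa> \<le> \<xi> s"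
    and pattern_prob: "0 < measure \<nu> AL" "0 < measure \<nu> A0" "0 < measure \<nu> AR"
begin

definition cond :: "(nat \<Rightarrow> real) \<Rightarrow> nat \<Rightarrow> real" where
  "cond u k = exp (- (\<Sum>i=1..k. \<xi> (u i)))"

definition deep_valley :: "nat \<Rightarrow> real \<Rightarrow> (nat \<Rightarrow> real) \<Rightarrow> nat \<Rightarrow> nat \<Rightarrow> bool" where
  "deep_valley K \<gamma> u b d \<longleftrightarrow> K < b \<and> b + K < d \<and>
     (\<forall>i\<in>{b - K..<b}. u i \<in> AL) \<and> u b \<in> A0 \<and> (\<forall>i\<in>{b<..b + K}. u i \<in> AR) \<and>
     (\<Sum>y<b - K. cond u y) \<le> \<gamma> * cond u (b - 1) \<and>
     (\<Sum>y=b + K..<d. cond u y) \<le> \<gamma> * cond u b \<and>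
     (\<Sum>k<b. left_mass (cond u) k) * (cond u (d - 1) + cond u d) \<le> \<gamma> * cond u b"

lemma cond_pos: "0 < cond u k" by (simp add: cond_def)

lemma cond_Suc: "cond u (Suc k) = cond u k * exp (- \<xi> (u (Suc k)))"
  by (simp add: cond_def exp_add[symmetric])

lemma Y_eq_left_mass: "Y u k = left_mass (cond u) k"
proof (induction k)
  case 0 show ?case by (simp add: left_mass_def cond_def)
next
  case (Suc k)
  have "exp (\<xi> (u (Suc k))) * (cond u k * exp (- \<xi> (u (Suc k)))) = cond u k * (exp (\<xi> (u (Suc k))) * exp (- \<xi> (u (Suc k))))" by simp
  also have "exp (\<xi> (u (Suc k))) * exp (- \<xi> (u (Suc k))) = 1" by (metis exp_minus_inverse)
  finally have e: "exp (\<xi> (u (Suc k))) * cond u (Suc k) = cond u k" by (simp add: cond_Suc)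
  have "left_mass (cond u) (Suc k) = 1 + (\<Sum>y\<le>k. cond u y) / cond u (Suc k)"
    using cond_pos[of u "Suc k"] by (simp add: left_mass_def add_divide_distrib)
  also have "(\<Sum>y\<le>k. cond u y) / cond u (Suc k) = exp (\<xi> (u (Suc k))) * left_mass (cond u) k"
    using cond_pos[of u "Suc k"] cond_pos[of u k] e by (simp add: left_mass_def field_simps)
  finally show ?case using Suc.IH by simp
qed

text \<open>\<open>Y\<close> stays large as long as the potential stays above an earlier value.\<close>

lemma ratio_le_Y: "b \<le> k \<Longrightarrow> cond u b \<le> Y u k * cond u k"
proof -
  assume "b \<le> k"
  then have "cond u b \<le> (\<Sum>y\<le>k. cond u y)" by (intro member_le_sum) (auto intro: less_imp_le cond_pos)
  then show ?thesis using cond_pos[of u k] by (simp add: Y_eq_left_mass left_mass_def)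
qed

lemma cond_height: "cond u (n + i) = cond u n * exp (x0 - height x0 u n i)"
  by (induction i) (auto simp: height_def cond_Suc exp_add[symmetric] algebra_simps exp_diff)

definition pattern :: "nat \<Rightarrow> nat \<Rightarrow> real set" where
  "pattern K i = (if i \<le> K then AL else if i = Suc K then A0 else AR)"

text \<open>After a visit of \<open>Y\<close> to the low level at \<open>n + k\<close>, the coordinates follow the pattern of a valley with
  bottom \<open>n + k + K + 1\<close>, and then the potential climbs to height \<open>2 * r\<close>.\<close>

definition success :: "nat \<Rightarrow> real \<Rightarrow> nat \<Rightarrow> nat \<Rightarrow> nat \<Rightarrow> (nat \<Rightarrow> real) set" where
  "success K r m n k = {u. stopped_Y (exp r) n k u < low_level} \<inter> {u. \<forall>i\<in>{1..2 * K + 1}. u (n + k + i) \<in> pattern K i}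
     \<inter> {u. 2 * r \<le> fst (climb start (2 * r) (n + k + (2 * K + 1)) m u)}"

lemma success_climb:
  assumes u: "u \<in> success K r m n k" and r: "start \<le> r"
  obtains j where "0 < j" "j \<le> m" "2 * r \<le> height start u (n + k + (2 * K + 1)) j"
    "\<And>i. i < j \<Longrightarrow> 0 \<le> height start u (n + k + (2 * K + 1)) i"
    "(\<Sum>i<j. exp (- height start u (n + k + (2 * K + 1)) i)) \<le> 2"
proof -
  let ?n = "n + k + (2 * K + 1)"
  obtain j where j: "j \<le> m" "climb start (2 * r) ?n m u = (height start u ?n j, \<Sum>i<j. exp (- height start u ?n i))"
    "\<forall>i<j. 0 \<le> height start u ?n i \<and> height start u ?n i < 2 * r"
    using climb_path[of m start "2 * r" ?n u] by blast
  have h: "2 * r \<le> height start u ?n j" using u j(2) by (simp add: success_def)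
  have "j \<noteq> 0"
  proof
    assume "j = 0"
    then have "2 * r \<le> start" using h by (simp add: height_def)
    then show False using r start_pos by simp
  qed
  moreover have "(\<Sum>i<j. exp (- height start u ?n i)) \<le> 2"
    using climb_bounds[of start "2 * r" ?n m u] j(2) start_pos r by simp
  ultimately show ?thesis using that[of j] j h by blast
qed

lemma pattern_slopes:
  assumes u: "u \<in> success K r m n k" and i: "i \<le> K"
  shows "exp (\<kappa> * i) * cond u (n + k) \<le> cond u (n + k + i)"
    "exp (\<kappa> * i) * cond u (n + k + Suc K + i) \<le> cond u (n + k + Suc K)"
proof -
  have pt: "\<And>i. 1 \<le> i \<Longrightarrow> i \<le> 2 * K + 1 \<Longrightarrow> u (n + k + i) \<in> pattern K i" using u by (auto simp: success_def)
  show "exp (\<kappa> * i) * cond u (n + k) \<le> cond u (n + k + i)" using i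
  proof (induction i)
    case (Suc i)
    have "u (n + k + Suc i) \<in> AL" using pt[of "Suc i"] Suc.prems by (auto simp: pattern_def)
    then have "exp \<kappa> \<le> exp (- \<xi> (u (n + k + Suc i)))" using left by force
    then have "(exp (\<kappa> * i) * cond u (n + k)) * exp \<kappa> \<le> cond u (n + k + i) * exp (- \<xi> (u (n + k + Suc i)))"
      using Suc cond_pos less_imp_le by (intro mult_mono) auto
    then show ?case by (simp add: cond_Suc algebra_simps exp_add)
  qed simp
  show "exp (\<kappa> * i) * cond u (n + k + Suc K + i) \<le> cond u (n + k + Suc K)" using i
  proof (induction i)
    case (Suc i)
    have "u (n + k + (Suc K + Suc i)) \<in> AR" using pt[of "Suc K + Suc i"] Suc.prems by (auto simp: pattern_def)
    then have "exp (- \<xi> (u (n + k + Suc K + Suc i))) \<le> exp (- \<kappa>)" using right by (force simp: add.assoc)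
    then have "exp (\<kappa> * Suc i) * (cond u (n + k + Suc K + i) * exp (- \<xi> (u (n + k + Suc K + Suc i))))
      \<le> exp (\<kappa> * Suc i) * (cond u (n + k + Suc K + i) * exp (- \<kappa>))"
      using cond_pos less_imp_le by (intro mult_left_mono) auto
    also have "\<dots> = (exp (\<kappa> * Suc i) * exp (- \<kappa>)) * cond u (n + k + Suc K + i)" by simp
    also have "exp (\<kappa> * Suc i) * exp (- \<kappa>) = exp (\<kappa> * i)" by (simp add: exp_add[symmetric] algebra_simps)
    also have "exp (\<kappa> * i) * cond u (n + k + Suc K + i) \<le> cond u (n + k + Suc K)" using Suc by simp
    finally show ?case by (simp add: cond_Suc)
  qed simp
qed

text \<open>Every factor \<open>exp (\<kappa> * K)\<close> comes from one of the two slopes of the pattern, on which the conductances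
  decrease geometrically away from the bottom. The left mass is at most \<open>low_level\<close> before the slope, and
  the right mass at most \<open>2 * exp start\<close> after it, so both become small for large \<open>K\<close>. In the last condition
  all \<open>Y k\<close> with \<open>k < b\<close> are of order \<open>exp r\<close> at most, while the conductance has dropped by
  \<open>exp (- 2 * r)\<close> at \<open>d\<close>.\<close>

lemma success_deep_valley:
  assumes u: "u \<in> success K r m n k" and r: "start \<le> r" and Sr: "low_level \<le> exp r" and Yn: "(1 + exp C) ^ n \<le> exp r"
    and K1: "low_level \<le> \<gamma> * exp (\<kappa> * K)" "2 * exp start \<le> \<gamma> * exp (\<kappa> * K)" 
    and growth: "real (n + k + K + 1) * (1 + exp C) ^ (K + 1) * exp (start - r) \<le> \<gamma>"
  shows "\<exists>b\<ge>n. \<exists>d. deep_valley K \<gamma> u b d"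
proof -
  define b where "b = n + k + Suc K"
  define n1 where "n1 = n + k + (2 * K + 1)"
  have n1: "n1 = b + K" by (simp add: n1_def b_def)
  obtain j where j: "0 < j" "2 * r \<le> height start u n1 j" "\<And>i. i < j \<Longrightarrow> 0 \<le> height start u n1 i"
    "(\<Sum>i<j. exp (- height start u n1 i)) \<le> 2"
    using success_climb[OF u r] unfolding n1_def by metis
  define d where "d = n1 + j"
  have pt: "\<And>i. 1 \<le> i \<Longrightarrow> i \<le> 2 * K + 1 \<Longrightarrow> u (n + k + i) \<in> pattern K i" using u by (auto simp: success_def)
  have Zk: "stopped_Y (exp r) n k u < low_level" using u by (simp add: success_def)
  have g0: "0 \<le> \<gamma>" using growth by (rule order_trans[rotated]) simp
  have eK: "0 < exp (\<kappa> * K)" by simp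
  have YS: "Y u (n + k) < low_level" using stopped_Y_eq_Y[of "exp r" n k u k] Zk Sr by simp
  \<comment> \<open>The slopes of the potential to the left and to the right of \<open>b\<close>.\<close>
  have slopeL: "exp (\<kappa> * K) * cond u (n + k) \<le> cond u (b - 1)" using pattern_slopes(1)[OF u, of K] by (simp add: b_def)
  have slopeR: "exp (\<kappa> * K) * cond u n1 \<le> cond u b" using pattern_slopes(2)[OF u, of K] by (simp add: n1 b_def)
  have PL: "\<forall>i\<in>{b - K..<b}. u i \<in> AL"
  proof
    fix i assume i: "i \<in> {b - K..<b}"
    define l where "l = i - (n + k)"
    have l: "i = n + k + l" "1 \<le> l" "l \<le> K" using i by (auto simp: l_def b_def)
    then show "u i \<in> AL" using pt[of l] by (simp add: pattern_def)
  qed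
  have P0: "u b \<in> A0" using pt[of "Suc K"] by (simp add: b_def pattern_def)
  have PR: "\<forall>i\<in>{b<..b + K}. u i \<in> AR"
  proof
    fix i assume i: "i \<in> {b<..b + K}"
    define l where "l = i - (n + k)"
    have l: "i = n + k + l" "Suc K < l" "l \<le> 2 * K + 1" using i by (auto simp: l_def b_def)
    then show "u i \<in> AR" using pt[of l] by (simp add: pattern_def)
  qed
  have sL: "(\<Sum>y<b - K. cond u y) \<le> \<gamma> * cond u (b - 1)"
  proof -
    have "{..<b - K} = {..n + k}" by (auto simp: b_def)
    then have "(\<Sum>y<b - K. cond u y) = Y u (n + k) * cond u (n + k)"
      using cond_pos[of u "n + k"] by (simp add: Y_eq_left_mass left_mass_def)
    also have "\<dots> \<le> low_level * cond u (n + k)" using YS cond_pos[of u "n + k"] by (intro mult_right_mono) auto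
    also have "\<dots> \<le> (\<gamma> * exp (\<kappa> * K)) * cond u (n + k)" using K1(1) cond_pos[of u "n + k"] by (intro mult_right_mono) auto
    also have "\<dots> = \<gamma> * (exp (\<kappa> * K) * cond u (n + k))" by simp
    also have "\<dots> \<le> \<gamma> * cond u (b - 1)" by (rule mult_left_mono[OF slopeL g0])
    finally show ?thesis .
  qed
  have sR: "(\<Sum>y=b + K..<d. cond u y) \<le> \<gamma> * cond u b"
  proof -
    have "(\<Sum>y=b + K..<d. cond u y) = (\<Sum>i<j. cond u (n1 + i))"
      unfolding n1[symmetric] d_def using sum.shift_bounds_nat_ivl[of "cond u" 0 n1 j] by (simp add: atLeast0LessThan add.commute)
    also have "\<dots> = (cond u n1 * exp start) * (\<Sum>i<j. exp (- height start u n1 i))"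
      unfolding sum_distrib_left by (rule sum.cong[OF refl], subst cond_height[of u n1 _ start]) (simp add: exp_add[symmetric] mult.assoc)
    also have "\<dots> \<le> (cond u n1 * exp start) * 2" using j(4) cond_pos[of u n1] by (intro mult_left_mono) auto
    also have "\<dots> = (2 * exp start) * cond u n1" by simp
    also have "\<dots> \<le> (\<gamma> * exp (\<kappa> * K)) * cond u n1" using K1(2) cond_pos[of u n1] by (intro mult_right_mono) auto
    also have "\<dots> = \<gamma> * (exp (\<kappa> * K) * cond u n1)" by simp
    also have "\<dots> \<le> \<gamma> * cond u b" by (rule mult_left_mono[OF slopeR g0])
    finally show ?thesis .
  qed
  have sY: "(\<Sum>k<b. left_mass (cond u) k) \<le> real b * ((1 + exp C) ^ K * exp r)"
  proof -
    have q: "1 \<le> 1 + exp C" by simp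
    have Yi: "Y u i \<le> (1 + exp C) ^ K * exp r" if i: "i < b" for i
    proof -
      have q1: "exp r \<le> (1 + exp C) ^ K * exp r" using one_le_power[OF q, of K] mult_right_mono[of 1 "(1 + exp C) ^ K" "exp r"] by simp
      consider "i \<le> n" | "n \<le> i" "i \<le> n + k" | "n + k < i" by linarith
      then show ?thesis
      proof cases
        case 1
        have "Y u i \<le> (1 + exp C) ^ i" using Y_le[of u 0 i] by simp
        also have "\<dots> \<le> (1 + exp C) ^ n" by (rule power_increasing[OF 1 q])
        finally show ?thesis using Yn q1 by linarith
      next
        case 2
        then have "Y u i < exp r" using stopped_Y_eq_Y[of "exp r" n k u "i - n"] Zk Sr by simp
        then show ?thesis using q1 by linarith
      next
        case 3
        define l where "l = i - (n + k)"
        have l: "i = n + k + l" "l \<le> K" using 3 i by (auto simp: l_def b_def)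
        have "Y u i \<le> (1 + exp C) ^ l * Y u (n + k)" unfolding l(1) by (rule Y_le)
        also have "\<dots> \<le> (1 + exp C) ^ K * exp r"
          using YS Sr Y_ge_1[of u "n + k"] power_increasing[OF l(2) q] by (intro mult_mono) auto
        finally show ?thesis .
      qed
    qed
    have "(\<Sum>k<b. left_mass (cond u) k) \<le> (\<Sum>k<b. (1 + exp C) ^ K * exp r)"
      unfolding Y_eq_left_mass[symmetric] by (rule sum_mono) (use Yi in auto)
    then show ?thesis by simp
  qed
  have sD: "(\<Sum>k<b. left_mass (cond u) k) * (cond u (d - 1) + cond u d) \<le> \<gamma> * cond u b"
  proof -
    have d1: "d = Suc (d - 1)" using j(1) by (simp add: d_def)
    have "cond u (d - 1) \<le> exp C * cond u d"
    proof -
      have "exp (- C) \<le> exp (- \<xi> (u d))" using bound[of "u d"] by auto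
      then have "cond u (d - 1) * exp (- C) \<le> cond u d" using cond_pos[of u "d - 1"]
        by (subst d1, subst cond_Suc, subst d1[symmetric]) (intro mult_left_mono, auto)
      then have "exp C * (cond u (d - 1) * exp (- C)) \<le> exp C * cond u d" by (intro mult_left_mono) auto
      moreover have "exp C * (cond u (d - 1) * exp (- C)) = cond u (d - 1) * (exp C * exp (- C))" by (simp only: mult_ac)
      ultimately show ?thesis unfolding exp_minus_inverse mult_1_right by linarith
    qed
    then have c1: "cond u (d - 1) + cond u d \<le> (1 + exp C) * cond u d" by (simp add: algebra_simps)
    have "cond u d = cond u n1 * exp (start - height start u n1 j)" unfolding d_def by (rule cond_height)
    also have "\<dots> \<le> cond u n1 * exp (start - 2 * r)" using j(2) cond_pos[of u n1] by simp
    also have "\<dots> \<le> cond u b * exp (start - 2 * r)"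
    proof (rule mult_right_mono)
      have "1 \<le> exp (\<kappa> * K)" using kappa by simp
      then have "1 * cond u n1 \<le> exp (\<kappa> * K) * cond u n1" using cond_pos[of u n1] by (intro mult_right_mono) auto
      then show "cond u n1 \<le> cond u b" using slopeR by simp
    qed simp
    finally have c2: "cond u d \<le> cond u b * exp (start - 2 * r)" .
    have "(\<Sum>k<b. left_mass (cond u) k) * (cond u (d - 1) + cond u d)
       \<le> (real b * ((1 + exp C) ^ K * exp r)) * ((1 + exp C) * (cond u b * exp (start - 2 * r)))"
    proof (rule mult_mono[OF sY])
      show "cond u (d - 1) + cond u d \<le> (1 + exp C) * (cond u b * exp (start - 2 * r))"
        using c1 by (rule order_trans) (intro mult_left_mono c2, simp add: add_nonneg_nonneg)
    qed (auto intro!: add_nonneg_nonneg less_imp_le[OF cond_pos] mult_nonneg_nonneg)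
    also have "\<dots> = (real b * (1 + exp C) ^ (K + 1) * (exp r * exp (start - 2 * r))) * cond u b" by simp
    also have "exp r * exp (start - 2 * r) = exp (start - r)" by (simp add: exp_add[symmetric])
    also have "real b * (1 + exp C) ^ (K + 1) * exp (start - r) * cond u b \<le> \<gamma> * cond u b"
      using growth cond_pos[of u b] by (intro mult_right_mono) (auto simp: b_def)
    finally show ?thesis .
  qed
  have "deep_valley K \<gamma> u b d" unfolding deep_valley_def
    using PL P0 PR sL sR sD j(1) by (auto simp: b_def n1 d_def n1_def)
  moreover have "n \<le> b" by (simp add: b_def)
  ultimately show ?thesis by blast
qed

text \<open>From the end of the pattern until the climb ends, the potential stays so far above the bottom of the
  valley that \<open>Y\<close> exceeds the low level, and at the end of the climb \<open>Y\<close> exceeds \<open>exp r\<close>. Hence every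
  later visit to the low level before \<open>exp r\<close> is reached falls into the pattern.\<close>

lemma success_overlap:
  assumes u: "u \<in> success K r m n k" "u \<in> success K r m n k'" and r: "start \<le> r" and Sr: "low_level \<le> exp r"
    and K1: "low_level * exp start \<le> exp (\<kappa> * K)"
  shows "k' \<le> k + (2 * K + 1)"
proof (rule ccontr)
  assume gt: "\<not> k' \<le> k + (2 * K + 1)"
  define b where "b = n + k + Suc K"
  define n1 where "n1 = n + k + (2 * K + 1)"
  have n1: "n1 = b + K" by (simp add: n1_def b_def)
  obtain j where j: "0 < j" "2 * r \<le> height start u n1 j" "\<And>i. i < j \<Longrightarrow> 0 \<le> height start u n1 i"
    using success_climb[OF u(1) r] unfolding n1_def by metis
  have slopeR: "exp (\<kappa> * K) * cond u n1 \<le> cond u b" using pattern_slopes(2)[OF u(1), of K] by (simp add: n1 b_def)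
  have Zk: "stopped_Y (exp r) n k' u < low_level" using u(2) by (simp add: success_def)
  have Y_stopped: "i \<le> k' \<Longrightarrow> stopped_Y (exp r) n i u = Y u (n + i) \<and> Y u (n + i) < exp r" for i using stopped_Y_eq_Y[of "exp r" n k' u i] Zk Sr by simp
  have S0: "0 < low_level" unfolding low_level_def by (rule add_nonneg_pos) auto
  have low: "exp (\<kappa> * K + height start u n1 q - start) \<le> Y u (n1 + q)" for q
  proof -
    have "exp (\<kappa> * K) * cond u n1 \<le> Y u (n1 + q) * cond u (n1 + q)"
      using slopeR ratio_le_Y[of b "n1 + q" u] by (simp add: n1)
    also have "cond u (n1 + q) = cond u n1 * exp (start - height start u n1 q)" by (rule cond_height)
    finally have "exp (\<kappa> * K) * cond u n1 \<le> (Y u (n1 + q) * exp (start - height start u n1 q)) * cond u n1" by (simp only: mult_ac)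
    then have "exp (\<kappa> * K) \<le> Y u (n1 + q) * exp (start - height start u n1 q)" using cond_pos[of u n1] by simp
    then have "exp (\<kappa> * K) * exp (height start u n1 q - start) \<le> Y u (n1 + q) * exp (start - height start u n1 q) * exp (height start u n1 q - start)"
      by (rule mult_right_mono) simp
    also have "\<dots> = Y u (n1 + q)" by (simp add: mult.assoc exp_add[symmetric])
    finally show ?thesis by (simp add: exp_add[symmetric] add_diff_eq)
  qed
  define q where "q = n + k' - n1"
  have q: "n1 + q = n + k'" using gt by (simp add: q_def n1_def)
  have SeK: "ln low_level + start \<le> \<kappa> * K"
  proof -
    have "exp (ln low_level + start) \<le> exp (\<kappa> * K)" using K1 S0 by (simp add: exp_add)
    then show ?thesis by simp
  qed
  show False
  proof (cases "q \<le> j")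
    case True
    have h: "0 \<le> height start u n1 q"
    proof (cases "q = j")
      case True then show ?thesis using j(2) r start_pos by simp
    qed (use j(3) \<open>q \<le> j\<close> in auto)
    have "low_level = exp (ln low_level)" using S0 by simp
    also have "\<dots> \<le> exp (\<kappa> * K + height start u n1 q - start)" using SeK h by simp
    also have "\<dots> \<le> Y u (n + k')" using low[of q] q by simp
    finally show False using Y_stopped[of k'] Zk by simp
  next
    case False
    have "1 \<le> low_level" by (simp add: low_level_def)
    then have "0 \<le> \<kappa> * K - start" using SeK ln_ge_zero[of low_level] by linarith
    then have "exp r \<le> exp (\<kappa> * K + height start u n1 j - start)" using j(2) r start_pos by simp
    also have "\<dots> \<le> Y u (n1 + j)" by (rule low)
    also have "n1 + j = n + (n1 + j - n)" by (simp add: n1_def)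
    finally have "exp r \<le> Y u (n + (n1 + j - n))" .
    moreover have "n1 + j - n \<le> k'" using False q by arith
    ultimately show False using Y_stopped[of "n1 + j - n"] by simp
  qed
qed

end

context valley_pattern begin

definition stage_prob :: "nat \<Rightarrow> real" where
  "stage_prob K = (\<Prod>i=1..2 * K + 1. N.prob (pattern K i)) / (48 * (1 + exp C) * real (2 * K + 2))"

lemma pattern_borel [measurable]: "pattern K i \<in> sets borel"
  by (simp add: pattern_def)

lemma pattern_prob_pos: "0 < N.prob (pattern K i)"
  using pattern_prob by (simp add: pattern_def)

lemma stage_prob_pos: "0 < stage_prob K"
  unfolding stage_prob_def by (intro divide_pos_pos prod_pos mult_pos_pos add_pos_pos) (auto simp: pattern_prob_pos)

lemma success_sets: "success K r m n k \<in> sets iid"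
proof -
  have 1: "{u. stopped_Y (exp r) n k u < low_level} \<in> sets iid"
    using measurable_sets[OF stopped_Y_measurable, of "{..<low_level}" "exp r" n k] by (simp add: vimage_def)
  have 2: "{u. \<forall>i\<in>{1..2 * K + 1}. u (n + k + i) \<in> pattern K i} \<in> sets iid"
    by (rule prob_pattern(1)[of UNIV]) (auto simp: determined_def intro: sets.top[of iid, simplified])
  have "(\<lambda>u. fst (climb start (2 * r) (n + k + (2 * K + 1)) m u)) \<in> borel_measurable iid" by measurable
  from measurable_sets[OF this, of "{2 * r..}"]
  have 3: "{u. 2 * r \<le> fst (climb start (2 * r) (n + k + (2 * K + 1)) m u)} \<in> sets iid" by (simp add: vimage_def)
  show ?thesis unfolding success_def using 1 2 3 by blast
qed

lemma success_determined: "determined (n + k + (2 * K + 1) + m) (success K r m n k)"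
  unfolding determined_def success_def by (auto simp: stopped_Y_update climb_update)

lemma success_lower_bound:
  assumes r: "start \<le> r" "C + climb_const \<le> r" "0 < r"
    and B [measurable]: "B \<in> sets iid" and det: "determined n B"
    and m: "2 * (2 * r + C + climb_const) ^ 3 / variance_xi \<le> real m"
  shows "(\<Prod>i=1..2 * K + 1. N.prob (pattern K i)) / (6 * r) * P.prob (B \<inter> {u. stopped_Y (exp r) n k u < low_level}) \<le> P.prob (B \<inter> success K r m n k)"
proof -
  define p where "p = (\<Prod>i=1..2 * K + 1. N.prob (pattern K i))"
  define B1 where "B1 = B \<inter> {u. stopped_Y (exp r) n k u < low_level}"
  define B2 where "B2 = B1 \<inter> {u. \<forall>i\<in>{1..2 * K + 1}. u (n + k + i) \<in> pattern K i}"
  have s1: "{u. stopped_Y (exp r) n k u < low_level} \<in> sets iid"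
    using measurable_sets[OF stopped_Y_measurable, of "{..<low_level}" "exp r" n k] by (simp add: vimage_def)
  have B1: "B1 \<in> sets iid" "determined (n + k) B1"
    unfolding B1_def using s1 B determined_mono[OF det, of "n + k"] by (auto simp: determined_def stopped_Y_update)
  note pp = prob_pattern[OF B1, of "pattern K" "2 * K + 1", OF pattern_borel]
  have B2: "B2 \<in> sets iid" "determined (n + k + (2 * K + 1)) B2" "P.prob B2 = P.prob B1 * p"
    unfolding B2_def p_def using pp B1 determined_mono[OF B1(2), of "n + k + (2 * K + 1)"] by (auto intro: determined_Int)
  have p0: "0 \<le> p" unfolding p_def by (intro prod_nonneg) simp
  have "p / (6 * r) * P.prob B1 = P.prob B2 / (6 * r)" using B2(3) by simp
  also have "\<dots> \<le> P.prob B2 / (2 * (2 * r + C + climb_const))"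
    using r C_pos climb_const_pos by (intro divide_left_mono) (auto intro!: mult_pos_pos)
  also have "\<dots> \<le> P.prob (B2 \<inter> {u. 2 * r \<le> fst (climb start (2 * r) (n + k + (2 * K + 1)) m u)})"
    by (rule climb_succeeds[OF _ B2(1,2) m]) (use r in simp)
  also have "B2 \<inter> {u. 2 * r \<le> fst (climb start (2 * r) (n + k + (2 * K + 1)) m u)} = B \<inter> success K r m n k"
    by (auto simp: B2_def B1_def success_def)
  finally show ?thesis by (simp add: p_def B1_def)
qed

text \<open>The bound holds for every event \<open>B\<close> of the past and \<open>stage_prob\<close> does not depend on \<open>n\<close>. The probability \<open>c / r\<close> of
  a success at one low visit is balanced by the expected number of low visits, which is of order \<open>r\<close>; as
  at most \<open>2 * K + 2\<close> successes overlap, the sum of their probabilities is comparable to the probability of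
  their union.\<close>

lemma stage:
  assumes K1: "low_level \<le> \<gamma> * exp (\<kappa> * K)" "2 * exp start \<le> \<gamma> * exp (\<kappa> * K)" "low_level * exp start \<le> exp (\<kappa> * K)"
    and gamma: "0 < \<gamma>"
  shows "\<exists>n' D. n \<le> n' \<and> D \<in> sets iid \<and> determined n' D \<and> D \<subseteq> {u. \<exists>b\<ge>n. \<exists>d. deep_valley K \<gamma> u b d}
    \<and> (\<forall>B. B \<in> sets iid \<longrightarrow> determined n B \<longrightarrow> stage_prob K * P.prob B \<le> P.prob (B \<inter> D))"
proof -
  define l where "l = ln (1 + exp C)"
  define v where "v = positive_variance"
  define a where "a = real n + real K + 2"
  define q where "q = (1 + exp C) ^ (K + 1) * exp start"
  have v: "0 < v" using positive_variance_pos by (simp add: v_def)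
  have lpos: "0 < l" unfolding l_def by (intro ln_gt_zero) simp
  have lim: "((\<lambda>r::real. (a + 2 * (r + l)\<^sup>2 / v) * exp (- r) * q) \<longlongrightarrow> 0) at_top" using v by real_asymp
  have "\<forall>\<^sub>F r in at_top. (a + 2 * (r + l)\<^sup>2 / v) * exp (- r) * q < \<gamma>"
    using order_tendstoD(2)[OF lim gamma] .
  moreover have "\<forall>\<^sub>F r in at_top. max 8 (max (4 * n * l) (max (ln low_level) (max start (C + climb_const)))) \<le> r" by (rule eventually_ge_at_top)
  ultimately have "\<forall>\<^sub>F r in at_top. (a + 2 * (r + l)\<^sup>2 / v) * exp (- r) * q < \<gamma> \<and> max 8 (max (4 * n * l) (max (ln low_level) (max start (C + climb_const)))) \<le> r"
    by (rule eventually_conj)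
  then obtain r where r0: "(a + 2 * (r + l)\<^sup>2 / v) * exp (- r) * q < \<gamma>" and r1: "max 8 (max (4 * n * l) (max (ln low_level) (max start (C + climb_const)))) \<le> r"
    using eventually_happens[of _ "at_top :: real filter"] by (auto simp: trivial_limit_at_top_linorder)
  have r: "8 \<le> r" "real n * l \<le> r / 4" "ln low_level \<le> r" "start \<le> r" "C + climb_const \<le> r" using r1 by auto
  have S1: "1 \<le> low_level" by (simp add: low_level_def)
  have Sr: "low_level \<le> exp r"
  proof -
    have "exp (ln low_level) \<le> exp r" using r(3) by simp
    then show ?thesis using S1 by simp
  qed
  have Yn: "(1 + exp C) ^ n \<le> exp r"
  proof -
    have "(1 + exp C) ^ n = exp (real n * l)" unfolding l_def by (subst exp_of_nat_mult) (simp add: add_pos_pos)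
    also have "\<dots> \<le> exp r" using r by simp
    finally show ?thesis .
  qed
  \<comment> \<open>The lengths of the search and of the climb demanded by \<open>expected_low_visits\<close> and \<open>climb_succeeds\<close>.\<close>
  define t where "t = nat \<lceil>2 * (r + l)\<^sup>2 / v\<rceil>"
  have t: "2 * (r + l)\<^sup>2 / v \<le> real t" "real t \<le> 2 * (r + l)\<^sup>2 / v + 1"
  proof -
    have "0 \<le> 2 * (r + l)\<^sup>2 / v" using v by simp
    then show "2 * (r + l)\<^sup>2 / v \<le> real t" "real t \<le> 2 * (r + l)\<^sup>2 / v + 1" unfolding t_def by linarith+
  qed
  define m where "m = nat \<lceil>2 * (2 * r + C + climb_const) ^ 3 / variance_xi\<rceil>"
  have m: "2 * (2 * r + C + climb_const) ^ 3 / variance_xi \<le> real m" unfolding m_def by linarith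
  define D where "D = (\<Union>k\<in>{..<t}. success K r m n k)"
  define n' where "n' = n + t + (2 * K + 1) + m"
  have "n \<le> n'" by (simp add: n'_def)
  moreover have Ds: "D \<in> sets iid" unfolding D_def by (intro sets.finite_UN) (auto simp: success_sets)
  moreover have "determined n' D" unfolding D_def
    by (intro determined_Un determined_mono[OF success_determined]) (auto simp: n'_def)
  moreover have "D \<subseteq> {u. \<exists>b\<ge>n. \<exists>d. deep_valley K \<gamma> u b d}"
  proof
    fix u assume "u \<in> D"
    then obtain k where k: "k < t" "u \<in> success K r m n k" by (auto simp: D_def)
    have "real (n + k + K + 1) * (1 + exp C) ^ (K + 1) * exp (start - r) = real (n + k + K + 1) * exp (- r) * q"
      by (simp add: q_def exp_diff exp_minus divide_inverse)
    also have "\<dots> \<le> (a + 2 * (r + l)\<^sup>2 / v) * exp (- r) * q"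
    proof (intro mult_right_mono)
      show "real (n + k + K + 1) \<le> a + 2 * (r + l)\<^sup>2 / v" using k(1) t(2) by (simp add: a_def)
    qed (auto simp: q_def add_nonneg_nonneg)
    also have "\<dots> \<le> \<gamma>" using r0 by simp
    finally have "real (n + k + K + 1) * (1 + exp C) ^ (K + 1) * exp (start - r) \<le> \<gamma>" .
    from success_deep_valley[OF k(2) r(4) Sr Yn K1(1,2) this]
    show "u \<in> {u. \<exists>b\<ge>n. \<exists>d. deep_valley K \<gamma> u b d}" by simp
  qed
  moreover have "stage_prob K * P.prob B \<le> P.prob (B \<inter> D)" if B: "B \<in> sets iid" "determined n B" for B
  proof -
    define p where "p = (\<Prod>i=1..2 * K + 1. N.prob (pattern K i))"
    have p0: "0 \<le> p" unfolding p_def by (intro prod_nonneg) simp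
    have "r / (8 * (1 + exp C)) * P.prob B \<le> (\<Sum>k<t. P.prob (B \<inter> {u. stopped_Y (exp r) n k u < low_level}))"
      using expected_low_visits[OF r(1) _ B, of t] r(2) t(1) by (simp add: l_def v_def)
    then have "p / (6 * r) * (r / (8 * (1 + exp C)) * P.prob B) \<le> p / (6 * r) * (\<Sum>k<t. P.prob (B \<inter> {u. stopped_Y (exp r) n k u < low_level}))"
      using p0 r(1) by (intro mult_left_mono) auto
    also have "\<dots> = (\<Sum>k<t. p / (6 * r) * P.prob (B \<inter> {u. stopped_Y (exp r) n k u < low_level}))" by (rule sum_distrib_left)
    also have "\<dots> \<le> (\<Sum>k<t. P.prob (B \<inter> success K r m n k))"
      unfolding p_def using r B m by (intro sum_mono success_lower_bound) auto
    also have "\<dots> = (\<integral>u. (\<Sum>k<t. indicator (B \<inter> success K r m n k) u) \<partial>iid)"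
      using B success_sets by (subst Bochner_Integration.integral_sum) (auto simp: less_top[symmetric] P.emeasure_eq_measure)
    also have "\<dots> \<le> (\<integral>u. real (2 * K + 2) * indicator (B \<inter> D) u \<partial>iid)"
    proof (rule integral_mono)
      show "integrable iid (\<lambda>u. \<Sum>k<t. indicator (B \<inter> success K r m n k) u :: real)"
        using B success_sets by (intro Bochner_Integration.integrable_sum) (auto simp: less_top[symmetric] P.emeasure_eq_measure)
      show "integrable iid (\<lambda>u. real (2 * K + 2) * indicator (B \<inter> D) u)"
        using B Ds by (auto simp: less_top[symmetric] P.emeasure_eq_measure)
      fix u
      show "(\<Sum>k<t. indicator (B \<inter> success K r m n k) u) \<le> real (2 * K + 2) * indicator (B \<inter> D) u"
      proof (cases "u \<in> B \<inter> D")
        case False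
        then have "(\<Sum>k<t. indicator (B \<inter> success K r m n k) u) = (0::real)"
          by (intro sum.neutral) (auto simp: D_def indicator_def)
        then show ?thesis using False by simp
      next
        case True
        define A where "A = {k. k < t \<and> u \<in> success K r m n k}"
        have "A \<noteq> {}" using True by (auto simp: A_def D_def)
        define k0 where "k0 = Min A"
        have fA: "finite A" by (simp add: A_def)
        have k0: "k0 \<in> A" using Min_in[OF fA \<open>A \<noteq> {}\<close>] by (simp add: k0_def)
        have "A \<subseteq> {k0..k0 + (2 * K + 1)}"
          using success_overlap[OF _ _ r(4) Sr K1(3)] k0 Min_le[OF fA] by (auto simp: A_def k0_def)
        then have "card A \<le> card {k0..k0 + (2 * K + 1)}" by (intro card_mono) auto
        also have "\<dots> = 2 * K + 2" by simp
        finally have c: "real (card A) \<le> real (2 * K + 2)" by (simp only: of_nat_le_iff)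
        have "(\<Sum>k<t. indicator (B \<inter> success K r m n k) u) = (\<Sum>k<t. if u \<in> success K r m n k then 1 else 0 :: real)"
          using True by (intro sum.cong) (auto simp: indicator_def)
        also have "\<dots> = real (card A)" by (simp add: sum.If_cases A_def Int_def)
        finally show ?thesis using c True by simp
      qed
    qed
    also have "\<dots> = real (2 * K + 2) * P.prob (B \<inter> D)" using B Ds by simp
    finally have fin: "p / (6 * r) * (r / (8 * (1 + exp C)) * P.prob B) \<le> real (2 * K + 2) * P.prob (B \<inter> D)" .
    have eq: "p / (6 * r) * (r / (8 * (1 + exp C)) * P.prob B) = p / (48 * (1 + exp C)) * P.prob B"
      using r(1) by simp
    have "p / (48 * (1 + exp C)) * P.prob B \<le> P.prob (B \<inter> D) * real (2 * K + 2)"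
      using fin unfolding eq by (simp only: mult.commute)
    then have "p / (48 * (1 + exp C)) * P.prob B / real (2 * K + 2) \<le> P.prob (B \<inter> D)"
      by (rule mult_imp_div_pos_le[rotated]) simp
    moreover have "stage_prob K * P.prob B = p / (48 * (1 + exp C)) * P.prob B / real (2 * K + 2)"
      unfolding stage_prob_def p_def[symmetric] by simp
    ultimately show ?thesis by simp
  qed
  ultimately show ?thesis by blast
qed

text \<open>The stages are played one after the other on disjoint blocks of coordinates, and each succeeds with
  probability at least \<open>stage_prob K\<close> whatever happened before.\<close>

theorem deep_valleys_recur:
  assumes gamma: "0 < \<gamma>"
  shows "\<exists>K. AE u in iid. \<forall>n. \<exists>b\<ge>n. \<exists>d. deep_valley K \<gamma> u b d"
proof -
  have lim: "filterlim (\<lambda>K. exp (\<kappa> * real K)) at_top sequentially" using kappa by real_asymp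
  have "\<forall>\<^sub>F K in sequentially. max (low_level / \<gamma>) (max (2 * exp start / \<gamma>) (low_level * exp start)) \<le> exp (\<kappa> * real K)"
    using lim unfolding filterlim_at_top by blast
  then obtain K where K: "max (low_level / \<gamma>) (max (2 * exp start / \<gamma>) (low_level * exp start)) \<le> exp (\<kappa> * real K)"
    unfolding eventually_sequentially by blast
  have K1: "low_level \<le> \<gamma> * exp (\<kappa> * K)" "2 * exp start \<le> \<gamma> * exp (\<kappa> * K)" "low_level * exp start \<le> exp (\<kappa> * K)"
    using K gamma by (auto simp: pos_divide_le_eq mult.commute)
  let ?Q = "\<lambda>n x. n \<le> fst x \<and> snd x \<in> sets iid \<and> determined (fst x) (snd x) \<and> snd x \<subseteq> {u. \<exists>b\<ge>n. \<exists>d. deep_valley K \<gamma> u b d}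
    \<and> (\<forall>B. B \<in> sets iid \<longrightarrow> determined n B \<longrightarrow> stage_prob K * P.prob B \<le> P.prob (B \<inter> snd x))"
  have "\<forall>n. \<exists>x. ?Q n x"
  proof
    fix n
    from stage[OF K1 gamma, of n] obtain n' D where "?Q n (n', D)" unfolding fst_conv snd_conv by blast
    then show "\<exists>x. ?Q n x" by (rule exI)
  qed
  from choice[OF this] obtain f where f: "\<forall>n. ?Q n (f n)" by (rule exE)
  define nx where "nx = (\<lambda>n. fst (f n))"
  define D where "D = (\<lambda>n. snd (f n))"
  have st: "\<And>n. n \<le> nx n" "\<And>n. D n \<in> sets iid" "\<And>n. determined (nx n) (D n)"
      "\<And>n. D n \<subseteq> {u. \<exists>b\<ge>n. \<exists>d. deep_valley K \<gamma> u b d}"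
      "\<And>n B. B \<in> sets iid \<Longrightarrow> determined n B \<Longrightarrow> stage_prob K * P.prob B \<le> P.prob (B \<inter> D n)"
    using f unfolding nx_def D_def by blast+
  have "AE u in iid. \<exists>b\<ge>n. \<exists>d. deep_valley K \<gamma> u b d" for n
  proof -
    \<comment> \<open>\<open>N j\<close> is the start of stage \<open>j\<close>, and \<open>E J\<close> the event that the first \<open>J\<close> stages fail.\<close>
    define N where "N = (\<lambda>j. (nx ^^ j) n)"
    define E where "E = (\<lambda>J. space iid - (\<Union>j\<in>{..<J}. D (N j)))"
    have Nmono: "n \<le> N j" for j by (induction j) (auto simp: N_def intro: order_trans[OF _ st(1)])
    have Es: "E J \<in> sets iid" for J unfolding E_def by (intro sets.Diff sets.finite_UN sets.top) (use st(2) in auto)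
    have ES: "E (Suc J) = E J - D (N J)" for J by (auto simp: E_def lessThan_Suc)
    have Ed: "determined (N J) (E J)" for J
    proof (induction J)
      case 0 then show ?case by (simp add: E_def determined_def)
    next
      case (Suc J)
      have le: "N J \<le> N (Suc J)" by (simp add: N_def st(1))
      have "N (Suc J) = nx (N J)" by (simp add: N_def)
      then show ?case unfolding ES using determined_mono[OF Suc le] st(3)[of "N J"] by (intro determined_Diff) auto
    qed
    have c0: "0 \<le> 1 - stage_prob K"
    proof -
      have "stage_prob K * P.prob UNIV \<le> P.prob (UNIV \<inter> D n)" using sets.top[of iid] by (intro st(5)) (auto simp: determined_def)
      then have "stage_prob K \<le> P.prob (D n)" using P.prob_space by simp
      then show ?thesis using P.prob_le_1[of "D n"] by linarith
    qed
    have PE: "P.prob (E J) \<le> (1 - stage_prob K) ^ J" for J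
    proof (induction J)
      case 0 then show ?case by simp
    next
      case (Suc J)
      have "P.prob (E (Suc J)) = P.prob (E J) - P.prob (E J \<inter> D (N J))"
        unfolding ES by (rule P.finite_measure_Diff'[OF Es st(2)])
      also have "\<dots> \<le> P.prob (E J) - stage_prob K * P.prob (E J)" using st(5)[OF Es Ed] by simp
      also have "\<dots> = (1 - stage_prob K) * P.prob (E J)" by (simp add: algebra_simps)
      also have "\<dots> \<le> (1 - stage_prob K) * (1 - stage_prob K) ^ J" by (rule mult_left_mono[OF Suc c0])
      finally show ?case by simp
    qed
    define F where "F = (\<Inter>J. E J)"
    have Fs: "F \<in> sets iid" unfolding F_def using Es by (intro sets.countable_INT) auto
    have "P.prob F \<le> (1 - stage_prob K) ^ J" for J
      by (rule order_trans[OF P.finite_measure_mono PE[of J]]) (auto simp: F_def Es)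
    moreover have "(\<lambda>J. (1 - stage_prob K) ^ J) \<longlonglongrightarrow> 0" by (rule LIMSEQ_realpow_zero[OF c0]) (use stage_prob_pos[of K] in simp)
    ultimately have "P.prob F \<le> 0" by (intro LIMSEQ_le_const) auto
    then have "F \<in> null_sets iid" using Fs measure_nonneg[of iid F] by (auto simp: null_sets_def P.emeasure_eq_measure)
    then show ?thesis
    proof (rule AE_I')
      show "{u \<in> space iid. \<not> (\<exists>b\<ge>n. \<exists>d. deep_valley K \<gamma> u b d)} \<subseteq> F"
      proof
        fix u assume u: "u \<in> {u \<in> space iid. \<not> (\<exists>b\<ge>n. \<exists>d. deep_valley K \<gamma> u b d)}"
        have "u \<notin> D (N j)" for j
        proof
          assume "u \<in> D (N j)"
          then obtain b d where "N j \<le> b" "deep_valley K \<gamma> u b d" using st(4) by blast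
          then show False using u Nmono[of j] order_trans by blast
        qed
        then show "u \<in> F" by (auto simp: F_def E_def)
      qed
    qed
  qed
  then show ?thesis by (auto simp: AE_all_countable)
qed

end

section \<open>The optimal return time\<close>

text \<open>The complement of the support is a union of open null sets, countably many of which suffice by
  Lindelof's theorem.\<close>

lemma AE_topological_support:
  fixes \<nu> :: "'a::second_countable_topology measure"
  assumes sets: "sets \<nu> = sets borel"
  shows "AE s in \<nu>. s \<in> topological_support \<nu>"
proof -
  define F where "F = {U :: 'a set. open U \<and> emeasure \<nu> U = 0}"
  have "\<And>U. U \<in> F \<Longrightarrow> open U" by (simp add: F_def)
  then obtain F' where F': "F' \<subseteq> F" "countable F'" "\<Union> F' = \<Union> F" using Lindelof by metis
  have "(\<Union>U\<in>F'. U) \<in> null_sets \<nu>"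
    using F'(1,2) by (intro null_sets_UN') (auto simp: F_def null_sets_def sets)
  moreover have "{s \<in> space \<nu>. s \<notin> topological_support \<nu>} \<subseteq> (\<Union>U\<in>F'. U)"
  proof
    fix s assume "s \<in> {s \<in> space \<nu>. s \<notin> topological_support \<nu>}"
    then obtain U where "open U" "s \<in> U" "\<not> 0 < emeasure \<nu> U" by (auto simp: topological_support_def)
    then have "s \<in> \<Union> F" by (auto simp: F_def)
    then show "s \<in> (\<Union>U\<in>F'. U)" using F'(3) by simp
  qed
  ultimately show ?thesis by (rule AE_I')
qed

lemma limsup_eqI:
  fixes f :: "nat \<Rightarrow> real"
  assumes a: "0 < a"
    and up: "\<And>j::nat. \<forall>\<^sub>F n in sequentially. f n \<le> (1 + 1 / real (Suc j)) * a"
    and lo: "\<And>j::nat. \<exists>\<^sub>F n in sequentially. (1 - 1 / real (Suc j)) * a \<le> f n"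
  shows "limsup (\<lambda>n. ereal (f n)) = ereal a"
proof (rule antisym)
  have A: "limsup (\<lambda>n. ereal (f n)) \<le> ereal ((1 + 1 / real (Suc j)) * a)" for j
    by (rule Limsup_bounded) (use up[of j] in simp)
  have B: "(\<lambda>j. ereal ((1 + 1 / real (Suc j)) * a)) \<longlonglongrightarrow> ereal a"
  proof (subst tendsto_ereal)
    show "((\<lambda>j. (1 + 1 / real (Suc j)) * a) \<longlongrightarrow> a) sequentially" by real_asymp
  qed auto
  show "limsup (\<lambda>n. ereal (f n)) \<le> ereal a" by (rule LIMSEQ_le_const[OF B]) (use A in blast)
  have A: "ereal ((1 - 1 / real (Suc j)) * a) \<le> limsup (\<lambda>n. ereal (f n))" for j
  proof (rule ccontr)
    assume "\<not> ?thesis"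
    then have "limsup (\<lambda>n. ereal (f n)) < ereal ((1 - 1 / real (Suc j)) * a)" by simp
    then have "\<forall>\<^sub>F n in sequentially. ereal (f n) < ereal ((1 - 1 / real (Suc j)) * a)" by (rule Limsup_lessD)
    then have "\<forall>\<^sub>F n in sequentially. \<not> (1 - 1 / real (Suc j)) * a \<le> f n" by (rule eventually_mono) simp
    then show False using lo[of j] by (simp add: frequently_def)
  qed
  have B: "(\<lambda>j. ereal ((1 - 1 / real (Suc j)) * a)) \<longlonglongrightarrow> ereal a"
  proof (subst tendsto_ereal)
    show "((\<lambda>j. (1 - 1 / real (Suc j)) * a) \<longlongrightarrow> a) sequentially" by real_asymp
  qed auto
  show "ereal a \<le> limsup (\<lambda>n. ereal (f n))" by (rule LIMSEQ_le_const2[OF B]) (use A in blast)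
qed

text \<open>The mean return time to a site in the environment that is constantly \<open>M\<close> to the left of it and \<open>w\<close> to
  the right of it, with the better one of these two values at the site.\<close>

definition return_time :: "real \<Rightarrow> real \<Rightarrow> real" where
  "return_time w M = 2 * (M - w) * min M (1 - w) / ((2 * M - 1) * (1 - 2 * w))"

lemma return_time_endpoints:
  fixes w M :: real
  assumes "w < 1/2" "1/2 < M"
  shows "1 + M / (1 - 2 * w) + (1 - M) / (2 * M - 1) = 2 * (M - w) * M / ((2 * M - 1) * (1 - 2 * w))"
    "1 + w / (1 - 2 * w) + (1 - w) / (2 * M - 1) = 2 * (M - w) * (1 - w) / ((2 * M - 1) * (1 - 2 * w))"
proof -
  have n: "1 - 2 * w \<noteq> 0" "2 * M - 1 \<noteq> 0" using assms by auto
  show "1 + M / (1 - 2 * w) + (1 - M) / (2 * M - 1) = 2 * (M - w) * M / ((2 * M - 1) * (1 - 2 * w))"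
    "1 + w / (1 - 2 * w) + (1 - w) / (2 * M - 1) = 2 * (M - w) * (1 - w) / ((2 * M - 1) * (1 - 2 * w))"
    using n by (simp_all add: divide_simps) (simp_all add: algebra_simps)
qed

lemma return_time_pos: "w < 1/2 \<Longrightarrow> 1/2 < M \<Longrightarrow> 0 < return_time w M"
  unfolding return_time_def by (intro divide_pos_pos mult_pos_pos) auto

lemma return_time_le:
  assumes w: "w < 1/2" and M: "1/2 < M" and s: "w \<le> s" "s \<le> M"
  shows "return_time w M \<le> 1 + s / (1 - 2 * w) + (1 - s) / (2 * M - 1)"
proof -
  define a where "a = 1 / (1 - 2 * w)"
  define b where "b = 1 / (2 * M - 1)"
  define D where "D = (2 * M - 1) * (1 - 2 * w)"
  have D: "0 < D" using w M by (simp add: D_def)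
  have e: "2 * (M - w) * M / D = 1 + a * M + b * (1 - M)" "2 * (M - w) * (1 - w) / D = 1 + a * w + b * (1 - w)"
    using return_time_endpoints[OF w M] by (simp_all add: a_def b_def D_def)
  have t: "return_time w M \<le> 2 * (M - w) * M / D" "return_time w M \<le> 2 * (M - w) * (1 - w) / D"
    unfolding return_time_def D_def[symmetric] using D w M by (auto intro!: divide_right_mono mult_left_mono)
  show ?thesis
  proof (cases "a \<le> b")
    case True
    have "(b - a) * s \<le> (b - a) * M" using True s by (intro mult_left_mono) auto
    then have "1 + a * M + b * (1 - M) \<le> 1 + a * s + b * (1 - s)" by (simp add: algebra_simps)
    then show ?thesis using t(1) e(1) by (simp add: a_def b_def)
  next
    case False
    have "(a - b) * w \<le> (a - b) * s" using False s by (intro mult_left_mono) auto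
    then have "1 + a * w + b * (1 - w) \<le> 1 + a * s + b * (1 - s)" by (simp add: algebra_simps)
    then show ?thesis using t(2) e(2) by (simp add: a_def b_def)
  qed
qed

text \<open>In a neighbourhood of the optimal environment the mean return time is nearly optimal. If \<open>M \<le> 1 - w\<close>, the
  best value at the site itself is \<open>M\<close>, otherwise \<open>w\<close>.\<close>

lemma return_time_approx:
  assumes w: "w < 1/2" and M: "1/2 < M" and eps: "0 < \<epsilon>"
  shows "\<exists>\<eta>>0. M - \<eta> > 1/2 \<and> w + \<eta> < 1/2 \<and>
    ((\<forall>s. M - \<eta> \<le> s \<and> s \<le> M \<longrightarrow> 1 + s / (1 - 2 * (w + \<eta>)) + (1 - s) / (2 * (M - \<eta>) - 1) \<le> return_time w M + \<epsilon>) \<or>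
     (\<forall>s. w \<le> s \<and> s \<le> w + \<eta> \<longrightarrow> 1 + s / (1 - 2 * (w + \<eta>)) + (1 - s) / (2 * (M - \<eta>) - 1) \<le> return_time w M + \<epsilon>))"
proof -
  have r: "\<forall>\<^sub>F \<eta> in at_right 0. 0 < \<eta> \<and> M - \<eta> > 1/2 \<and> w + \<eta> < 1/2"
    using w M eventually_at_right_less[of 0] by (intro eventually_conj; (real_asymp | simp))
  have "((\<lambda>\<eta>. 1 + M / (1 - 2 * (w + \<eta>)) + (1 - (M - \<eta>)) / (2 * (M - \<eta>) - 1)) \<longlongrightarrow> 1 + M / (1 - 2 * w) + (1 - M) / (2 * M - 1)) (at_right 0)"
    using w M by (auto intro!: tendsto_eq_intros)
  then have l1: "((\<lambda>\<eta>. 1 + M / (1 - 2 * (w + \<eta>)) + (1 - (M - \<eta>)) / (2 * (M - \<eta>) - 1)) \<longlongrightarrow> 2 * (M - w) * M / ((2 * M - 1) * (1 - 2 * w))) (at_right 0)"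
    using return_time_endpoints[OF w M] by simp
  have "((\<lambda>\<eta>. 1 + (w + \<eta>) / (1 - 2 * (w + \<eta>)) + (1 - w) / (2 * (M - \<eta>) - 1)) \<longlongrightarrow> 1 + w / (1 - 2 * w) + (1 - w) / (2 * M - 1)) (at_right 0)"
    using w M by (auto intro!: tendsto_eq_intros)
  then have l2: "((\<lambda>\<eta>. 1 + (w + \<eta>) / (1 - 2 * (w + \<eta>)) + (1 - w) / (2 * (M - \<eta>) - 1)) \<longlongrightarrow> 2 * (M - w) * (1 - w) / ((2 * M - 1) * (1 - 2 * w))) (at_right 0)"
    using return_time_endpoints[OF w M] by simp
  show ?thesis
  proof (cases "M \<le> 1 - w")
    case True
    then have rt: "return_time w M = 2 * (M - w) * M / ((2 * M - 1) * (1 - 2 * w))" by (simp add: return_time_def)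
    have "\<forall>\<^sub>F \<eta> in at_right 0. 1 + M / (1 - 2 * (w + \<eta>)) + (1 - (M - \<eta>)) / (2 * (M - \<eta>) - 1) < return_time w M + \<epsilon>"
      by (rule order_tendstoD(2)[OF l1]) (use eps rt in simp)
    from eventually_happens'[OF _ eventually_conj[OF r this]]
    obtain \<eta> where e: "0 < \<eta>" "M - \<eta> > 1/2" "w + \<eta> < 1/2" "1 + M / (1 - 2 * (w + \<eta>)) + (1 - (M - \<eta>)) / (2 * (M - \<eta>) - 1) < return_time w M + \<epsilon>"
      by (auto simp: trivial_limit_at_right_real)
    have "1 + s / (1 - 2 * (w + \<eta>)) + (1 - s) / (2 * (M - \<eta>) - 1) \<le> return_time w M + \<epsilon>" if "M - \<eta> \<le> s" "s \<le> M" for s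
    proof -
      have "s / (1 - 2 * (w + \<eta>)) \<le> M / (1 - 2 * (w + \<eta>))" "(1 - s) / (2 * (M - \<eta>) - 1) \<le> (1 - (M - \<eta>)) / (2 * (M - \<eta>) - 1)"
        using that e by (auto intro!: divide_right_mono)
      then show ?thesis using e(4) by linarith
    qed
    then show ?thesis using e by blast
  next
    case False
    then have rt: "return_time w M = 2 * (M - w) * (1 - w) / ((2 * M - 1) * (1 - 2 * w))" by (simp add: return_time_def)
    have "\<forall>\<^sub>F \<eta> in at_right 0. 1 + (w + \<eta>) / (1 - 2 * (w + \<eta>)) + (1 - w) / (2 * (M - \<eta>) - 1) < return_time w M + \<epsilon>"
      by (rule order_tendstoD(2)[OF l2]) (use eps rt in simp)
    from eventually_happens'[OF _ eventually_conj[OF r this]]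
    obtain \<eta> where e: "0 < \<eta>" "M - \<eta> > 1/2" "w + \<eta> < 1/2" "1 + (w + \<eta>) / (1 - 2 * (w + \<eta>)) + (1 - w) / (2 * (M - \<eta>) - 1) < return_time w M + \<epsilon>"
      by (auto simp: trivial_limit_at_right_real)
    have "1 + s / (1 - 2 * (w + \<eta>)) + (1 - s) / (2 * (M - \<eta>) - 1) \<le> return_time w M + \<epsilon>" if "w \<le> s" "s \<le> w + \<eta>" for s
    proof -
      have "s / (1 - 2 * (w + \<eta>)) \<le> (w + \<eta>) / (1 - 2 * (w + \<eta>))" "(1 - s) / (2 * (M - \<eta>) - 1) \<le> (1 - w) / (2 * (M - \<eta>) - 1)"
        using that e by (auto intro!: divide_right_mono)
      then show ?thesis using e(4) by linarith
    qed
    then show ?thesis using e by blast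
  qed
qed

context quenched_walk begin

lemma valley_mono:
  assumes v: "valley \<omega> K \<alpha> \<beta> \<theta> \<gamma> b d" and le: "\<theta> \<le> \<theta>'" "\<gamma> \<le> \<gamma>'"
  shows "valley \<omega> K \<alpha> \<beta> \<theta>' \<gamma>' b d"
proof -
  have "\<gamma> * conductance \<omega> k \<le> \<gamma>' * conductance \<omega> k" for k
    using le(2) conductance_pos[of k] by (intro mult_right_mono) auto
  then show ?thesis using v le(1) unfolding valley_def by (meson order_trans)
qed

text \<open>Valleys reaching far to the right force recurrence: if the sum converged, \<open>c\<close> would tend to \<open>0\<close>, but
  at a valley \<open>c (b - 1) \<ge> 6 * c 0\<close>.\<close>

lemma conductance_diverges:
  assumes "\<And>N. \<exists>b\<ge>N. \<exists>d. valley \<omega> K \<alpha> \<beta> \<theta> (1 / 6) b d"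
  shows "\<exists>L. R < (\<Sum>k<L. conductance \<omega> k)"
proof (rule ccontr)
  assume "\<nexists>L. R < (\<Sum>k<L. conductance \<omega> k)"
  then have "summable (conductance \<omega>)"
    by (intro summableI_nonneg_bounded[of _ R]) (auto simp: not_less intro: less_imp_le conductance_pos)
  then have "conductance \<omega> \<longlonglongrightarrow> 0" by (rule summable_LIMSEQ_zero)
  then have "\<forall>\<^sub>F k in sequentially. conductance \<omega> k < 1" by (rule order_tendstoD(2)) simp
  then obtain N where N: "\<And>k. N \<le> k \<Longrightarrow> conductance \<omega> k < 1" unfolding eventually_sequentially by blast
  obtain b d where b: "Suc N \<le> b" "valley \<omega> K \<alpha> \<beta> \<theta> (1 / 6) b d" using assms by blast
  then have v: "K < b" "(\<Sum>y<b - K. conductance \<omega> y) \<le> 1 / 6 * conductance \<omega> (b - 1)" by (auto simp: valley_def)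
  have "conductance \<omega> 0 \<le> (\<Sum>y<b - K. conductance \<omega> y)"
    using v(1) by (intro member_le_sum) (auto intro: less_imp_le conductance_pos)
  then have "1 \<le> 1 / 6 * conductance \<omega> (b - 1)" using v(2) by simp
  moreover have "conductance \<omega> (b - 1) < 1" using b(1) by (intro N) simp
  ultimately show False by simp
qed

lemma AE_limsup_max_local_time:
  assumes w: "w < 1/2" and M: "1/2 < M"
    and wM: "\<And>x. 1 \<le> x \<Longrightarrow> w \<le> \<omega> x \<and> \<omega> x \<le> M"
    and valleys: "\<And>j::nat. \<exists>K \<alpha> \<beta>. 0 \<le> \<alpha> \<and> 0 \<le> \<beta> \<and> (\<forall>N. \<exists>b\<ge>N. \<exists>d. valley \<omega> K \<alpha> \<beta> (return_time w M + 1 / real (Suc j)) ((1 / real (Suc j)) ^ 3 / 6) b d)"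
  shows "AE X in Q. limsup (\<lambda>n. ereal (real (max_local_time X n) / real n)) = ereal (1 / return_time w M)"
proof -
  define \<theta> where "\<theta> = return_time w M"
  have theta: "0 < \<theta>" unfolding \<theta>_def by (rule return_time_pos[OF w M])
  have val: "\<exists>K \<alpha> \<beta>. 0 \<le> \<alpha> \<and> 0 \<le> \<beta> \<and> (\<forall>N. \<exists>b\<ge>N. \<exists>d. valley \<omega> K \<alpha> \<beta> (\<theta> + \<epsilon>) (\<epsilon> ^ 3 / 6) b d)" if "0 < \<epsilon>" for \<epsilon>
  proof -
    obtain j where "inverse (real (Suc j)) < \<epsilon>" using reals_Archimedean[OF \<open>0 < \<epsilon>\<close>] by blast
    then have j: "1 / real (Suc j) \<le> \<epsilon>" by (simp add: inverse_eq_divide)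
    have j3: "(1 / real (Suc j)) ^ 3 / 6 \<le> \<epsilon> ^ 3 / 6" using j by (intro divide_right_mono power_mono) auto
    obtain K \<alpha> \<beta> where k: "0 \<le> \<alpha>" "0 \<le> \<beta>" "\<forall>N. \<exists>b\<ge>N. \<exists>d. valley \<omega> K \<alpha> \<beta> (return_time w M + 1 / real (Suc j)) ((1 / real (Suc j)) ^ 3 / 6) b d"
      using valleys by blast
    have "\<forall>N. \<exists>b\<ge>N. \<exists>d. valley \<omega> K \<alpha> \<beta> (\<theta> + \<epsilon>) (\<epsilon> ^ 3 / 6) b d"
      using k(3) valley_mono[OF _ _ j3, of K \<alpha> \<beta> "return_time w M + 1 / real (Suc j)" _ _ "\<theta> + \<epsilon>"] j unfolding \<theta>_def by (meson add_left_mono)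
    then show ?thesis using k by blast
  qed
  obtain K \<alpha> \<beta> where "\<forall>N. \<exists>b\<ge>N. \<exists>d. valley \<omega> K \<alpha> \<beta> (\<theta> + 1) (1 ^ 3 / 6) b d" using val[of 1] by auto
  then have div: "\<exists>L. R < (\<Sum>k<L. conductance \<omega> k)" for R by (intro conductance_diverges[of K \<alpha> \<beta> "\<theta> + 1"]) simp
  have U: "AE X in Q. \<forall>j::nat. \<forall>\<^sub>F n in sequentially. \<theta> * real (max_local_time X n) \<le> (1 + 1 / real (Suc j)) * real n"
    unfolding AE_all_countable
    by (intro allI max_local_time_upper[OF wM w M _ _ div]) (use theta return_time_le[OF w M] in \<open>auto simp: \<theta>_def\<close>)
  have L: "AE X in Q. \<forall>j::nat. \<exists>\<^sub>F n in sequentially. (1 - 1 / real (Suc j)) * real n \<le> \<theta> * real (max_local_time X n)"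
    unfolding AE_all_countable by (intro allI max_local_time_lower[OF theta _ val]) auto
  show ?thesis using U L
  proof eventually_elim
    case (elim X)
    show ?case unfolding \<theta>_def[symmetric]
    proof (rule limsup_eqI)
      show "0 < 1 / \<theta>" using theta by simp
      fix j :: nat
      show "\<forall>\<^sub>F n in sequentially. real (max_local_time X n) / real n \<le> (1 + 1 / real (Suc j)) * (1 / \<theta>)"
        using spec[OF elim(1), of j] eventually_gt_at_top[of 0]
      proof eventually_elim
        case (elim n)
        then show ?case using theta by (simp add: pos_divide_le_eq pos_le_divide_eq mult.commute)
      qed
      show "\<exists>\<^sub>F n in sequentially. (1 - 1 / real (Suc j)) * (1 / \<theta>) \<le> real (max_local_time X n) / real n"
        using frequently_eventually_conj[OF spec[OF elim(2), of j] eventually_gt_at_top[of 0]]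
      proof (rule frequently_elim1)
        fix n assume "0 < n \<and> (1 - 1 / real (Suc j)) * real n \<le> \<theta> * real (max_local_time X n)"
        then show "(1 - 1 / real (Suc j)) * (1 / \<theta>) \<le> real (max_local_time X n) / real n"
          using theta by (simp add: pos_divide_le_eq pos_le_divide_eq mult.commute)
      qed
    qed
  qed
qed

text \<open>Stated for \<open>path_space\<close>, as the event is to be the second side of a rectangle for the joint law.\<close>

lemma limsup_event: "{X. limsup (\<lambda>n. ereal (real (max_local_time X n) / real n)) = c} \<in> sets path_space"
proof -
  have [measurable]: "(\<lambda>X. max_local_time X n) \<in> measurable Q (count_space UNIV)" for n
    using max_local_time_event by (intro measurableI) (auto simp: vimage_def)
  have "{X \<in> space Q. limsup (\<lambda>n. ereal (real (max_local_time X n) / real n)) = c} \<in> sets Q"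
    by measurable
  then show ?thesis by (simp add: sets_Q)
qed

end

section \<open>From the law of the environment to the theorem\<close>

text \<open>The standing assumptions on the environment, with the ellipticity constant fixed.\<close>

locale sinai_environment =
  fixes P :: "(int \<Rightarrow> real) measure" and M w \<delta> :: real
  assumes env: "iid_env_law P"
    and recurrent: "(\<integral>\<omega>. ln (\<rho> 0 \<omega>) \<partial>P) = 0"
    and delta: "0 < \<delta>" "\<delta> < 1" and elliptic: "\<P>(\<omega> in P. \<delta> \<le> \<omega> 0 \<and> \<omega> 0 \<le> 1 - \<delta>) = 1"
    and nondegenerate: "prob_space.variance P (\<lambda>\<omega>. ln (\<rho> 0 \<omega>)) > 0"
    and M: "M = Sup (topological_support (distr P borel (\<lambda>\<omega>. \<omega> 0)))"
    and w: "w = Inf (topological_support (distr P borel (\<lambda>\<omega>. \<omega> 0)))"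
begin

sublocale Env: prob_space P using env by (simp add: iid_env_law_def)

definition \<nu> :: "real measure" where "\<nu> = distr P borel (\<lambda>\<omega>. \<omega> 0)"

lemma space_P: "\<omega> \<in> space P \<longleftrightarrow> (\<forall>x. 0 < \<omega> x \<and> \<omega> x < 1)"
proof -
  have "space P = space env_space" using env by (intro sets_eq_imp_space_eq) (simp add: iid_env_law_def)
  then show ?thesis by (auto simp: env_space_def space_PiM space_restrict_space PiE_iff)
qed

lemma coordinate_P [measurable]: "(\<lambda>\<omega>. \<omega> x) \<in> borel_measurable P"
proof -
  have "Env.indep_vars (\<lambda>_. borel) (\<lambda>x \<omega>. \<omega> x) UNIV" using env by (simp add: iid_env_law_def)
  then show ?thesis by (simp add: Env.indep_vars_def)
qed

sublocale nu: prob_space \<nu> unfolding \<nu>_def by (rule Env.prob_space_distr) measurable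

lemma sets_nu [measurable_cong, simp]: "sets \<nu> = sets borel" by (simp add: \<nu>_def)

lemma space_nu [simp]: "space \<nu> = UNIV" by (simp add: \<nu>_def)

lemma AE_delta: "AE s in \<nu>. \<delta> \<le> s \<and> s \<le> 1 - \<delta>"
proof -
  have "AE \<omega> in P. \<omega> \<in> {\<omega> \<in> space P. \<delta> \<le> \<omega> 0 \<and> \<omega> 0 \<le> 1 - \<delta>}" by (rule Env.AE_prob_1[OF elliptic])
  then have "AE \<omega> in P. \<delta> \<le> \<omega> 0 \<and> \<omega> 0 \<le> 1 - \<delta>" by (rule eventually_mono) auto
  then show ?thesis unfolding \<nu>_def by (subst AE_distr_iff) auto
qed

lemma delta_half: "\<delta> \<le> 1 - \<delta>"
proof -
  from nu.not_empty have "\<exists>s. \<delta> \<le> s \<and> s \<le> 1 - \<delta>"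
    using eventually_happens'[OF _ AE_delta] nu.ae_filter_bot by auto
  then show ?thesis by auto
qed

lemma support_bounds: "topological_support \<nu> \<subseteq> {\<delta>..1 - \<delta>}" "topological_support \<nu> \<noteq> {}"
proof -
  show "topological_support \<nu> \<subseteq> {\<delta>..1 - \<delta>}"
  proof (rule ccontr)
    assume "\<not> ?thesis"
    then obtain s where s: "s \<in> topological_support \<nu>" "s \<notin> {\<delta>..1 - \<delta>}" by blast
    have "open (- {\<delta>..1 - \<delta>})" by (intro open_Compl) simp
    then have "0 < emeasure \<nu> (- {\<delta>..1 - \<delta>})" using s unfolding topological_support_def by blast
    moreover have "AE x in \<nu>. \<not> x \<in> - {\<delta>..1 - \<delta>}" using AE_delta by (rule eventually_mono) simp
    then have "emeasure \<nu> {x \<in> space \<nu>. x \<in> - {\<delta>..1 - \<delta>}} = 0"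
      by (rule emeasure_eq_0_AE)
    then have "emeasure \<nu> (- {\<delta>..1 - \<delta>}) = 0" by (simp add: Collect_neg_eq[symmetric] Compl_eq)
    ultimately show False by simp
  qed
  show "topological_support \<nu> \<noteq> {}"
  proof -
    have "\<exists>s. s \<in> topological_support \<nu>"
      using nu.ae_filter_bot AE_topological_support[OF sets_nu] by (rule eventually_happens')
    then show ?thesis by blast
  qed
qed

lemma M_w_eq: "M = Sup (topological_support \<nu>)" "w = Inf (topological_support \<nu>)"
  unfolding \<nu>_def by (rule M, rule w)

lemma support_bdd: "bdd_above (topological_support \<nu>)" "bdd_below (topological_support \<nu>)"
  by (rule bdd_above_mono[OF bdd_above_Icc support_bounds(1)], rule bdd_below_mono[OF bdd_below_Icc support_bounds(1)])

lemma M_le: "M \<le> 1 - \<delta>" and w_ge: "\<delta> \<le> w"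
proof -
  show "M \<le> 1 - \<delta>" unfolding M_w_eq using support_bounds(1) by (intro cSup_least support_bounds(2)) auto
  show "\<delta> \<le> w" unfolding M_w_eq using support_bounds(1) by (intro cInf_greatest support_bounds(2)) auto
qed

lemma AE_w_M: "AE s in \<nu>. w \<le> s \<and> s \<le> M"
  using AE_topological_support[OF sets_nu]
proof (rule AE_mp, intro AE_I2 impI)
  fix s assume "s \<in> topological_support \<nu>"
  then show "w \<le> s \<and> s \<le> M" unfolding M_w_eq
    by (intro conjI cInf_lower cSup_upper support_bdd)
qed

lemma prob_near_M: "0 < \<eta> \<Longrightarrow> 0 < measure \<nu> {s. M - \<eta> \<le> s \<and> s \<le> M}"
proof -
  assume "0 < \<eta>"
  then have "M - \<eta> < Sup (topological_support \<nu>)" unfolding M_w_eq(1)[symmetric] by simp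
  then obtain s where s: "s \<in> topological_support \<nu>" "M - \<eta> < s"
    using less_cSup_iff[OF support_bounds(2) support_bdd(1)] by blast
  have "open {M - \<eta><..}" "s \<in> {M - \<eta><..}" using s by auto
  then have "0 < emeasure \<nu> {M - \<eta><..}" using s(1) unfolding topological_support_def by blast
  also have "emeasure \<nu> {M - \<eta><..} \<le> emeasure \<nu> {s. M - \<eta> \<le> s \<and> s \<le> M}"
  proof (rule emeasure_mono_AE)
    show "AE s in \<nu>. s \<in> {M - \<eta><..} \<longrightarrow> s \<in> {s. M - \<eta> \<le> s \<and> s \<le> M}" using AE_w_M by (rule eventually_mono) auto
  qed simp
  finally show ?thesis by (simp add: nu.emeasure_eq_measure)
qed

lemma prob_near_w: "0 < \<eta> \<Longrightarrow> 0 < measure \<nu> {s. w \<le> s \<and> s \<le> w + \<eta>}"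
proof -
  assume "0 < \<eta>"
  then have "Inf (topological_support \<nu>) < w + \<eta>" unfolding M_w_eq(2)[symmetric] by simp
  then obtain s where s: "s \<in> topological_support \<nu>" "s < w + \<eta>"
    using cInf_less_iff[OF support_bounds(2) support_bdd(2)] by blast
  have "open {..<w + \<eta>}" "s \<in> {..<w + \<eta>}" using s by auto
  then have "0 < emeasure \<nu> {..<w + \<eta>}" using s(1) unfolding topological_support_def by blast
  also have "emeasure \<nu> {..<w + \<eta>} \<le> emeasure \<nu> {s. w \<le> s \<and> s \<le> w + \<eta>}"
  proof (rule emeasure_mono_AE)
    show "AE s in \<nu>. s \<in> {..<w + \<eta>} \<longrightarrow> s \<in> {s. w \<le> s \<and> s \<le> w + \<eta>}" using AE_w_M by (rule eventually_mono) auto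
  qed simp
  finally show ?thesis by (simp add: nu.emeasure_eq_measure)
qed

text \<open>Truncation to the range of the environment makes \<open>log \<rho>\<close> bounded everywhere; on almost every
  environment it changes nothing.\<close>

definition clamp :: "real \<Rightarrow> real" where "clamp s = max \<delta> (min (1 - \<delta>) s)"
definition \<xi> :: "real \<Rightarrow> real" where "\<xi> s = ln ((1 - clamp s) / clamp s)"

lemma clamp_eq: "\<delta> \<le> s \<Longrightarrow> s \<le> 1 - \<delta> \<Longrightarrow> clamp s = s"
  by (simp add: clamp_def)

lemma xi_measurable [measurable]: "\<xi> \<in> borel_measurable borel"
  unfolding \<xi>_def clamp_def by measurable

lemma xi_bound: "\<bar>\<xi> s\<bar> \<le> ln ((1 - \<delta>) / \<delta>)"
proof -
  have c: "\<delta> \<le> clamp s" "clamp s \<le> 1 - \<delta>" using delta_half by (auto simp: clamp_def)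
  have p: "0 < clamp s" "0 < 1 - clamp s" using c delta by linarith+
  have "(1 - clamp s) / clamp s \<le> (1 - \<delta>) / \<delta>" "clamp s / (1 - clamp s) \<le> (1 - \<delta>) / \<delta>"
    using c delta by (intro frac_le; linarith)+
  moreover have "0 < (1 - clamp s) / clamp s" "0 < clamp s / (1 - clamp s)"
    using p by (rule_tac [!] divide_pos_pos)
  ultimately have "ln ((1 - clamp s) / clamp s) \<le> ln ((1 - \<delta>) / \<delta>)" "ln (clamp s / (1 - clamp s)) \<le> ln ((1 - \<delta>) / \<delta>)"
    by (blast intro: ln_mono)+
  moreover have "ln (clamp s / (1 - clamp s)) = - ln ((1 - clamp s) / clamp s)"
    using p by (simp add: ln_div)
  ultimately show ?thesis by (simp add: \<xi>_def abs_le_iff)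
qed

lemma AE_xi: "AE s in \<nu>. \<xi> s = ln ((1 - s) / s)"
  using AE_delta by (rule eventually_mono) (auto simp: \<xi>_def clamp_eq)

lemma log_ratio_measurable: "(\<lambda>s. ln ((1 - s) / s)) \<in> borel_measurable (borel :: real measure)"
  by measurable

lemma measurable_nu: "f \<in> borel_measurable borel \<Longrightarrow> f \<in> borel_measurable \<nu>" for f :: "real \<Rightarrow> real"
  by (simp only: measurable_cong_sets[OF sets_nu refl])

lemma xi_centred: "(\<integral>s. \<xi> s \<partial>\<nu>) = 0"
proof -
  have "(\<integral>s. \<xi> s \<partial>\<nu>) = (\<integral>s. ln ((1 - s) / s) \<partial>\<nu>)"
    by (rule integral_cong_AE[OF measurable_nu[OF xi_measurable] measurable_nu[OF log_ratio_measurable] AE_xi])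
  also have "\<dots> = (\<integral>\<omega>. ln (\<rho> 0 \<omega>) \<partial>P)"
    unfolding \<nu>_def \<rho>_def by (rule integral_distr[OF coordinate_P log_ratio_measurable])
  finally show ?thesis unfolding recurrent .
qed

lemma xi_nonzero: "0 < (\<integral>s. (\<xi> s)\<^sup>2 \<partial>\<nu>)"
proof -
  have sq: "AE s in \<nu>. (\<xi> s)\<^sup>2 = (ln ((1 - s) / s))\<^sup>2" using AE_xi by (rule eventually_mono) (simp only:)
  have m1: "(\<lambda>s. (\<xi> s)\<^sup>2) \<in> borel_measurable borel" by (rule borel_measurable_power[OF xi_measurable])
  have m2: "(\<lambda>s. (ln ((1 - s) / s))\<^sup>2) \<in> borel_measurable (borel :: real measure)" by (rule borel_measurable_power[OF log_ratio_measurable])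
  have "(\<integral>s. (\<xi> s)\<^sup>2 \<partial>\<nu>) = (\<integral>s. (ln ((1 - s) / s))\<^sup>2 \<partial>\<nu>)"
    by (rule integral_cong_AE[OF measurable_nu[OF m1] measurable_nu[OF m2] sq])
  also have "\<dots> = (\<integral>\<omega>. (ln (\<rho> 0 \<omega>))\<^sup>2 \<partial>P)"
    unfolding \<nu>_def \<rho>_def by (rule integral_distr[OF coordinate_P m2])
  finally show ?thesis using nondegenerate unfolding recurrent diff_zero by (simp only:)
qed

sublocale bounded_centred \<nu> \<xi> "ln ((1 - \<delta>) / \<delta>)"
  by unfold_locales (auto simp: xi_bound xi_centred xi_nonzero)

lemma xi_sign:
  assumes "\<delta> \<le> s" "s \<le> 1 - \<delta>"
  shows "1/2 \<le> s \<Longrightarrow> \<xi> s \<le> 0" "s \<le> 1/2 \<Longrightarrow> 0 \<le> \<xi> s"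
proof -
  have p: "0 < s" "0 < 1 - s" using assms delta by linarith+
  then have q: "0 < (1 - s) / s" by (rule_tac divide_pos_pos)
  have e: "\<xi> s = ln ((1 - s) / s)" using assms by (simp only: \<xi>_def clamp_eq)
  show "\<xi> s \<le> 0" if "1/2 \<le> s"
  proof -
    have "(1 - s) / s \<le> 1" using that p(1) by (simp add: pos_divide_le_eq)
    then show ?thesis unfolding e using ln_le_zero_iff[OF q] by blast
  qed
  show "0 \<le> \<xi> s" if "s \<le> 1/2"
  proof -
    have "1 \<le> (1 - s) / s" using that p(1) by (simp add: pos_le_divide_eq)
    then show ?thesis unfolding e using ln_ge_zero_iff[OF q] by blast
  qed
qed

text \<open>Otherwise \<open>log \<rho> \<ge> 0\<close> almost surely, and the vanishing mean would force \<open>log \<rho> = 0\<close>, against the positive variance.\<close>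

lemma M_gt: "1/2 < M"
proof (rule ccontr)
  assume M2: "\<not> 1/2 < M"
  have nn: "AE s in \<nu>. 0 \<le> \<xi> s" using AE_w_M AE_delta
  proof eventually_elim
    case (elim s)
    then have "\<delta> \<le> s" "s \<le> 1 - \<delta>" "s \<le> 1/2" using M2 by linarith+
    then show ?case by (rule xi_sign(2))
  qed
  have "AE s in \<nu>. \<xi> s = 0" using integral_nonneg_eq_0_iff_AE[OF integrable_xi nn] centred by blast
  then show False using xi_nonzero_AE by blast
qed

lemma w_lt: "w < 1/2"
proof (rule ccontr)
  assume w2: "\<not> w < 1/2"
  have nn: "AE s in \<nu>. 0 \<le> - \<xi> s" using AE_w_M AE_delta
  proof eventually_elim
    case (elim s)
    then have "\<delta> \<le> s" "s \<le> 1 - \<delta>" "1/2 \<le> s" using w2 by linarith+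
    then have "\<xi> s \<le> 0" by (rule xi_sign(1))
    then show ?case by linarith
  qed
  have "(\<integral>s. - \<xi> s \<partial>\<nu>) = 0" using centred by simp
  then have "AE s in \<nu>. - \<xi> s = 0"
    using integral_nonneg_eq_0_iff_AE[OF Bochner_Integration.integrable_minus[OF integrable_xi] nn] by blast
  then have "AE s in \<nu>. \<xi> s = 0" by (rule eventually_mono) linarith
  then show False using xi_nonzero_AE by blast
qed

text \<open>Valleys are properties of the environment on the nonnegative half-line, where it is an i.i.d.
  sequence indexed by the natural numbers.\<close>

lemma distr_environment: "(\<lambda>\<omega> n. \<omega> (int n)) \<in> measurable P iid" "distr P iid (\<lambda>\<omega> n. \<omega> (int n)) = iid"
proof -
  have ps: "prob_space \<nu>" by (rule nu.prob_space_axioms)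
  have ind: "Env.indep_vars (\<lambda>_. borel) (\<lambda>x \<omega>. \<omega> x) UNIV" using env by (simp add: iid_env_law_def)
  have same: "distr P borel (\<lambda>\<omega>. \<omega> x) = \<nu>" for x using env by (simp add: iid_env_law_def \<nu>_def)
  have setsI: "sets (Pi\<^sub>M UNIV (\<lambda>_::int. borel)) = sets (Pi\<^sub>M UNIV (\<lambda>_::int. \<nu>))"
    by (rule sets_PiM_cong) auto
  have m1: "(\<lambda>\<omega>. \<omega>) \<in> measurable P (Pi\<^sub>M UNIV (\<lambda>_::int. \<nu>))"
    by (rule measurable_PiM_single') (auto simp: space_PiM measurable_cong_sets[OF refl sets_nu])
  have "distr P (Pi\<^sub>M UNIV (\<lambda>_::int. \<nu>)) (\<lambda>\<omega>. \<omega>) = distr P (Pi\<^sub>M UNIV (\<lambda>_::int. borel)) (\<lambda>\<omega>. \<lambda>x\<in>UNIV. \<omega> x)"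
    by (rule distr_cong) (auto simp: setsI)
  also have "\<dots> = Pi\<^sub>M UNIV (\<lambda>x. distr P borel (\<lambda>\<omega>. \<omega> x))"
    using ind by (subst (asm) Env.indep_vars_iff_distr_eq_PiM) auto
  also have "\<dots> = Pi\<^sub>M UNIV (\<lambda>_. \<nu>)" by (simp add: same)
  finally have d1: "distr P (Pi\<^sub>M UNIV (\<lambda>_::int. \<nu>)) (\<lambda>\<omega>. \<omega>) = Pi\<^sub>M UNIV (\<lambda>_. \<nu>)" .
  have m2: "(\<lambda>\<omega> n. \<omega> (int n)) \<in> measurable (Pi\<^sub>M UNIV (\<lambda>_::int. \<nu>)) iid"
    unfolding iid_def by (rule measurable_PiM_single') (auto simp: space_PiM)
  have d2: "distr (Pi\<^sub>M UNIV (\<lambda>_::int. \<nu>)) iid (\<lambda>\<omega> n. \<omega> (int n)) = iid"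
    using distr_PiM_reindex[of UNIV "\<lambda>_. \<nu>" int UNIV] ps by (simp add: iid_def restrict_UNIV)
  show "(\<lambda>\<omega> n. \<omega> (int n)) \<in> measurable P iid" using measurable_compose[OF m1 m2] by simp
  have "distr P iid (\<lambda>\<omega> n. \<omega> (int n)) = distr (distr P (Pi\<^sub>M UNIV (\<lambda>_::int. \<nu>)) (\<lambda>\<omega>. \<omega>)) iid (\<lambda>\<omega> n. \<omega> (int n))"
    by (subst distr_distr[OF m2 m1]) (simp add: comp_def)
  then show "distr P iid (\<lambda>\<omega> n. \<omega> (int n)) = iid" by (simp add: d1 d2)
qed

lemma AE_coordinates: "AE \<omega> in P. \<forall>x. w \<le> \<omega> x \<and> \<omega> x \<le> M"
proof -
  have "AE \<omega> in P. w \<le> \<omega> x \<and> \<omega> x \<le> M" for x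
  proof -
    have e: "distr P borel (\<lambda>\<omega>. \<omega> x) = \<nu>" using env by (simp add: iid_env_law_def \<nu>_def)
    have "AE s in distr P borel (\<lambda>\<omega>. \<omega> x). w \<le> s \<and> s \<le> M" unfolding e by (rule AE_w_M)
    then show ?thesis by (rule AE_distrD[rotated]) measurable
  qed
  then show ?thesis by (simp add: AE_all_countable)
qed

text \<open>The sets for the pattern are small neighbourhoods of \<open>M\<close> and of \<open>w\<close>, which have positive probability
  because \<open>M\<close> and \<open>w\<close> are the ends of the support.\<close>

lemma AE_valleys:
  assumes eps: "0 < \<epsilon>" and gam: "0 < \<gamma>"
  shows "\<exists>K \<alpha> \<beta>. 0 \<le> \<alpha> \<and> 0 \<le> \<beta> \<and> (AE \<omega> in P. \<forall>N. \<exists>b\<ge>N. \<exists>d. valley \<omega> K \<alpha> \<beta> (return_time w M + \<epsilon>) \<gamma> b d)"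
proof -
  obtain \<eta> where e: "0 < \<eta>" "M - \<eta> > 1/2" "w + \<eta> < 1/2"
    and alt: "(\<forall>s. M - \<eta> \<le> s \<and> s \<le> M \<longrightarrow> 1 + s / (1 - 2 * (w + \<eta>)) + (1 - s) / (2 * (M - \<eta>) - 1) \<le> return_time w M + \<epsilon>) \<or>
     (\<forall>s. w \<le> s \<and> s \<le> w + \<eta> \<longrightarrow> 1 + s / (1 - 2 * (w + \<eta>)) + (1 - s) / (2 * (M - \<eta>) - 1) \<le> return_time w M + \<epsilon>)"
    using return_time_approx[OF w_lt M_gt eps] by blast
  define \<alpha> where "\<alpha> = 1 / (1 - 2 * (w + \<eta>))"
  define \<beta> where "\<beta> = 1 / (2 * (M - \<eta>) - 1)"
  have ab: "0 < \<alpha>" "0 < \<beta>" "\<alpha> * (1 - 2 * (w + \<eta>)) = 1" "\<beta> * (2 * (M - \<eta>) - 1) = 1"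
    using e by (auto simp: \<alpha>_def \<beta>_def)
  define AL where "AL = {s. M - \<eta> \<le> s \<and> s \<le> M}"
  define AR where "AR = {s. w \<le> s \<and> s \<le> w + \<eta>}"
  obtain A0 where A0: "A0 = AL \<or> A0 = AR" "\<And>s. s \<in> A0 \<Longrightarrow> 1 + \<alpha> * s + \<beta> * (1 - s) \<le> return_time w M + \<epsilon>"
    using alt by (auto simp: AL_def AR_def \<alpha>_def \<beta>_def)
  define \<kappa> where "\<kappa> = min (- ln ((1 - (M - \<eta>)) / (M - \<eta>))) (ln ((1 - (w + \<eta>)) / (w + \<eta>)))"
  have bnds: "M - \<eta> < 1" "0 < w" "M < 1" using M_le w_ge delta e by auto
  have kap: "0 < \<kappa>"
  proof -
    have "ln ((1 - (M - \<eta>)) / (M - \<eta>)) < 0" using e bnds by (intro ln_less_zero) (auto simp: divide_simps)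
    moreover have "0 < ln ((1 - (w + \<eta>)) / (w + \<eta>))" using e bnds by (intro ln_gt_zero) (auto simp: divide_simps)
    ultimately show ?thesis by (simp add: \<kappa>_def)
  qed
  have L: "\<xi> s \<le> - \<kappa>" if "s \<in> AL" for s
  proof -
    have s: "M - \<eta> \<le> s" "s \<le> M" using that by (auto simp: AL_def)
    have "clamp s = s" using s e M_le delta_half by (intro clamp_eq) auto
    then have "\<xi> s = ln ((1 - s) / s)" by (simp add: \<xi>_def)
    also have "\<dots> \<le> ln ((1 - (M - \<eta>)) / (M - \<eta>))" using s e bnds by (intro ln_mono frac_le divide_pos_pos) auto
    finally show ?thesis by (simp add: \<kappa>_def)
  qed
  have R: "\<kappa> \<le> \<xi> s" if "s \<in> AR" for s
  proof -
    have s: "w \<le> s" "s \<le> w + \<eta>" using that by (auto simp: AR_def)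
    have "clamp s = s" using s e w_ge delta_half by (intro clamp_eq) auto
    then have "\<xi> s = ln ((1 - s) / s)" by (simp add: \<xi>_def)
    moreover have "ln ((1 - (w + \<eta>)) / (w + \<eta>)) \<le> ln ((1 - s) / s)" using s e bnds by (intro ln_mono frac_le divide_pos_pos) auto
    ultimately show ?thesis by (simp add: \<kappa>_def)
  qed
  have mb: "AL \<in> sets borel" "AR \<in> sets borel" by (simp_all add: AL_def AR_def)
  interpret V: valley_pattern \<nu> \<xi> "ln ((1 - \<delta>) / \<delta>)" AL A0 AR \<kappa>
  proof unfold_locales
    show "A0 \<in> sets borel" using A0(1) mb by auto
    show "0 < measure \<nu> AL" "0 < measure \<nu> AR" using prob_near_M[OF e(1)] prob_near_w[OF e(1)] by (simp_all add: AL_def AR_def)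
    then show "0 < measure \<nu> A0" using A0(1) by auto
  qed (use mb kap L R in auto)
  obtain K where K: "AE u in iid. \<forall>n. \<exists>b\<ge>n. \<exists>d. V.deep_valley K \<gamma> u b d" using V.deep_valleys_recur[OF gam] by blast
  have "AE u in distr P iid (\<lambda>\<omega> n. \<omega> (int n)). \<forall>n. \<exists>b\<ge>n. \<exists>d. V.deep_valley K \<gamma> u b d"
    by (subst distr_environment(2)) (rule K)
  from AE_distrD[OF distr_environment(1) this]
  have "AE \<omega> in P. \<forall>n. \<exists>b\<ge>n. \<exists>d. V.deep_valley K \<gamma> (\<lambda>n. \<omega> (int n)) b d" .
  then have "AE \<omega> in P. \<forall>N. \<exists>b\<ge>N. \<exists>d. valley \<omega> K \<alpha> \<beta> (return_time w M + \<epsilon>) \<gamma> b d"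
    using AE_coordinates
  proof eventually_elim
    case (elim \<omega>)
    let ?u = "\<lambda>n. \<omega> (int n)"
    have c: "V.cond ?u k = conductance \<omega> k" for k
    proof -
      have "V.cond ?u k = (\<Prod>i=1..k. exp (- \<xi> (\<omega> (int i))))"
        unfolding V.cond_def by (simp add: sum_negf[symmetric] exp_sum)
      also have "\<dots> = conductance \<omega> k" unfolding conductance_def
      proof (rule prod.cong[OF refl])
        fix i
        have s: "w \<le> \<omega> (int i)" "\<omega> (int i) \<le> M" using elim(2) by auto
        have "clamp (\<omega> (int i)) = \<omega> (int i)" using s M_le w_ge by (intro clamp_eq) auto
        then show "exp (- \<xi> (\<omega> (int i))) = \<omega> (int i) / (1 - \<omega> (int i))"
          using s bnds by (simp add: \<xi>_def exp_minus)
      qed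
      finally show ?thesis .
    qed
    have c': "V.cond ?u = conductance \<omega>" using c by (rule ext)
    have "valley \<omega> K \<alpha> \<beta> (return_time w M + \<epsilon>) \<gamma> b d" if v: "V.deep_valley K \<gamma> ?u b d" for b d
    proof -
      have "\<alpha> * (2 * \<omega> (int y) - 1) \<le> - 1" if "b < y" "y \<le> b + K" for y
      proof -
        have "\<omega> (int y) \<in> AR" using v that by (auto simp: V.deep_valley_def)
        then have "\<alpha> * (1 - 2 * (w + \<eta>)) \<le> \<alpha> * (1 - 2 * \<omega> (int y))" using ab(1) by (intro mult_left_mono) (auto simp: AR_def)
        then show ?thesis using ab(3) by (simp add: algebra_simps)
      qed
      moreover have "\<beta> * (1 - 2 * \<omega> (int y)) \<le> - 1" if "b - K \<le> y" "y < b" for y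
      proof -
        have "\<omega> (int y) \<in> AL" using v that by (auto simp: V.deep_valley_def)
        then have "\<beta> * (2 * (M - \<eta>) - 1) \<le> \<beta> * (2 * \<omega> (int y) - 1)" using ab(2) by (intro mult_left_mono) (auto simp: AL_def)
        then show ?thesis using ab(4) by (simp add: algebra_simps)
      qed
      moreover have "1 + \<alpha> * \<omega> (int b) + \<beta> * (1 - \<omega> (int b)) \<le> return_time w M + \<epsilon>"
        using v by (intro A0(2)) (simp add: V.deep_valley_def)
      ultimately show ?thesis using v unfolding valley_def V.deep_valley_def c' by blast
    qed
    then show ?case using elim(1) by blast
  qed
  then show ?thesis using ab by (intro exI[of _ K] exI[of _ \<alpha>] exI[of _ \<beta>]) auto
qed

lemma AE_good_environment:
  "AE \<omega> in P. \<forall>j::nat. \<exists>K \<alpha> \<beta>. 0 \<le> \<alpha> \<and> 0 \<le> \<beta> \<and>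
     (\<forall>N. \<exists>b\<ge>N. \<exists>d. valley \<omega> K \<alpha> \<beta> (return_time w M + 1 / real (Suc j)) ((1 / real (Suc j)) ^ 3 / 6) b d)"
  unfolding AE_all_countable
proof
  fix j :: nat
  obtain K \<alpha> \<beta> where k: "0 \<le> \<alpha>" "0 \<le> \<beta>"
    "AE \<omega> in P. \<forall>N. \<exists>b\<ge>N. \<exists>d. valley \<omega> K \<alpha> \<beta> (return_time w M + 1 / real (Suc j)) ((1 / real (Suc j)) ^ 3 / 6) b d"
    using AE_valleys[of "1 / real (Suc j)" "(1 / real (Suc j)) ^ 3 / 6"] by auto
  show "AE \<omega> in P. \<exists>K \<alpha> \<beta>. 0 \<le> \<alpha> \<and> 0 \<le> \<beta> \<and>
     (\<forall>N. \<exists>b\<ge>N. \<exists>d. valley \<omega> K \<alpha> \<beta> (return_time w M + 1 / real (Suc j)) ((1 / real (Suc j)) ^ 3 / 6) b d)"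
    using k(3) by (rule eventually_mono) (use k(1,2) in blast)
qed

lemma AE_joint_limsup:
  assumes quenched: "\<And>\<omega>. \<omega> \<in> space P \<Longrightarrow> quenched_law \<omega> (Pq \<omega>)" and joint: "joint_law P Pq J"
  shows "AE (\<omega>, X) in J. limsup (\<lambda>n. ereal (real (max_local_time X n) / real n)) = ereal (1 / return_time w M)"
proof -
  let ?G = "{X. limsup (\<lambda>n. ereal (real (max_local_time X n) / real n)) = ereal (1 / return_time w M)}"
  have walk: "quenched_walk \<omega> (Pq \<omega>)" if "\<omega> \<in> space P" for \<omega>
    using quenched[OF that] that by unfold_locales (auto simp: space_P)
  obtain \<omega>0 where "\<omega>0 \<in> space P" using Env.not_empty by blast
  then have G: "?G \<in> sets path_space" using quenched_walk.limsup_event[OF walk] by blast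
  have one: "AE \<omega> in P. emeasure (Pq \<omega>) ?G = 1"
    using AE_coordinates AE_good_environment AE_space
  proof eventually_elim
    case (elim \<omega>)
    interpret W: quenched_walk \<omega> "Pq \<omega>" by (rule walk[OF elim(3)])
    have "AE X in Pq \<omega>. X \<in> ?G"
      using W.AE_limsup_max_local_time[OF w_lt M_gt _ spec[OF elim(2)]] elim(1) by simp
    moreover have "?G \<in> sets (Pq \<omega>)" using G W.sets_Q by simp
    ultimately show ?case by (intro W.Q.emeasure_eq_1_AE)
  qed
  interpret J: prob_space J using joint by (simp add: joint_law_def)
  have "emeasure J (space P \<times> ?G) = (\<integral>\<^sup>+\<omega>\<in>space P. emeasure (Pq \<omega>) ?G \<partial>P)"
    using joint G unfolding joint_law_def by blast
  also have "\<dots> = (\<integral>\<^sup>+\<omega>. 1 \<partial>P)"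
    by (rule nn_integral_cong_AE) (use one AE_space in \<open>eventually_elim, auto\<close>)
  also have "\<dots> = 1" by (simp add: Env.emeasure_space_1)
  finally have "J.prob (space P \<times> ?G) = 1" by (simp add: measure_def)
  from J.AE_prob_1[OF this] show ?thesis by (rule eventually_mono) auto
qed

end

theorem theorem1p1:
  fixes P :: "(int \<Rightarrow> real) measure"
    and Pq :: "(int \<Rightarrow> real) \<Rightarrow> (nat \<Rightarrow> nat) measure"
    and J :: "((int \<Rightarrow> real) \<times> (nat \<Rightarrow> nat)) measure"
    and M w :: real
  assumes env: "iid_env_law P"
    and quenched: "\<And>\<omega>. \<omega> \<in> space P \<Longrightarrow> quenched_law \<omega> (Pq \<omega>)"
    and joint: "joint_law P Pq J"
    and recurrent: "(\<integral>\<omega>. ln (\<rho> 0 \<omega>) \<partial>P) = 0"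
    and elliptic: "\<exists>\<delta>\<in>{0<..<1}. \<P>(\<omega> in P. \<delta> \<le> \<omega> 0 \<and> \<omega> 0 \<le> 1 - \<delta>) = 1"
    and nondegenerate: "prob_space.variance P (\<lambda>\<omega>. ln (\<rho> 0 \<omega>)) > 0"
    and M: "M = Sup (topological_support (distr P borel (\<lambda>\<omega>. \<omega> 0)))"
    and w: "w = Inf (topological_support (distr P borel (\<lambda>\<omega>. \<omega> 0)))"
  shows "M \<in> {1/2<..1} \<and> w \<in> {0..<1/2} \<and>
    (AE (\<omega>, X) in J.
       limsup (\<lambda>n. ereal (real (max_local_time X n) / real n)) =
         ereal ((2 * M - 1) * (1 - 2 * w) / (2 * (M - w) * min M (1 - w)))) \<and>
    (M = 1 - w \<longrightarrow>
       (AE (\<omega>, X) in J.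
          limsup (\<lambda>n. ereal (real (max_local_time X n) / real n)) =
            ereal ((2 * M - 1) / (2 * M))))"
proof -
  obtain \<delta> where \<delta>: "0 < \<delta>" "\<delta> < 1" "\<P>(\<omega> in P. \<delta> \<le> \<omega> 0 \<and> \<omega> 0 \<le> 1 - \<delta>) = 1"
    using elliptic by auto
  interpret sinai_environment P M w \<delta>
    by unfold_locales (rule env recurrent \<delta> nondegenerate M w)+
  have val: "1 / return_time w M = (2 * M - 1) * (1 - 2 * w) / (2 * (M - w) * min M (1 - w))"
    by (simp add: return_time_def)
  have val2: "(2 * M - 1) * (1 - 2 * w) / (2 * (M - w) * min M (1 - w)) = (2 * M - 1) / (2 * M)" if "M = 1 - w"
  proof -
    have e: "1 - 2 * w = 2 * M - 1" "M - w = 2 * M - 1" "min M (1 - w) = M" using that by auto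
    have cancel: "x * x / (2 * x * M) = x / (2 * M)" if "x \<noteq> 0" for x using that by simp
    show ?thesis unfolding e by (rule cancel) (use M_gt in simp)
  qed
  note lim = AE_joint_limsup[OF quenched joint, unfolded val]
  show ?thesis
  proof (intro conjI impI)
    show "M \<in> {1/2<..1}" "w \<in> {0..<1/2}" using M_gt M_le w_lt w_ge \<delta>(1) by auto
    show "AE (\<omega>, X) in J. limsup (\<lambda>n. ereal (real (max_local_time X n) / real n)) =
         ereal ((2 * M - 1) * (1 - 2 * w) / (2 * (M - w) * min M (1 - w)))"
      by (rule lim)
    assume symmetric: "M = 1 - w"
    show "AE (\<omega>, X) in J. limsup (\<lambda>n. ereal (real (max_local_time X n) / real n)) = ereal ((2 * M - 1) / (2 * M))"
      using lim unfolding val2[OF symmetric] .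
  qed
qed

end
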